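(* Let $\Gamma=(V,E)$ be a finite graph, let $\{G_v\}_{v\in V}$ be a family of non-trivial finite abelian groups, and let $W=W(\Gamma,\{G_v\}_{v\in V})$ be their graph product. For $k\ge 1$ let $Z_k=\mathbb{Z}/2\ast\dots\ast\mathbb{Z}/2$ be the $k$-fold free product of groups of order two. Assume that there is no partition $V=V_1\sqcup\dots\sqcup V_\ell$ ($\ell\ge1$, all $V_i$ non-empty) such that the natural map $W_{\Gamma_{V_1}}\times\dots\times W_{\Gamma_{V_\ell}}\to W$ is an isomorphism and each $W_{\Gamma_{V_i}}$ is either isomorphic to $Z_k$ for some $k\ge1$ or finite abelian. Then $W$ admits infinitely many linearly independent homogeneous Aut-invariant quasimorphisms.
   Context: A finite graph $\Gamma=(V,E)$ consists of a non-empty finite vertex set $V$ and a set $E$ of 2-element subsets of $V$. For $X\subset V$, $\Gamma_X$ is the full subgraph spanned by $X$. Given non-trivial groups $\{G_v\}_{v\in V}$, the graph product is $W(\Gamma,\{G_v\}_{v\in V})=(\ast_{v\in V}G_v)/N$ where $N$ is the normal subgroup generated by all commutators $[G_x,G_y]$ with $\{x,y\}\in E$. For non-empty $X\subset V$, $W_{\Gamma_X}$ denotes the graph product on $\Gamma_X$ with vertex groups $\{G_v\}_{v\in X}$, viewed as the subgroup of $W$ generated by the $G_v$, $v\in X$. A quasimorphism on a group $G$ is a map $\psi\colon G\to\mathbb{R}$ with $\sup_{g,h}|\psi(g)+\psi(h)-\psi(gh)|<\infty$; homogeneous means $\psi(g^n)=n\psi(g)$ for all $g\in G$, $n\in\mathbb{Z}$;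 Aut-invariant means $\psi\circ\varphi=\psi$ for all automorphisms $\varphi$ of $G$. Linear independence is in the real vector space of functions $G\to\mathbb{R}$. *)

theory Defs
  imports Complex_Main "HOL-Algebra.Algebra"
begin

section \<open>Finite simple graphs\<close>

definition finite_graph :: "'v set \<Rightarrow> 'v set set \<Rightarrow> bool" where
  "finite_graph V E \<longleftrightarrow> finite V \<and> V \<noteq> {} \<and>
     (\<forall>e\<in>E. \<exists>x y. e = {x, y} \<and> x \<noteq> y \<and> x \<in> V \<and> y \<in> V)"

section \<open>Graph products via the standard monoid presentation\<close>

text \<open>Words in the generators: letters (v, a) with v a vertex and a in the carrier of G v.\<close>

definition gp_words :: "'v set \<Rightarrow> ('v \<Rightarrow> ('g, 'b) monoid_scheme) \<Rightarrow> ('v \<times> 'g) list set" where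
  "gp_words V G = {w. \<forall>(v, a) \<in> set w. v \<in> V \<and> a \<in> carrier (G v)}"

text \<open>Elementary moves: delete an identity letter, merge two adjacent letters of the
  same vertex group, swap two adjacent letters whose vertices are joined by an edge.
  These are exactly the defining relations of the free product modulo the
  commutators [G_x, G_y] for edges {x,y}.\<close>

inductive gp_step :: "'v set set \<Rightarrow> ('v \<Rightarrow> ('g, 'b) monoid_scheme)
    \<Rightarrow> ('v \<times> 'g) list \<Rightarrow> ('v \<times> 'g) list \<Rightarrow> bool"
  for E G where
  del: "gp_step E G (xs @ (v, \<one>\<^bsub>G v\<^esub>) # ys) (xs @ ys)"
| merge: "gp_step E G (xs @ (v, a) # (v, b) # ys) (xs @ (v, a \<otimes>\<^bsub>G v\<^esub> b) # ys)"
| swap: "{v, u} \<in> E \<Longrightarrow> gp_step E G (xs @ (v, a) # (u, b) # ys) (xs @ (u, b) # (v, a) # ys)"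

definition gp_rel :: "'v set \<Rightarrow> 'v set set \<Rightarrow> ('v \<Rightarrow> ('g, 'b) monoid_scheme)
    \<Rightarrow> (('v \<times> 'g) list \<times> ('v \<times> 'g) list) set" where
  "gp_rel V E G = Restr ((Restr ({(x, y). gp_step E G x y} \<union> {(y, x). gp_step E G x y}) (gp_words V G))\<^sup>*) (gp_words V G)"

definition gp_class :: "'v set \<Rightarrow> 'v set set \<Rightarrow> ('v \<Rightarrow> ('g, 'b) monoid_scheme)
    \<Rightarrow> ('v \<times> 'g) list \<Rightarrow> ('v \<times> 'g) list set" where
  "gp_class V E G w = gp_rel V E G `` {w}"

text \<open>The graph product W(\<Gamma>, {G_v}): equivalence classes of words, product = concatenation.\<close>

definition graph_product :: "'v set \<Rightarrow> 'v set set \<Rightarrow> ('v \<Rightarrow> ('g, 'b) monoid_scheme)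
    \<Rightarrow> ('v \<times> 'g) list set monoid" where
  "graph_product V E G =
     \<lparr>carrier = gp_words V G // gp_rel V E G,
      monoid.mult = (\<lambda>A1 A2. gp_class V E G ((SOME x. x \<in> A1) @ (SOME y. y \<in> A2))),
      one = gp_class V E G []\<rparr>"

text \<open>Canonical image of the vertex group G v in the graph product.\<close>

definition gp_incl :: "'v set \<Rightarrow> 'v set set \<Rightarrow> ('v \<Rightarrow> ('g, 'b) monoid_scheme)
    \<Rightarrow> 'v \<Rightarrow> 'g \<Rightarrow> ('v \<times> 'g) list set" where
  "gp_incl V E G v a = gp_class V E G [(v, a)]"

text \<open>W_{\<Gamma>_X} viewed as the subgroup of W generated by the G_v, v in X.\<close>

definition gp_sub :: "'v set \<Rightarrow> 'v set set \<Rightarrow> ('v \<Rightarrow> ('g, 'b) monoid_scheme)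
    \<Rightarrow> 'v set \<Rightarrow> ('v \<times> 'g) list set monoid" where
  "gp_sub V E G S = (graph_product V E G)
     \<lparr>carrier := generate (graph_product V E G) (\<Union>v\<in>S. gp_incl V E G v ` carrier (G v))\<rparr>"

text \<open>Z_k: the k-fold free product of groups of order two
  (graph product over the edgeless graph on k vertices).\<close>

definition Zk :: "nat \<Rightarrow> (nat \<times> int) list set monoid" where
  "Zk k = graph_product {..<k} {} (\<lambda>_. integer_mod_group 2)"

text \<open>Natural multiplication map W_1 \<times> ... \<times> W_l \<rightarrow> W, (w_0,...,w_{l-1}) \<mapsto> w_0 \<cdots> w_{l-1}.\<close>

definition ordered_prod :: "('a, 'b) monoid_scheme \<Rightarrow> nat \<Rightarrow> (nat \<Rightarrow> 'a) \<Rightarrow> 'a" where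
  "ordered_prod M l x = foldr (\<lambda>i acc. x i \<otimes>\<^bsub>M\<^esub> acc) [0..<l] \<one>\<^bsub>M\<^esub>"

section \<open>Quasimorphisms\<close>

definition quasimorphism :: "('a, 'b) monoid_scheme \<Rightarrow> ('a \<Rightarrow> real) \<Rightarrow> bool" where
  "quasimorphism M \<psi> \<longleftrightarrow> (\<exists>D. \<forall>g\<in>carrier M. \<forall>h\<in>carrier M.
      \<bar>\<psi> g + \<psi> h - \<psi> (g \<otimes>\<^bsub>M\<^esub> h)\<bar> \<le> D)"

definition homogeneous_qm :: "('a, 'b) monoid_scheme \<Rightarrow> ('a \<Rightarrow> real) \<Rightarrow> bool" where
  "homogeneous_qm M \<psi> \<longleftrightarrow> (\<forall>g\<in>carrier M. \<forall>n::int. \<psi> (g [^]\<^bsub>M\<^esub> n) = of_int n * \<psi> g)"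

definition aut_invariant :: "('a, 'b) monoid_scheme \<Rightarrow> ('a \<Rightarrow> real) \<Rightarrow> bool" where
  "aut_invariant M \<psi> \<longleftrightarrow> (\<forall>\<phi>\<in>iso M M. \<forall>g\<in>carrier M. \<psi> (\<phi> g) = \<psi> g)"

text \<open>Linear independence of a set of real-valued functions on the carrier of M
  (every finite subfamily is linearly independent).\<close>

definition lin_indep_funs :: "('a, 'b) monoid_scheme \<Rightarrow> ('a \<Rightarrow> real) set \<Rightarrow> bool" where
  "lin_indep_funs M Q \<longleftrightarrow> (\<forall>S c. finite S \<and> S \<subseteq> Q \<and>
      (\<forall>g\<in>carrier M. (\<Sum>f\<in>S. c f * f g) = 0) \<longrightarrow> (\<forall>f\<in>S. c f = 0))"

end

theory Submission
  imports Defs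
begin

text \<open>
  Unless \<open>W\<close> decomposes as forbidden, it retracts onto a free product \<open>P = A * B\<close> of finite abelian
  groups with \<open>|A| \<ge> 3\<close>: either \<open>A = G\<^sub>u \<times> G\<^sub>w\<close>, \<open>B = G\<^sub>v\<close> with \<open>u, w\<close> adjacent and \<open>v\<close> adjacent to
  neither, or \<open>A = G\<^sub>u\<close>, \<open>B = G\<^sub>v\<close> with \<open>u, v\<close> non-adjacent. Torsion elements of \<open>W\<close> are conjugate into
  cliques, so they form finitely many conjugacy classes, and a finite-index subgroup of
  \<open>Aut W\<close> preserves each of them. Such an automorphism descends to \<open>P\<close>, where it is inner. Hence every
  homogeneous quasimorphism on \<open>P\<close>, pulled back to \<open>W\<close>, has a finite orbit under \<open>Aut W\<close>, and the sum
  over the orbit is Aut-invariant.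

  To see that the sums do not vanish, count occurrences of \<open>a\<^sup>K b\<^sup>2\<^sup>K a\<^sup>3\<^sup>K b\<^sup>4\<^sup>K\<close> in the
  sequence of \<open>A\<close>-letters, minus occurrences in the inverse element. For large \<open>K\<close> none of the finitely many
  endomorphisms of \<open>P\<close> that arise can turn the run-length pattern around, so all terms of the sum
  are non-negative on a suitable element; and each fixed element has value 0 for large \<open>K\<close>, which makes
  the values triangular.
\<close>

section \<open>Graph products\<close>

text \<open>Finite orbits alone are not enough: an automorphism may send an element to a conjugate
  of its inverse, and then the terms of the orbit sum cancel. Hence the counted word must not be
  cyclically its own reversal. This takes two distinct non-trivial letters in one factor, which is
  the reason for |A| \<ge> 3. A cyclic word in two letters has an even number of runs; two runs are
  always symmetric, four runs of distinct lengths never are. Endomorphisms may change the letters,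
  so only the run lengths can carry the orientation.

  An automorphism of W need not preserve the kernel of the retraction to P. One that fixes the
  conjugacy class of every vertex-group element does, as the kernel is normally generated by such
  elements.

  If neither configuration occurs, non-adjacency is an equivalence relation, since a failure of
  transitivity is the first configuration. Distinct classes are completely joined, so W is the
  direct product of the subgroups on the classes. A class with at least two vertices has only groups
  of order two, by the absence of the second configuration, and gives some \<open>Zk\<close>; a
  single vertex gives a finite abelian group.\<close>

locale graph_prod =
  fixes V :: "'v set" and E :: "'v set set" and G :: "'v \<Rightarrow> 'g monoid"
  assumes vertex_group: "v \<in> V \<Longrightarrow> group (G v)" and no_loop: "{v} \<notin> E"
begin

abbreviation "W \<equiv> graph_product V E G"
abbreviation "words \<equiv> gp_words V G"
abbreviation "cls \<equiv> gp_class V E G"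
abbreviation "rel \<equiv> gp_rel V E G"

lemma words_Nil [simp]: "[] \<in> words"
  and words_Cons [simp]: "x # w \<in> words \<longleftrightarrow> fst x \<in> V \<and> snd x \<in> carrier (G (fst x)) \<and> w \<in> words"
  and words_append [simp]: "w @ w' \<in> words \<longleftrightarrow> w \<in> words \<and> w' \<in> words"
  by (auto simp: gp_words_def)

lemma words_filter: "w \<in> words \<Longrightarrow> filter Q w \<in> words"
  by (auto simp: gp_words_def)

lemma words_concat: "(\<And>w. w \<in> set ws \<Longrightarrow> w \<in> words) \<Longrightarrow> concat ws \<in> words"
  by (induction ws) auto

lemma rel_invariant:
  assumes "(x, y) \<in> rel"
    and "\<And>x y. x \<in> words \<Longrightarrow> y \<in> words \<Longrightarrow> gp_step E G x y \<Longrightarrow> F x = F y"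
  shows "F x = F y"
proof -
  have "(x, y) \<in> (Restr ({(x, y). gp_step E G x y} \<union> {(y, x). gp_step E G x y}) words)\<^sup>*"
    using assms(1) by (auto simp: gp_rel_def)
  then show ?thesis
  proof (induction rule: rtrancl_induct)
    case (step y z)
    then show ?case using assms(2)[of y z] assms(2)[of z y] by auto
  qed simp
qed

lemma equiv_rel: "equiv words rel"
proof (rule equivI)
  let ?R = "Restr ({(x, y). gp_step E G x y} \<union> {(y, x). gp_step E G x y}) words"
  have "sym ?R" by (auto simp: sym_def)
  then have "sym (?R\<^sup>*)" by (rule sym_rtrancl)
  then show "sym rel" unfolding gp_rel_def by (auto simp: sym_def)
  show "trans rel" unfolding gp_rel_def
    by (rule transI) (auto intro: rtrancl_trans)
  show "refl_on words rel" by (auto simp: gp_rel_def refl_on_def)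
qed (auto simp: gp_rel_def)

lemma cls_eq_iff: "x \<in> words \<Longrightarrow> y \<in> words \<Longrightarrow> cls x = cls y \<longleftrightarrow> (x, y) \<in> rel"
  unfolding gp_class_def using eq_equiv_class_iff[OF equiv_rel] by blast

lemma cls_self: "x \<in> words \<Longrightarrow> x \<in> cls x"
  unfolding gp_class_def using equiv_class_self[OF equiv_rel] .

lemma cls_step:
  assumes "gp_step E G x y" "x \<in> words" "y \<in> words"
  shows "cls x = cls y"
  using assms cls_eq_iff[of x y] by (auto simp: gp_rel_def)

lemma cls_invariant:
  assumes "cls x = cls y" "x \<in> words" "y \<in> words"
    and "\<And>x y. x \<in> words \<Longrightarrow> y \<in> words \<Longrightarrow> gp_step E G x y \<Longrightarrow> F x = F y"
  shows "F x = F y"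
  using rel_invariant[of x y F] assms cls_eq_iff by blast

lemma gp_step_append: "gp_step E G x y \<Longrightarrow> gp_step E G (u @ x @ z) (u @ y @ z)"
proof (induction rule: gp_step.induct)
  case (del xs v ys)
  then show ?case using gp_step.del[of E G "u @ xs" v "ys @ z"] by simp
next
  case (merge xs v a b ys)
  then show ?case using gp_step.merge[of E G "u @ xs" v a b "ys @ z"] by simp
next
  case (swap v w xs a b ys)
  then show ?case using gp_step.swap[of v w E G "u @ xs" a b "ys @ z"] by simp
qed

lemma cls_append_cong:
  assumes "cls x = cls x'" "cls y = cls y'" "x \<in> words" "x' \<in> words" "y \<in> words" "y' \<in> words"
  shows "cls (x @ y) = cls (x' @ y')"
proof -
  have "cls (x @ y) = cls (x' @ y)"
  proof (rule cls_invariant[OF assms(1,3,4), of "\<lambda>x. cls (x @ y)"])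
    fix a b assume "a \<in> words" "b \<in> words" "gp_step E G a b"
    with gp_step_append[of a b "[]" y] show "cls (a @ y) = cls (b @ y)"
      by (intro cls_step) (auto simp: assms)
  qed
  also have "\<dots> = cls (x' @ y')"
  proof (rule cls_invariant[OF assms(2,5,6), of "\<lambda>y. cls (x' @ y)"])
    fix a b assume "a \<in> words" "b \<in> words" "gp_step E G a b"
    with gp_step_append[of a b x' "[]"] show "cls (x' @ a) = cls (x' @ b)"
      by (intro cls_step) (auto simp: assms)
  qed
  finally show ?thesis .
qed

lemma carrier_eq: "carrier W = cls ` words"
  by (auto simp: graph_product_def quotient_def gp_class_def)

lemma cls_closed [simp]: "w \<in> words \<Longrightarrow> cls w \<in> carrier W"
  by (simp add: carrier_eq)

lemma carrierE:
  assumes "g \<in> carrier W" obtains w where "w \<in> words" "g = cls w"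
  using assms carrier_eq by auto

lemma one_eq: "\<one>\<^bsub>W\<^esub> = cls []"
  by (simp add: graph_product_def)

text \<open>\<open>graph_product\<close> multiplies the representatives picked by
  \<open>SOME\<close>. Together with \<open>cls_append_cong\<close> this allows any representatives
  to be used instead.\<close>

lemma cls_some: 
  assumes "w \<in> words" shows "(SOME x. x \<in> cls w) \<in> words" "cls (SOME x. x \<in> cls w) = cls w"
proof -
  have "(SOME x. x \<in> cls w) \<in> cls w" using cls_self[OF assms] by (rule someI)
  then have *: "(w, SOME x. x \<in> cls w) \<in> rel" by (simp add: gp_class_def)
  then show "(SOME x. x \<in> cls w) \<in> words" by (auto simp: gp_rel_def)
  then show "cls (SOME x. x \<in> cls w) = cls w" using * assms cls_eq_iff by metis
qed

lemma mult_cls: "x \<in> words \<Longrightarrow> y \<in> words \<Longrightarrow> cls x \<otimes>\<^bsub>W\<^esub> cls y = cls (x @ y)"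
  using cls_append_cong[OF cls_some(2) cls_some(2)] cls_some(1)
  by (simp add: graph_product_def)

section \<open>Inverse words and the group structure\<close>

definition winv :: "('v \<times> 'g) list \<Rightarrow> ('v \<times> 'g) list" where
  "winv w = rev (map (\<lambda>(v, a). (v, inv\<^bsub>G v\<^esub> a)) w)"

lemma winv_Nil [simp]: "winv [] = []"
  and winv_Cons: "winv ((v, a) # w) = winv w @ [(v, inv\<^bsub>G v\<^esub> a)]"
  and winv_append [simp]: "winv (w @ w') = winv w' @ winv w"
  by (auto simp: winv_def)

lemma winv_words [simp]: "w \<in> words \<Longrightarrow> winv w \<in> words"
  by (induction w) (auto simp: winv_Cons vertex_group group.inv_closed)

lemma winv_winv: "w \<in> words \<Longrightarrow> winv (winv w) = w"
  by (induction w) (auto simp: winv_Cons vertex_group group.inv_inv)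

lemma cls_del:
  assumes "x \<in> words" "y \<in> words" "v \<in> V"
  shows "cls (x @ (v, \<one>\<^bsub>G v\<^esub>) # y) = cls (x @ y)"
  using assms by (intro cls_step gp_step.del)
    (auto simp: vertex_group group.is_monoid monoid.one_closed)

lemma cls_merge:
  assumes "x \<in> words" "y \<in> words" "v \<in> V" "a \<in> carrier (G v)" "b \<in> carrier (G v)"
  shows "cls (x @ (v, a) # (v, b) # y) = cls (x @ (v, a \<otimes>\<^bsub>G v\<^esub> b) # y)"
  using assms by (intro cls_step gp_step.merge)
    (auto simp: vertex_group group.is_monoid monoid.m_closed)

lemma cls_swap:
  assumes "x \<in> words" "y \<in> words" "v \<in> V" "a \<in> carrier (G v)" "u \<in> V" "b \<in> carrier (G u)" "{v, u} \<in> E"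
  shows "cls (x @ (v, a) # (u, b) # y) = cls (x @ (u, b) # (v, a) # y)"
  using assms by (intro cls_step gp_step.swap) auto

lemma cls_winv: "w \<in> words \<Longrightarrow> cls (winv w @ w) = cls []"
proof (induction w)
  case Nil then show ?case by simp
next
  case (Cons x w)
  obtain v a where x: "x = (v, a)" by force
  have v: "v \<in> V" "a \<in> carrier (G v)" "w \<in> words" using Cons.prems x by auto
  interpret Gv: group "G v" using vertex_group v by simp
  have "cls (winv (x # w) @ x # w) = cls (winv w @ (v, inv\<^bsub>G v\<^esub> a) # (v, a) # w)"
    by (simp add: x winv_Cons)
  also have "\<dots> = cls (winv w @ (v, inv\<^bsub>G v\<^esub> a \<otimes>\<^bsub>G v\<^esub> a) # w)"
    using v by (intro cls_merge) auto
  also have "\<dots> = cls (winv w @ w)" using v cls_del by simp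
  finally show ?case using Cons.IH v by simp
qed

lemma group_W: "group W"
proof (rule groupI)
  show "x \<otimes>\<^bsub>W\<^esub> y \<in> carrier W" if "x \<in> carrier W" "y \<in> carrier W" for x y
    using that by (auto simp: carrier_eq mult_cls)
  show "\<one>\<^bsub>W\<^esub> \<in> carrier W" by (simp add: one_eq)
  show "x \<otimes>\<^bsub>W\<^esub> y \<otimes>\<^bsub>W\<^esub> z = x \<otimes>\<^bsub>W\<^esub> (y \<otimes>\<^bsub>W\<^esub> z)"
    if "x \<in> carrier W" "y \<in> carrier W" "z \<in> carrier W" for x y z
    using that by (auto simp: carrier_eq mult_cls)
  show "\<one>\<^bsub>W\<^esub> \<otimes>\<^bsub>W\<^esub> x = x" if "x \<in> carrier W" for x
    using that by (auto simp: carrier_eq mult_cls one_eq)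
  show "\<exists>y\<in>carrier W. y \<otimes>\<^bsub>W\<^esub> x = \<one>\<^bsub>W\<^esub>" if x: "x \<in> carrier W" for x
  proof -
    obtain w where "w \<in> words" "x = cls w" using x by (rule carrierE)
    then show ?thesis by (intro bexI[of _ "cls (winv w)"]) (auto simp: mult_cls one_eq cls_winv)
  qed
qed

sublocale W: group W by (rule group_W)

lemma inv_cls: "w \<in> words \<Longrightarrow> inv\<^bsub>W\<^esub> (cls w) = cls (winv w)"
  by (rule W.inv_equality) (auto simp: mult_cls cls_winv one_eq)

lemma pow_cls: "w \<in> words \<Longrightarrow> cls w [^]\<^bsub>W\<^esub> (n::nat) = cls (concat (replicate n w))"
proof (induction n)
  case (Suc n)
  have "replicate n w @ [w] = replicate (Suc n) w" by (simp add: replicate_append_same)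
  then have "concat (replicate n w) @ w = concat (replicate (Suc n) w)"
    by (metis concat.simps concat_append append_Nil2)
  moreover have "concat (replicate n w) \<in> words" using Suc.prems by (intro words_concat) auto
  ultimately show ?case using Suc by (simp add: mult_cls)
qed (simp add: one_eq)

section \<open>Vertex groups inside W and the universal property\<close>

abbreviation "incl \<equiv> gp_incl V E G"

lemma incl_closed [simp]: "v \<in> V \<Longrightarrow> a \<in> carrier (G v) \<Longrightarrow> incl v a \<in> carrier W"
  by (simp add: gp_incl_def)

lemma incl_mult:
  assumes "v \<in> V" "a \<in> carrier (G v)" "b \<in> carrier (G v)"
  shows "incl v (a \<otimes>\<^bsub>G v\<^esub> b) = incl v a \<otimes>\<^bsub>W\<^esub> incl v b"
  using assms cls_merge[of "[]" "[]" v a b] by (simp add: gp_incl_def mult_cls)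

lemma incl_hom: "v \<in> V \<Longrightarrow> incl v \<in> hom (G v) W"
  by (rule homI) (auto simp: incl_mult)

lemma incl_one: "v \<in> V \<Longrightarrow> incl v \<one>\<^bsub>G v\<^esub> = \<one>\<^bsub>W\<^esub>"
  using cls_del[of "[]" "[]" v] by (simp add: gp_incl_def one_eq)

lemma incl_commute:
  assumes "u \<in> V" "a \<in> carrier (G u)" "v \<in> V" "b \<in> carrier (G v)" "{u, v} \<in> E"
  shows "incl u a \<otimes>\<^bsub>W\<^esub> incl v b = incl v b \<otimes>\<^bsub>W\<^esub> incl u a"
  using assms cls_swap[of "[]" "[]" u a v b] by (simp add: gp_incl_def mult_cls)

lemma cls_Cons: "v \<in> V \<Longrightarrow> a \<in> carrier (G v) \<Longrightarrow> w \<in> words \<Longrightarrow> cls ((v, a) # w) = incl v a \<otimes>\<^bsub>W\<^esub> cls w"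
  by (simp add: gp_incl_def mult_cls)

lemma hom_eqI:
  assumes "f \<in> hom W M" "g \<in> hom W M" "group M"
    and "\<And>v a. v \<in> V \<Longrightarrow> a \<in> carrier (G v) \<Longrightarrow> f (incl v a) = g (incl v a)"
    and "x \<in> carrier W"
  shows "f x = g x"
proof -
  interpret f: group_hom W M f using assms group_W by (simp add: group_hom_def group_hom_axioms_def)
  interpret g: group_hom W M g using assms group_W by (simp add: group_hom_def group_hom_axioms_def)
  have "f (cls w) = g (cls w)" if "w \<in> words" for w
    using that
  proof (induction w)
    case Nil
    then show ?case by (simp flip: one_eq)
  next
    case (Cons x w)
    then show ?case by (cases x) (auto simp: cls_Cons assms(4))
  qed
  then show ?thesis using assms(5) by (auto simp: carrier_eq)
qed

definition eval_word :: "('m, 'b) monoid_scheme \<Rightarrow> ('v \<Rightarrow> 'g \<Rightarrow> 'm) \<Rightarrow> ('v \<times> 'g) list \<Rightarrow> 'm" where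
  "eval_word M h w = foldr (\<lambda>(v, a) x. h v a \<otimes>\<^bsub>M\<^esub> x) w \<one>\<^bsub>M\<^esub>"

text \<open>Universal property. Letterwise evaluation in M survives each elementary move: deletions
  and merges because every \<open>h v\<close> is a homomorphism, swaps by the commutation
  hypothesis. Projections, retractions and the comparison with \<open>Zk\<close> are all built from
  it.\<close>

lemma hom_extension:
  assumes "group M" and h: "\<And>v. v \<in> V \<Longrightarrow> h v \<in> hom (G v) M"
    and comm: "\<And>u v a b. {u, v} \<in> E \<Longrightarrow> u \<in> V \<Longrightarrow> v \<in> V \<Longrightarrow> a \<in> carrier (G u) \<Longrightarrow> b \<in> carrier (G v)
       \<Longrightarrow> h u a \<otimes>\<^bsub>M\<^esub> h v b = h v b \<otimes>\<^bsub>M\<^esub> h u a"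
  obtains f where "f \<in> hom W M" "\<And>v a. v \<in> V \<Longrightarrow> a \<in> carrier (G v) \<Longrightarrow> f (incl v a) = h v a"
proof -
  interpret M: group M by fact
  let ?e = "eval_word M h"
  have hc: "h v a \<in> carrier M" if "v \<in> V" "a \<in> carrier (G v)" for v a
    using h that by (auto simp: hom_def)
  have e_Nil: "?e [] = \<one>\<^bsub>M\<^esub>" and e_Cons: "\<And>v a w. ?e ((v, a) # w) = h v a \<otimes>\<^bsub>M\<^esub> ?e w"
    by (auto simp: eval_word_def)
  have e_closed: "?e w \<in> carrier M" if "w \<in> words" for w
    using that by (induction w) (auto simp: e_Nil e_Cons hc)
  have e_append: "?e (w @ w') = ?e w \<otimes>\<^bsub>M\<^esub> ?e w'" if "w \<in> words" "w' \<in> words" for w w'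
    using that by (induction w) (auto simp: e_Nil e_Cons hc e_closed M.m_assoc)
  have e_step: "?e x = ?e y" if "gp_step E G x y" "x \<in> words" "y \<in> words" for x y
    using that
  proof (induction rule: gp_step.induct)
    case (del xs v ys)
    then have "h v \<one>\<^bsub>G v\<^esub> = \<one>\<^bsub>M\<^esub>"
      using h[of v] vertex_group[of v] \<open>group M\<close> by (simp add: hom_one)
    then show ?case using del by (simp add: e_append e_Cons e_closed)
  next
    case (merge xs v a b ys)
    then have "h v (a \<otimes>\<^bsub>G v\<^esub> b) = h v a \<otimes>\<^bsub>M\<^esub> h v b" using h[of v] by (simp add: hom_mult)
    then show ?case using merge by (simp add: e_append e_Cons e_closed hc M.m_assoc)
  next
    case (swap v u xs a b ys)
    then have c: "h v a \<otimes>\<^bsub>M\<^esub> h u b = h u b \<otimes>\<^bsub>M\<^esub> h v a" by (intro comm) auto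
    have "h v a \<otimes>\<^bsub>M\<^esub> (h u b \<otimes>\<^bsub>M\<^esub> ?e ys) = h v a \<otimes>\<^bsub>M\<^esub> h u b \<otimes>\<^bsub>M\<^esub> ?e ys"
      using swap by (auto simp: hc e_closed M.m_assoc)
    also have "\<dots> = h u b \<otimes>\<^bsub>M\<^esub> (h v a \<otimes>\<^bsub>M\<^esub> ?e ys)"
      unfolding c using swap by (auto simp: hc e_closed M.m_assoc)
    finally show ?case using swap by (simp add: e_append e_Cons e_closed)
  qed
  define f where "f A = ?e (SOME w. w \<in> A)" for A
  have f_cls: "f (cls w) = ?e w" if "w \<in> words" for w
    unfolding f_def
    by (rule cls_invariant[of _ _ ?e, OF cls_some(2)[OF that] cls_some(1)[OF that] that]) (rule e_step)
  show thesis
  proof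
    show "f \<in> hom W M"
      by (rule homI) (auto simp: carrier_eq f_cls e_closed mult_cls e_append)
    show "f (incl v a) = h v a" if "v \<in> V" "a \<in> carrier (G v)" for v a
      using that by (simp add: gp_incl_def f_cls e_Cons e_Nil hc)
  qed
qed


section \<open>Reduced words\<close>

text \<open>A word is recorded by its projections to all pairs of non-adjacent vertices; these are
  insensitive to swaps.\<close>

definition fam :: "('v \<times> 'g) list \<Rightarrow> 'v \<Rightarrow> 'v \<Rightarrow> ('v \<times> 'g) list" where
  "fam w = (\<lambda>x y. if {x, y} \<in> E then [] else filter (\<lambda>l. fst l = x \<or> fst l = y) w)"

text \<open>The instance y = v, available because there are no loops, forces a v-letter to occur;
  the other y say that no letter at a non-adjacent vertex precedes it. So
  \<open>front v (fam w)\<close> means that swaps can bring a v-letter of w to the front.\<close>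

definition front :: "'v \<Rightarrow> ('v \<Rightarrow> 'v \<Rightarrow> ('v \<times> 'g) list) \<Rightarrow> bool" where
  "front v F \<longleftrightarrow> (\<forall>y. {v, y} \<notin> E \<longrightarrow> F v y \<noteq> [] \<and> fst (hd (F v y)) = v)"

definition upd :: "'v \<Rightarrow> (('v \<times> 'g) list \<Rightarrow> ('v \<times> 'g) list) \<Rightarrow> ('v \<Rightarrow> 'v \<Rightarrow> ('v \<times> 'g) list)
    \<Rightarrow> ('v \<Rightarrow> 'v \<Rightarrow> ('v \<times> 'g) list)" where
  "upd v t F = (\<lambda>x y. if {x, y} \<notin> E \<and> (x = v \<or> y = v) then t (F x y) else F x y)"

definition front_letter :: "'v \<Rightarrow> ('v \<Rightarrow> 'v \<Rightarrow> ('v \<times> 'g) list) \<Rightarrow> 'g" where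
  "front_letter v F = (if front v F then snd (hd (F v v)) else \<one>\<^bsub>G v\<^esub>)"

definition strip_front :: "'v \<Rightarrow> ('v \<Rightarrow> 'v \<Rightarrow> ('v \<times> 'g) list) \<Rightarrow> ('v \<Rightarrow> 'v \<Rightarrow> ('v \<times> 'g) list)" where
  "strip_front v F = (if front v F then upd v tl F else F)"

definition put :: "'v \<Rightarrow> 'g \<Rightarrow> ('v \<Rightarrow> 'v \<Rightarrow> ('v \<times> 'g) list) \<Rightarrow> ('v \<Rightarrow> 'v \<Rightarrow> ('v \<times> 'g) list)" where
  "put v c F = (if c = \<one>\<^bsub>G v\<^esub> then F else upd v ((#) (v, c)) F)"

text \<open>Left multiplication by a letter, on the level of families: remove the front v-letter
  (the identity if there is none), multiply it by a, put the result back unless it is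
  trivial.\<close>

definition act :: "'v \<Rightarrow> 'g \<Rightarrow> ('v \<Rightarrow> 'v \<Rightarrow> ('v \<times> 'g) list) \<Rightarrow> ('v \<Rightarrow> 'v \<Rightarrow> ('v \<times> 'g) list)" where
  "act v a F = put v (a \<otimes>\<^bsub>G v\<^esub> front_letter v F) (strip_front v F)"

text \<open>No letter is an identity, and no letter can be brought by swaps next to a later letter
  of the same vertex group.\<close>

primrec reduced :: "('v \<times> 'g) list \<Rightarrow> bool" where
  "reduced [] \<longleftrightarrow> True"
| "reduced (l # w) \<longleftrightarrow> snd l \<noteq> \<one>\<^bsub>G (fst l)\<^esub> \<and> reduced w \<and> \<not> front (fst l) (fam w)"

lemma front_letter_put: "\<not> front v F \<Longrightarrow> front_letter v (put v c F) = c"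
  using no_loop[of v] by (auto simp: front_letter_def put_def upd_def front_def)

lemma strip_front_put:
  assumes "\<not> front v F" shows "strip_front v (put v c F) = F"
proof (cases "c = \<one>\<^bsub>G v\<^esub>")
  case False
  have "front v (upd v ((#) (v, c)) F)" by (auto simp: front_def upd_def)
  with False show ?thesis by (simp add: put_def strip_front_def) (auto simp: upd_def fun_eq_iff)
qed (simp add: put_def strip_front_def assms)

lemma fam_Cons: "c \<noteq> \<one>\<^bsub>G v\<^esub> \<Longrightarrow> fam ((v, c) # w) = put v c (fam w)"
  by (auto simp: put_def upd_def fam_def fun_eq_iff)

text \<open>Take the first v-letter. An earlier letter at a vertex y not adjacent to v would come
  before it in the projection to v and y, whose head is a v-letter.\<close>

lemma front_famE:
  assumes "front v (fam w)"
  obtains p c q where "w = p @ (v, c) # q" "\<forall>l\<in>set p. {v, fst l} \<in> E"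
proof -
  have "filter (\<lambda>l. fst l = v) w \<noteq> []"
    using assms no_loop[of v] by (auto simp: front_def fam_def dest!: spec[of _ v])
  then have "\<exists>l\<in>set w. fst l = v" by (auto simp: filter_empty_conv)
  from split_list_first_prop[OF this]
  obtain p l q where w: "w = p @ l # q" "fst l = v" "\<forall>k\<in>set p. fst k \<noteq> v" by blast
  have "{v, fst k} \<in> E" if "k \<in> set p" for k
  proof (rule ccontr)
    assume n: "{v, fst k} \<notin> E"
    let ?f = "filter (\<lambda>l. fst l = v \<or> fst l = fst k)"
    have "?f p \<noteq> []" using that by (auto simp: filter_empty_conv)
    then have "hd (?f w) \<in> set (?f p)" using w hd_in_set[of "?f p"] by (simp del: set_filter)
    then show False using assms w(3) n by (auto simp: front_def fam_def dest!: spec[of _ "fst k"])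
  qed
  then show thesis using that[of p "snd l" q] w by auto
qed

lemma fam_move_front:
  assumes "\<forall>l\<in>set p. {v, fst l} \<in> E"
  shows "fam (p @ (v, c) # q) = fam ((v, c) # p @ q)"
proof -
  have "filter (\<lambda>l. fst l = x \<or> fst l = y) p = []" if "{x, y} \<notin> E" "x = v \<or> y = v" for x y
    using assms that no_loop by (fastforce simp: filter_empty_conv insert_commute)
  then show ?thesis by (auto simp: fam_def fun_eq_iff)
qed

lemma front_fam_delete:
  assumes "{u, v} \<in> E" shows "front u (fam (p @ (v, c) # q)) = front u (fam (p @ q))"
proof -
  have "u \<noteq> v" using assms no_loop by auto
  then have "fam (p @ (v, c) # q) u y = fam (p @ q) u y" if "{u, y} \<notin> E" for y
    using that assms by (auto simp: fam_def)
  then show ?thesis by (auto simp: front_def)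
qed

lemma not_front_adjacent:
  assumes "\<forall>l\<in>set p. {v, fst l} \<in> E" and "front v (fam (p @ q))"
  shows "front v (fam q)"
proof -
  have "filter (\<lambda>l. fst l = v \<or> fst l = y) p = []" if "{v, y} \<notin> E" for y
    using assms that no_loop by (fastforce simp: filter_empty_conv)
  then show ?thesis using assms(2) by (auto simp: front_def fam_def)
qed

lemma reduced_delete:
  assumes "\<forall>l\<in>set p. {v, fst l} \<in> E" "reduced (p @ (v, c) # q)"
  shows "reduced (p @ q) \<and> \<not> front v (fam (p @ q)) \<and> c \<noteq> \<one>\<^bsub>G v\<^esub>"
proof -
  have red: "reduced (p @ q)" "reduced ((v, c) # q)"
    using assms by (induction p) (auto simp: front_fam_delete insert_commute)
  then show ?thesis using not_front_adjacent[OF assms(1)] by auto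
qed

text \<open>Separates the G v coordinate of a state, with c trivial when v is not in front. In this
  coordinate \<open>act v\<close> is plain left multiplication, which yields the group law in
  \<open>act_states\<close>.\<close>

lemma fam_decompose:
  assumes "w \<in> words" "reduced w" "v \<in> V"
  obtains c q where "c \<in> carrier (G v)" "q \<in> words" "reduced q" "\<not> front v (fam q)" "fam w = put v c (fam q)"
proof (cases "front v (fam w)")
  case True
  then obtain p c q where w: "w = p @ (v, c) # q" and p: "\<forall>l\<in>set p. {v, fst l} \<in> E"
    by (rule front_famE)
  have "reduced (p @ q) \<and> \<not> front v (fam (p @ q)) \<and> c \<noteq> \<one>\<^bsub>G v\<^esub>"
    using reduced_delete[OF p] assms(2) w by blast
  moreover from this have "fam w = put v c (fam (p @ q))"
    using fam_move_front[OF p] fam_Cons w by simp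
  ultimately show thesis using that[of c "p @ q"] assms w by auto
next
  case False
  then show thesis
    using that[of "\<one>\<^bsub>G v\<^esub>" w] assms vertex_group by (auto simp: put_def group.is_monoid monoid.one_closed)
qed

section \<open>Uniqueness of reduced words through an action on families\<close>

definition "states = fam ` {w \<in> words. reduced w}"

lemma put_states:
  assumes "c \<in> carrier (G v)" "v \<in> V" "q \<in> words" "reduced q" "\<not> front v (fam q)"
  shows "put v c (fam q) \<in> states"
proof (cases "c = \<one>\<^bsub>G v\<^esub>")
  case True
  then show ?thesis using assms by (auto simp: put_def states_def)
next
  case False
  then have "put v c (fam q) = fam ((v, c) # q)" using fam_Cons by simp
  moreover have "(v, c) # q \<in> {w \<in> words. reduced w}" using assms False by auto
  ultimately show ?thesis by (simp add: states_def)
qed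

lemma act_put: "\<not> front v F \<Longrightarrow> act v a (put v c F) = put v (a \<otimes>\<^bsub>G v\<^esub> c) F"
  by (simp add: act_def front_letter_put strip_front_put)

lemma act_states:
  assumes "F \<in> states" "v \<in> V" "a \<in> carrier (G v)" "b \<in> carrier (G v)"
  shows "act v a F \<in> states" "act v \<one>\<^bsub>G v\<^esub> F = F"
    "act v a (act v b F) = act v (a \<otimes>\<^bsub>G v\<^esub> b) F"
proof -
  interpret Gv: group "G v" using vertex_group assms by simp
  obtain w where w: "F = fam w" "w \<in> words" "reduced w" using assms(1) by (auto simp: states_def)
  obtain c q where q: "c \<in> carrier (G v)" "q \<in> words" "reduced q" "\<not> front v (fam q)" "F = put v c (fam q)"
    using fam_decompose[OF w(2,3) assms(2)] w(1) by metis
  show "act v a F \<in> states" using q assms by (simp add: act_put put_states)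
  show "act v \<one>\<^bsub>G v\<^esub> F = F" using q by (simp add: act_put)
  show "act v a (act v b F) = act v (a \<otimes>\<^bsub>G v\<^esub> b) F"
    using q assms by (simp add: act_put Gv.m_assoc)
qed

lemma act_local:
  assumes "\<And>y. {v, y} \<notin> E \<Longrightarrow> F v y = F' v y"
  shows "front v F = front v F'" "front_letter v F = front_letter v F'"
  using assms no_loop[of v] by (auto simp: front_def front_letter_def)

text \<open>What \<open>act\<close> does to one entry of the family, the decision being read off the
  row of v. For adjacent v and u the two operations change disjoint sets of entries, and neither
  reads an entry that the other changes; this is why they commute.\<close>

definition act_letter :: "'v \<Rightarrow> 'g \<Rightarrow> ('v \<Rightarrow> 'v \<Rightarrow> ('v \<times> 'g) list) \<Rightarrow> ('v \<times> 'g) list \<Rightarrow> ('v \<times> 'g) list" where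
  "act_letter v a F l =
    (if a \<otimes>\<^bsub>G v\<^esub> front_letter v F = \<one>\<^bsub>G v\<^esub> then [] else [(v, a \<otimes>\<^bsub>G v\<^esub> front_letter v F)])
      @ (if front v F then tl l else l)"

lemma act_eq_upd: "act v a F = upd v (act_letter v a F) F"
  unfolding act_def put_def strip_front_def act_letter_def
  by (cases "front v F"; cases "a \<otimes>\<^bsub>G v\<^esub> front_letter v F = \<one>\<^bsub>G v\<^esub>") (auto simp: upd_def fun_eq_iff)

lemma upd_commute:
  assumes "{v, u} \<in> E" shows "upd v s (upd u t F) = upd u t (upd v s F)"
proof -
  have "\<not> (x = v \<and> y = u) \<and> \<not> (x = u \<and> y = v)" if "{x, y} \<notin> E" for x y
    using that assms by (auto simp: insert_commute)
  moreover have "v \<noteq> u" using assms no_loop by auto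
  ultimately show ?thesis by (fastforce simp: upd_def fun_eq_iff)
qed

lemma act_letter_upd:
  assumes "{v, u} \<in> E" shows "act_letter v a (upd u t F) = act_letter v a F"
proof -
  have "v \<noteq> u" using assms no_loop by auto
  then have "upd u t F v y = F v y" if "{v, y} \<notin> E" for y
    using that assms by (auto simp: upd_def)
  then show ?thesis using act_local[of v "upd u t F" F] by (simp add: act_letter_def fun_eq_iff)
qed

lemma act_commute:
  assumes "{v, u} \<in> E" shows "act v a (act u b F) = act u b (act v a F)"
  using assms by (simp add: act_eq_upd act_letter_upd upd_commute[OF assms] insert_commute)

text \<open>Van der Waerden's argument. The action of a word on the empty family depends only on its
  class, and a reduced word sends the empty family to its own family because no step meets a front
  letter to merge with.\<close>

lemma fam_eq:
  assumes "cls w = cls w'" "w \<in> words" "w' \<in> words" "reduced w" "reduced w'"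
  shows "fam w = fam w'"
proof -
  let ?a = "foldr (\<lambda>(v, a). act v a)"
  have st: "?a x F \<in> states" if "x \<in> words" "F \<in> states" for x F
    using that by (induction x) (auto intro: act_states)
  have red: "?a x (fam []) = fam x" if "x \<in> words" "reduced x" for x
    using that
  proof (induction x)
    case (Cons l x)
    obtain v c where l: "l = (v, c)" by force
    interpret Gv: group "G v" using vertex_group Cons.prems l by simp
    have "act v c (fam x) = put v c (fam x)"
      using Cons.prems l by (simp add: act_def front_letter_def strip_front_def)
    also have "\<dots> = fam (l # x)" using Cons.prems l fam_Cons by simp
    finally show ?case using Cons l by simp
  qed simp
  have e: "fam [] \<in> states" by (force simp: states_def)
  have "?a w (fam []) = ?a w' (fam [])"
  proof (rule cls_invariant[OF assms(1-3), of "\<lambda>w. ?a w (fam [])"])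
    fix x y assume xy: "x \<in> words" "y \<in> words" "gp_step E G x y"
    from xy(3,1,2) show "?a x (fam []) = ?a y (fam [])"
    proof (induction rule: gp_step.induct)
      case (del xs v ys)
      then show ?case using act_states(2)[OF st[OF _ e], of ys v] by auto
    next
      case (merge xs v a b ys)
      then show ?case using act_states(3)[OF st[OF _ e], of ys v a b] by auto
    next
      case (swap v u xs a b ys)
      then show ?case using act_commute by simp
    qed
  qed
  then show ?thesis using red assms by simp
qed

lemma fam_eq_Nil: "fam w = fam [] \<Longrightarrow> w = []"
proof (cases w)
  case (Cons l w')
  assume "fam w = fam []"
  then have "fam w (fst l) (fst l) = fam [] (fst l) (fst l)" by simp
  then show ?thesis using no_loop[of "fst l"] Cons by (auto simp: fam_def)
qed

lemma reduced_trivial: "w \<in> words \<Longrightarrow> reduced w \<Longrightarrow> cls w = cls [] \<Longrightarrow> w = []"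
  using fam_eq[of w "[]"] fam_eq_Nil by simp

section \<open>Shortening words that are not reduced\<close>

lemma cls_move_front:
  assumes "p \<in> words" "v \<in> V" "c \<in> carrier (G v)" "q \<in> words" "\<forall>l\<in>set p. {v, fst l} \<in> E"
  shows "cls ((v, c) # p @ q) = cls (p @ (v, c) # q)"
  using assms
proof (induction p)
  case (Cons l p)
  obtain u b where l: "l = (u, b)" by force
  have "cls ((v, c) # l # p @ q) = cls ([l] @ (v, c) # p @ q)"
    using cls_swap[of "[]" "p @ q" v c u b] Cons.prems l by auto
  also have "\<dots> = cls ([l] @ p @ (v, c) # q)"
    using Cons l by (intro cls_append_cong) auto
  finally show ?case by simp
qed simp

lemma cls_merge_distant:
  assumes "p \<in> words" "q \<in> words" "v \<in> V" "c \<in> carrier (G v)" "d \<in> carrier (G v)" "x \<in> words"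
    and "\<forall>l\<in>set p. {v, fst l} \<in> E"
  shows "cls (x @ (v, c) # p @ (v, d) # q) = cls (x @ p @ (v, c \<otimes>\<^bsub>G v\<^esub> d) # q)"
proof -
  interpret Gv: group "G v" using vertex_group assms by simp
  have "cls ((v, c) # p @ (v, d) # q) = cls (p @ (v, c) # (v, d) # q)"
    using assms by (intro cls_move_front) auto
  also have "\<dots> = cls (p @ (v, c \<otimes>\<^bsub>G v\<^esub> d) # q)" using assms by (intro cls_merge)
  finally show ?thesis using assms by (intro cls_append_cong) auto
qed

text \<open>The shortest non-reduced suffix can only fail at its head, and the front letter of its
  tail is the partner to merge with.\<close>

lemma not_reducedE:
  assumes "\<not> reduced w" "\<And>l. l \<in> set w \<Longrightarrow> snd l \<noteq> \<one>\<^bsub>G (fst l)\<^esub>"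
  obtains x v c p d q where "w = x @ (v, c) # p @ (v, d) # q" "\<forall>l\<in>set p. {v, fst l} \<in> E"
proof -
  have "\<exists>x v c p d q. w = x @ (v, c) # p @ (v, d) # q \<and> (\<forall>l\<in>set p. {v, fst l} \<in> E)"
    using assms
  proof (induction w)
    case (Cons l w)
    obtain v c where l: "l = (v, c)" by force
    show ?case
    proof (cases "reduced w")
      case True
      then have "front v (fam w)" using Cons.prems(1) Cons.prems(2)[of l] l by auto
      then obtain p d q where "w = p @ (v, d) # q" "\<forall>l\<in>set p. {v, fst l} \<in> E"
        by (rule front_famE)
      then have "l # w = [] @ (v, c) # p @ (v, d) # q \<and> (\<forall>l\<in>set p. {v, fst l} \<in> E)" using l by simp
      then show ?thesis by blast
    next
      case False
      then obtain x v c p d q where "w = x @ (v, c) # p @ (v, d) # q \<and> (\<forall>l\<in>set p. {v, fst l} \<in> E)"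
        using Cons by (metis list.set_intros(2))
      then have "l # w = (l # x) @ (v, c) # p @ (v, d) # q \<and> (\<forall>l\<in>set p. {v, fst l} \<in> E)" by simp
      then show ?thesis by blast
    qed
  qed simp
  then show thesis using that by blast
qed

lemma shorten_identity:
  assumes "w \<in> words" "l \<in> set w" "snd l = \<one>\<^bsub>G (fst l)\<^esub>"
  obtains w' where "w' \<in> words" "length w' < length w" "cls w' = cls w"
proof -
  obtain x y where "w = x @ l # y" using assms(2) by (meson split_list)
  then show thesis using that[of "x @ y"] assms cls_del[of x y "fst l"] by (cases l) auto
qed

lemma shorten_pair:
  assumes "w \<in> words" "w = x @ (v, c) # p @ (v, d) # q" "\<forall>l\<in>set p. {v, fst l} \<in> E"
  obtains w' where "w' \<in> words" "length w' < length w" "cls w' = cls w"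
proof -
  have "v \<in> V" using assms by simp
  then interpret Gv: group "G v" using vertex_group by simp
  show thesis
    using that[of "x @ p @ (v, c \<otimes>\<^bsub>G v\<^esub> d) # q"] assms cls_merge_distant[of p q v c d x] by auto
qed

lemma shorten:
  assumes "w \<in> words" "\<not> reduced w"
  obtains w' where "w' \<in> words" "length w' < length w" "cls w' = cls w"
proof (cases "\<exists>l\<in>set w. snd l = \<one>\<^bsub>G (fst l)\<^esub>")
  case True
  then show thesis using shorten_identity[OF assms(1)] that by metis
next
  case False
  then obtain x v c p d q where "w = x @ (v, c) # p @ (v, d) # q" "\<forall>l\<in>set p. {v, fst l} \<in> E"
    using not_reducedE[OF assms(2)] by metis
  then show thesis using shorten_pair[OF assms(1)] that by metis
qed

lemma reduced_representative:
  assumes "w \<in> words"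
  obtains w' where "w' \<in> words" "reduced w'" "cls w' = cls w"
proof -
  define P where "P n \<longleftrightarrow> (\<exists>w'\<in>words. cls w' = cls w \<and> length w' = n)" for n
  have "P (length w)" using assms by (auto simp: P_def)
  then have "P (LEAST n. P n)" by (rule LeastI)
  then obtain w' where w': "w' \<in> words" "cls w' = cls w" "length w' = (LEAST n. P n)"
    by (auto simp: P_def)
  have "reduced w'"
  proof (rule ccontr)
    assume "\<not> reduced w'"
    then obtain x where "x \<in> words" "length x < length w'" "cls x = cls w'" using shorten w' by metis
    then have "P (length x)" "length x < (LEAST n. P n)" using w' by (auto simp: P_def)
    then show False using not_less_Least by blast
  qed
  then show thesis using that w' by blast
qed

end

section \<open>Torsion elements\<close>

definition conjugate :: "('a, 'b) monoid_scheme \<Rightarrow> 'a \<Rightarrow> 'a \<Rightarrow> bool" where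
  "conjugate M g h \<longleftrightarrow> (\<exists>x\<in>carrier M. h = x \<otimes>\<^bsub>M\<^esub> g \<otimes>\<^bsub>M\<^esub> inv\<^bsub>M\<^esub> x)"

context group
begin

lemma conjugateI: "x \<in> carrier G \<Longrightarrow> conjugate G g (x \<otimes> g \<otimes> inv x)"
  by (auto simp: conjugate_def)

lemma conjugate_refl: "g \<in> carrier G \<Longrightarrow> conjugate G g g"
  by (auto simp: conjugate_def intro!: bexI[of _ \<one>])

lemma conjugate_sym:
  assumes "conjugate G g h" "g \<in> carrier G" shows "conjugate G h g"
proof -
  obtain x where x: "x \<in> carrier G" "h = x \<otimes> g \<otimes> inv x" using assms by (auto simp: conjugate_def)
  then have "g = inv x \<otimes> h \<otimes> inv (inv x)" using assms(2) by (simp add: m_assoc inv_solve_left)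
  then show ?thesis using x(1) by (metis conjugateI inv_closed)
qed

lemma conjugate_trans:
  assumes "conjugate G g h" "conjugate G h k" "g \<in> carrier G" shows "conjugate G g k"
proof -
  obtain x y where "x \<in> carrier G" "h = x \<otimes> g \<otimes> inv x" "y \<in> carrier G" "k = y \<otimes> h \<otimes> inv y"
    using assms by (auto simp: conjugate_def)
  then have "k = (y \<otimes> x) \<otimes> g \<otimes> inv (y \<otimes> x)" "y \<otimes> x \<in> carrier G"
    using assms(3) by (auto simp: m_assoc inv_mult_group)
  then show ?thesis by (auto simp: conjugate_def)
qed

lemma conj_mult:
  assumes "x \<in> carrier G" "g \<in> carrier G" "h \<in> carrier G"
  shows "(x \<otimes> g \<otimes> inv x) \<otimes> (x \<otimes> h \<otimes> inv x) = x \<otimes> (g \<otimes> h) \<otimes> inv x"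
proof -
  have "inv x \<otimes> (x \<otimes> (h \<otimes> inv x)) = h \<otimes> inv x" using assms by (simp add: m_assoc[symmetric])
  then show ?thesis using assms by (simp add: m_assoc)
qed

lemma conj_pow:
  assumes "x \<in> carrier G" "g \<in> carrier G"
  shows "(x \<otimes> g \<otimes> inv x) [^] (n::nat) = x \<otimes> (g [^] n) \<otimes> inv x"
  using assms by (induction n) (auto simp: conj_mult)

lemma conjugate_pow:
  "conjugate G g h \<Longrightarrow> g \<in> carrier G \<Longrightarrow> conjugate G (g [^] (n::nat)) (h [^] n)"
  by (auto simp: conjugate_def conj_pow)

lemma conjugate_one: "conjugate G \<one> h \<longleftrightarrow> h = \<one>"
  by (auto simp: conjugate_def)

end

lemma (in group_hom) conjugate_hom:
  "conjugate G x y \<Longrightarrow> x \<in> carrier G \<Longrightarrow> conjugate H (h x) (h y)"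
  by (auto simp: conjugate_def)

lemma length_concat_replicate [simp]: "length (concat (replicate n w)) = n * length w"
  by (induction n) auto

lemma nth_concat_replicate:
  "i < n * length w \<Longrightarrow> concat (replicate n w) ! i = w ! (i mod length w)"
proof (induction n arbitrary: i)
  case (Suc n)
  then show ?case by (cases "i < length w") (auto simp: nth_append le_mod_geq)
qed simp

text \<open>Lets a mergeable pair found anywhere in a power be located in a rotation of the base
  word, as long as it spans at most one period.\<close>

lemma window_concat_replicate:
  assumes "k \<le> length w" "i + k \<le> n * length w"
  shows "take k (drop i (concat (replicate n w))) = take k (rotate i w)"
  using assms by (intro nth_equalityI) (auto simp: nth_concat_replicate nth_rotate)

context graph_prod
begin

lemma conjugate_rotate:
  assumes "x \<in> words" "y \<in> words" shows "conjugate W (cls (x @ y)) (cls (y @ x))"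
proof -
  have "inv\<^bsub>W\<^esub> (cls x) \<otimes>\<^bsub>W\<^esub> cls (x @ y) \<otimes>\<^bsub>W\<^esub> inv\<^bsub>W\<^esub> (inv\<^bsub>W\<^esub> (cls x))
      = inv\<^bsub>W\<^esub> (cls x) \<otimes>\<^bsub>W\<^esub> (cls x \<otimes>\<^bsub>W\<^esub> cls y) \<otimes>\<^bsub>W\<^esub> cls x"
    using assms by (simp add: mult_cls)
  also have "\<dots> = cls (y @ x)" using assms by (simp add: W.m_assoc[symmetric]) (simp add: mult_cls)
  finally show ?thesis using assms W.conjugateI[of "inv\<^bsub>W\<^esub> (cls x)"] by (metis W.inv_closed cls_closed)
qed

text \<open>On words, dropping all vertices outside Q is the retraction of W onto the subgroup of a
  full subgraph; each elementary move either disappears or stays a move.\<close>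

lemma cls_filter:
  assumes "cls x = cls y" "x \<in> words" "y \<in> words"
  shows "cls (filter (\<lambda>l. Q (fst l)) x) = cls (filter (\<lambda>l. Q (fst l)) y)"
proof (rule cls_invariant[OF assms, of "\<lambda>w. cls (filter (\<lambda>l. Q (fst l)) w)"])
  fix x y assume "x \<in> words" "y \<in> words" "gp_step E G x y"
  from this(3,1,2) show "cls (filter (\<lambda>l. Q (fst l)) x) = cls (filter (\<lambda>l. Q (fst l)) y)"
  proof (induction rule: gp_step.induct)
    case (del xs v ys)
    then show ?case using cls_del[of "filter (\<lambda>l. Q (fst l)) xs"] by (auto simp: words_filter)
  next
    case (merge xs v a b ys)
    then show ?case using cls_merge[of "filter (\<lambda>l. Q (fst l)) xs"] by (auto simp: words_filter)
  next
    case (swap v u xs a b ys)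
    then show ?case using cls_swap[of "filter (\<lambda>l. Q (fst l)) xs"] by (auto simp: words_filter)
  qed
qed

lemma minimal_conjugate:
  assumes "g \<in> carrier W"
  obtains w where "w \<in> words" "conjugate W g (cls w)"
    "\<And>w'. w' \<in> words \<Longrightarrow> conjugate W g (cls w') \<Longrightarrow> length w \<le> length w'"
proof -
  obtain w0 where "w0 \<in> words" "g = cls w0" using assms by (rule carrierE)
  then have "w0 \<in> words \<and> conjugate W g (cls w0)" using assms W.conjugate_refl by simp
  from ex_has_least_nat[of "\<lambda>w. w \<in> words \<and> conjugate W g (cls w)", OF this, of length]
  show thesis using that by blast
qed

lemma not_distinct_pair:
  assumes "\<not> distinct (map fst w)" "\<And>k l. k \<in> set w \<Longrightarrow> l \<in> set w \<Longrightarrow> fst k = fst l \<or> {fst k, fst l} \<in> E"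
  shows "\<exists>x v c p d q. w = x @ (v, c) # p @ (v, d) # q \<and> (\<forall>l\<in>set p. {v, fst l} \<in> E)"
  using assms
proof (induction w)
  case (Cons l w)
  show ?case
  proof (cases "distinct (map fst w)")
    case True
    then have "fst l \<in> fst ` set w" using Cons.prems(1) by simp
    then have "\<exists>k\<in>set w. fst k = fst l" by (metis imageE)
    from split_list_first_prop[OF this]
    obtain p k q where w: "w = p @ k # q" "fst k = fst l" "\<forall>k\<in>set p. fst k \<noteq> fst l" by blast
    have "l # w = [] @ (fst l, snd l) # p @ (fst l, snd k) # q" using w by (metis append_Nil prod.collapse)
    moreover have "\<forall>k\<in>set p. {fst l, fst k} \<in> E" using w Cons.prems(2)[of l] by fastforce
    ultimately show ?thesis by blast
  next
    case False
    then obtain x v c p d q where "w = x @ (v, c) # p @ (v, d) # q \<and> (\<forall>l\<in>set p. {v, fst l} \<in> E)"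
      using Cons by (metis list.set_intros(2))
    then have "l # w = (l # x) @ (v, c) # p @ (v, d) # q \<and> (\<forall>l\<in>set p. {v, fst l} \<in> E)" by simp
    then show ?thesis by blast
  qed
qed simp

lemma filter_eq_appendE:
  assumes "filter Q w = a @ b"
  obtains w1 w2 where "w = w1 @ w2" "filter Q w1 = a" "filter Q w2 = b"
proof -
  have "\<exists>w1 w2. w = w1 @ w2 \<and> filter Q w1 = a \<and> filter Q w2 = b"
    using assms
  proof (induction w arbitrary: a)
    case (Cons l w)
    show ?case
    proof (cases "a = [] \<or> \<not> Q l")
      case True
      then show ?thesis
      proof
        assume "a = []"
        then show ?thesis using Cons.prems by (intro exI[of _ "[]"] exI[of _ "l # w"]) simp
      next
        assume "\<not> Q l"
        then obtain w1 w2 where "w = w1 @ w2 \<and> filter Q w1 = a \<and> filter Q w2 = b" using Cons by force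
        then show ?thesis using \<open>\<not> Q l\<close> by (intro exI[of _ "l # w1"] exI[of _ w2]) simp
      qed
    next
      case False
      then obtain a' where a: "a = l # a'" "filter Q w = a' @ b" using Cons.prems by (cases a) auto
      then obtain w1 w2 where "w = w1 @ w2 \<and> filter Q w1 = a' \<and> filter Q w2 = b" using Cons.IH by blast
      then show ?thesis using a False by (intro exI[of _ "l # w1"] exI[of _ w2]) simp
    qed
  qed simp
  then show thesis using that by blast
qed

text \<open>In a shortest representative of the conjugacy class, the letters that do not commute with
  the rest of the word form a word all of whose powers are reduced; so there are none.\<close>

theorem torsion_conjugate_clique:
  assumes g: "g \<in> carrier W" "g [^]\<^bsub>W\<^esub> (n::nat) = \<one>\<^bsub>W\<^esub>" "n > 0"
  obtains w where "w \<in> words" "conjugate W g (cls w)" "distinct (map fst w)"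
    "\<And>k l. k \<in> set w \<Longrightarrow> l \<in> set w \<Longrightarrow> fst k = fst l \<or> {fst k, fst l} \<in> E"
proof -
  obtain w where w: "w \<in> words" "conjugate W g (cls w)"
    and least: "\<And>w'. w' \<in> words \<Longrightarrow> conjugate W g (cls w') \<Longrightarrow> length w \<le> length w'"
    using minimal_conjugate[OF g(1)] by metis
  have least': False if "w' \<in> words" "conjugate W g (cls w')" "length w' < length w" for w'
    using least that by fastforce
  have noid: "snd l \<noteq> \<one>\<^bsub>G (fst l)\<^esub>" if "l \<in> set w" for l
    using shorten_identity[OF w(1) that] least' w(2) by metis
  \<comment> \<open>Rotations of w represent conjugates of g, so a mergeable pair in any rotation
    would contradict minimality.\<close>
  have nopair: False if split: "w = w1 @ w2" "w2 @ w1 = x @ (v, c) # p @ (v, d) # q" "\<forall>l\<in>set p. {v, fst l} \<in> E"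
    for w1 w2 x v c p d q
  proof -
    have "w2 @ w1 \<in> words" using w that(1) by auto
    then obtain w' where w': "w' \<in> words" "length w' < length (w2 @ w1)" "cls w' = cls (w2 @ w1)"
      using shorten_pair split by metis
    moreover have "conjugate W g (cls w')"
      using W.conjugate_trans[OF w(2) _ g(1)] conjugate_rotate[of w1 w2] w'(3) that(1) w(1) by simp
    ultimately show False using least'[of w'] split(1) by simp
  qed
  \<comment> \<open>Letters at vertices without \<open>nc\<close> commute with all letters of w at
    other vertices. The aim is to show that no other letters exist.\<close>
  define nc where "nc v \<longleftrightarrow> (\<exists>y\<in>fst ` set w. y \<noteq> v \<and> {v, y} \<notin> E)" for v
  define w' where "w' = filter (\<lambda>l. nc (fst l)) w"
  have w'_words: "w' \<in> words" using w(1) by (simp add: w'_def words_filter)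
  have "w' = []"
  proof (rule ccontr)
    assume "w' \<noteq> []"
    define m where "m = length w'"
    define u where "u = concat (replicate n w')"
    have u_set: "set u \<subseteq> set w'" by (auto simp: u_def)
    have u_words: "u \<in> words" using w'_words by (auto simp: u_def intro: words_concat)
    have "cls w [^]\<^bsub>W\<^esub> n = \<one>\<^bsub>W\<^esub>"
      using W.conjugate_pow[OF w(2) g(1), of n] g(2) by (simp add: W.conjugate_one)
    then have "cls (concat (replicate n w)) = cls []" using w(1) by (simp add: pow_cls one_eq)
    from cls_filter[OF this, of nc] have "cls u = cls []"
      using w(1) words_concat[of "replicate n w"] by (simp add: filter_concat u_def w'_def)
    moreover have "u \<noteq> []" using \<open>w' \<noteq> []\<close> g(3) by (auto simp: u_def)
    ultimately have "\<not> reduced u" using reduced_trivial u_words by blast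
    then obtain x v c p d q where u: "u = x @ (v, c) # p @ (v, d) # q" and p: "\<forall>l\<in>set p. {v, fst l} \<in> E"
      using not_reducedE[of u] u_set noid by (metis (no_types, lifting) filter_is_subset subsetD w'_def)
    have len: "length x + length p + 2 \<le> n * m" 
      using arg_cong[OF u, of length] by (simp add: u_def m_def)
    have "(v, c) \<in> set w'" using u u_set by auto
    then have "nc v" "v \<in> fst ` set w" by (force simp: w'_def)+
    then obtain l where l: "l \<in> set w" "fst l \<noteq> v" "{v, fst l} \<notin> E" by (auto simp: nc_def)
    have "nc (fst l)" using \<open>v \<in> fst ` set w\<close> l unfolding nc_def
      by (intro bexI[of _ v]) (auto simp: insert_commute)
    then have "l \<in> set w'" using l by (simp add: w'_def)
    have win: "take k (drop (length x) u) = take k (rotate (length x) w')" if "k \<le> m" "k \<le> length p + 2" for k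
      unfolding u_def using that len by (intro window_concat_replicate) (auto simp: m_def)
    show False
    \<comment> \<open>If the pair is a full period or more apart, the letters before the second one
      include \<open>l\<close>, whose vertex differs from v and is not adjacent to it. Otherwise the
      pair already lies in a rotation of \<open>w'\<close>.\<close>
    proof (cases "m \<le> length p + 1")
      case True
      then have "take m ((v, c) # p) = rotate (length x) w'"
        using win[of m] take_append[of m "(v, c) # p" "(v, d) # q"] by (simp add: u m_def)
      then have "l \<in> set ((v, c) # p)" using \<open>l \<in> set w'\<close> by (metis in_set_takeD set_rotate)
      then show False using l p by auto
    next
      case False
      then have "take (length p + 2) (rotate (length x) w') = (v, c) # p @ [(v, d)]"
        using win[of "length p + 2"] by (simp add: u)
      then obtain r where r: "rotate (length x) w' = (v, c) # p @ (v, d) # r"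
        by (metis append_take_drop_id append_Cons append_assoc append_Nil)
      \<comment> \<open>The rotation of the filtered word is lifted to a rotation
        \<open>w2 @ w1\<close> of w itself, where \<open>nopair\<close> applies.\<close>
      obtain a b where ab: "w' = a @ b" "rotate (length x) w' = b @ a"
        using that by (metis append_take_drop_id rotate_drop_take)
      obtain w1 w2 where w12: "w = w1 @ w2" "filter (\<lambda>l. nc (fst l)) w1 = a" "filter (\<lambda>l. nc (fst l)) w2 = b"
        using filter_eq_appendE ab(1) w'_def by metis
      then have "filter (\<lambda>l. nc (fst l)) (w2 @ w1) = (v, c) # p @ (v, d) # r" using ab r by simp
      then obtain x0 y where x0: "w2 @ w1 = x0 @ (v, c) # y" "filter (\<lambda>l. nc (fst l)) y = p @ (v, d) # r"
        by (auto simp: filter_eq_Cons_iff simp del: filter_append)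
      then obtain p0 y0 where p0: "y = p0 @ y0" "filter (\<lambda>l. nc (fst l)) p0 = p"
        "filter (\<lambda>l. nc (fst l)) y0 = (v, d) # r"
        using filter_eq_appendE by metis
      then obtain z q0 where z: "y0 = z @ (v, d) # q0" "\<forall>l\<in>set z. \<not> nc (fst l)"
        by (auto simp: filter_eq_Cons_iff)
      have "w2 @ w1 = x0 @ (v, c) # (p0 @ z) @ (v, d) # q0" using x0 p0 z by simp
      \<comment> \<open>Letters between the pair that survive the filter belong to p and are
        adjacent to v; those filtered out are adjacent to v because v occurs in w.\<close>
      moreover have "{v, fst k} \<in> E" if "k \<in> set (p0 @ z)" for k
      proof (cases "nc (fst k)")
        case True
        then have "k \<in> set p" using that p0 z by auto
        then show ?thesis using p by auto
      next
        case False
        moreover have "v \<noteq> fst k" using \<open>nc v\<close> False by auto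
        ultimately show ?thesis using \<open>v \<in> fst ` set w\<close> by (auto simp: nc_def insert_commute)
      qed
      ultimately show False using nopair[OF w12(1)] by blast
    qed
  qed
  then have clique: "fst k = fst l \<or> {fst k, fst l} \<in> E" if "k \<in> set w" "l \<in> set w" for k l
    using that by (force simp: w'_def nc_def filter_empty_conv)
  moreover have "distinct (map fst w)"
  proof (rule ccontr)
    assume "\<not> distinct (map fst w)"
    from not_distinct_pair[OF this clique] obtain x v c p d q
      where "w = x @ (v, c) # p @ (v, d) # q" "\<forall>l\<in>set p. {v, fst l} \<in> E" by blast
    then show False using nopair[of "[]" w x v c p d q] by simp
  qed
  ultimately show thesis using that w by blast
qed

end

section \<open>Homogeneous quasimorphisms\<close>

context group
begin

lemma quasimorphism_pow:
  assumes D: "\<And>g h. g \<in> carrier G \<Longrightarrow> h \<in> carrier G \<Longrightarrow> \<bar>f g + f h - f (g \<otimes> h)\<bar> \<le> D"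
    and "g \<in> carrier G"
  shows "\<bar>f (g [^] (Suc m * n)) - real (Suc m) * f (g [^] n)\<bar> \<le> real m * D"
proof (induction m)
  case (Suc m)
  have "g [^] (Suc (Suc m) * n) = g [^] n \<otimes> g [^] (Suc m * n)"
    using assms(2) by (simp add: nat_pow_mult)
  then have "\<bar>f (g [^] n) + f (g [^] (Suc m * n)) - f (g [^] (Suc (Suc m) * n))\<bar> \<le> D"
    using D[of "g [^] n" "g [^] (Suc m * n)"] assms(2) by simp
  then show ?case using Suc by (simp add: algebra_simps)
qed simp

text \<open>The averages at m and at n differ from the average at m n by at most D/m and D/n, so the
  sequence is Cauchy. The limit stays within D of f and therefore has defect at most 4 D. The limit
  formula is exported because values are computed from it later.\<close>

lemma homogenization:
  assumes "quasimorphism G f"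
  obtains F where "quasimorphism G F" "homogeneous_qm G F"
    "\<And>g. g \<in> carrier G \<Longrightarrow> (\<lambda>n. f (g [^] n) / real n) \<longlonglongrightarrow> F g"
proof -
  obtain D where D: "\<And>g h. g \<in> carrier G \<Longrightarrow> h \<in> carrier G \<Longrightarrow> \<bar>f g + f h - f (g \<otimes> h)\<bar> \<le> D"
    using assms by (auto simp: quasimorphism_def)
  have D0: "D \<ge> 0" using D[of \<one> \<one>] by simp
  define a where "a g n = f (g [^] n) / real n" for g and n :: nat
  have est: "\<bar>a g (m * n) - a g n\<bar> \<le> D / real n" if "g \<in> carrier G" "m > 0" "n > 0" for g m n
  proof -
    obtain k where "m = Suc k" using \<open>m > 0\<close> gr0_implies_Suc by blast
    then have "\<bar>f (g [^] (m * n)) - real m * f (g [^] n)\<bar> \<le> real k * D"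
      using quasimorphism_pow[OF D that(1)] by blast
    also have "\<dots> \<le> real m * D" using \<open>m = Suc k\<close> D0 by (simp add: mult_right_mono)
    finally have "\<bar>f (g [^] (m * n)) - real m * f (g [^] n)\<bar> / (real m * real n) \<le> real m * D / (real m * real n)"
      using that by (intro divide_right_mono) auto
    moreover have "\<bar>a g (m * n) - a g n\<bar> = \<bar>f (g [^] (m * n)) - real m * f (g [^] n)\<bar> / (real m * real n)"
    proof -
      have "a g (m * n) - a g n = (f (g [^] (m * n)) - real m * f (g [^] n)) / (real m * real n)"
        using that by (simp add: a_def field_simps)
      then show ?thesis using that by (simp add: abs_divide abs_mult)
    qed
    ultimately show ?thesis using that by simp
  qed
  have est2: "\<bar>a g m - a g n\<bar> \<le> D / real m + D / real n" if "g \<in> carrier G" "m > 0" "n > 0" for g m n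
    using est[of g m n] est[of g n m] that by (simp add: mult.commute)
  have conv: "convergent (a g)" if g: "g \<in> carrier G" for g
  proof (rule Cauchy_convergent, rule CauchyI)
    fix e :: real assume e: "e > 0"
    obtain M where M: "real M > 2 * D / e" using reals_Archimedean2 by blast
    have small: "D / real n < e / 2" if "n \<ge> Suc M" for n
    proof -
      have "2 * D / e < real n" using M that by linarith
      then show ?thesis using e that by (simp add: field_simps)
    qed
    have "norm (a g m - a g n) < e" if "m \<ge> Suc M" "n \<ge> Suc M" for m n
    proof -
      have "0 < m" "0 < n" using that by auto
      from est2[OF g this] small[OF that(1)] small[OF that(2)] show ?thesis
        unfolding real_norm_def by linarith
    qed
    then show "\<exists>M. \<forall>m\<ge>M. \<forall>n\<ge>M. norm (a g m - a g n) < e" by blast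
  qed
  define F where "F g = lim (a g)" for g
  have lim: "a g \<longlonglongrightarrow> F g" if "g \<in> carrier G" for g
    using conv[OF that] by (simp add: F_def convergent_LIMSEQ_iff)
  have close: "\<bar>F g - f g\<bar> \<le> D" if g: "g \<in> carrier G" for g
  proof (rule tendsto_upperbound)
    show "(\<lambda>n. \<bar>a g n - f g\<bar>) \<longlonglongrightarrow> \<bar>F g - f g\<bar>" by (intro tendsto_intros lim g)
    show "\<forall>\<^sub>F n in sequentially. \<bar>a g n - f g\<bar> \<le> D"
      using eventually_gt_at_top[of 0] by eventually_elim (use est[OF g, of _ 1] g in \<open>auto simp: a_def\<close>)
  qed simp
  have "\<bar>F g + F h - F (g \<otimes> h)\<bar> \<le> 4 * D" if "g \<in> carrier G" "h \<in> carrier G" for g h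
    using close[of g] close[of h] close[of "g \<otimes> h"] D[of g h] that by simp
  then have qm: "quasimorphism G F" by (auto simp: quasimorphism_def)
  have inv: "F (inv g) = - F g" if g: "g \<in> carrier G" for g
  proof -
    have "(\<lambda>n. a g n + a (inv g) n) \<longlonglongrightarrow> F g + F (inv g)" by (intro tendsto_add lim) (auto simp: g)
    moreover have "(\<lambda>n. a g n + a (inv g) n) \<longlonglongrightarrow> 0"
    proof (rule tendsto_sandwich[of "\<lambda>n. - 2 * D / real n" _ _ "\<lambda>n. 2 * D / real n"])
      \<comment> \<open>One D for the defect at the pair of inverse powers and one more for the
        value at the identity, which is itself at most D.\<close>
      have b: "\<bar>f (g [^] n) + f (inv g [^] n)\<bar> \<le> 2 * D" for n :: nat
        using D[of "g [^] n" "inv g [^] n"] D[of \<one> \<one>] g by (simp add: nat_pow_inv)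
      have "- 2 * D / real n \<le> a g n + a (inv g) n" "a g n + a (inv g) n \<le> 2 * D / real n" for n
      proof -
        have lo: "- 2 * D \<le> f (g [^] n) + f (inv g [^] n)" and hi: "f (g [^] n) + f (inv g [^] n) \<le> 2 * D"
          using b[of n] by linarith+
        show "- 2 * D / real n \<le> a g n + a (inv g) n" "a g n + a (inv g) n \<le> 2 * D / real n"
          using divide_right_mono[OF lo, of "real n"] divide_right_mono[OF hi, of "real n"]
          by (simp_all add: a_def add_divide_distrib)
      qed
      then show "\<forall>\<^sub>F n in sequentially. - 2 * D / real n \<le> a g n + a (inv g) n"
        "\<forall>\<^sub>F n in sequentially. a g n + a (inv g) n \<le> 2 * D / real n" by auto
    qed (rule lim_const_over_n)+
    ultimately show ?thesis using LIMSEQ_unique by fastforce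
  qed
  have nat: "F (g [^] k) = real k * F g" if g: "g \<in> carrier G" for g and k :: nat
  proof (cases "k = 0")
    case True
    have "F \<one> = 0" using inv[of \<one>] by simp
    then show ?thesis using True by simp
  next
    case False
    have "(\<lambda>n. real k * a g (k * n)) \<longlonglongrightarrow> real k * F g"
    proof (intro tendsto_mult tendsto_const)
      have "strict_mono (\<lambda>n. k * n)" using False by (auto simp: strict_mono_def)
      from LIMSEQ_subseq_LIMSEQ[OF lim[OF g] this] show "(\<lambda>n. a g (k * n)) \<longlonglongrightarrow> F g"
        by (simp add: comp_def)
    qed
    moreover have "(\<lambda>n. real k * a g (k * n)) = a (g [^] k)"
      using False g by (auto simp: a_def nat_pow_pow fun_eq_iff)
    ultimately show ?thesis using lim[of "g [^] k"] g LIMSEQ_unique by fastforce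
  qed
  have "F (g [^] n) = of_int n * F g" if g: "g \<in> carrier G" for g and n :: int
  proof (cases n rule: int_cases2)
    case (nonneg k)
    then show ?thesis using nat[OF g] by (simp add: int_pow_int)
  next
    case (nonpos k)
    then show ?thesis using nat[OF g, of k] inv[of "g [^] k"] g by (simp add: int_pow_neg int_pow_int)
  qed
  then have "homogeneous_qm G F" by (simp add: homogeneous_qm_def)
  then show thesis using that[OF qm] lim unfolding a_def by blast
qed

lemma homogeneous_nat:
  assumes "homogeneous_qm G F" "g \<in> carrier G" shows "F (g [^] (n::nat)) = real n * F g"
proof -
  have "F (g [^] int n) = of_int (int n) * F g" using assms by (simp only: homogeneous_qm_def)
  then show ?thesis by (simp add: int_pow_int)
qed

lemma homogeneous_inv:
  assumes "homogeneous_qm G F" "g \<in> carrier G" shows "F (inv g) = - F g"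
proof -
  have "F (g [^] (- 1 :: int)) = of_int (- 1) * F g" using assms by (simp only: homogeneous_qm_def)
  then show ?thesis using assms(2) by (simp add: int_pow_neg)
qed

lemma homogeneous_torsion:
  assumes "homogeneous_qm G F" "g \<in> carrier G" "g [^] (n::nat) = \<one>" "n > 0" shows "F g = 0"
proof -
  have "F \<one> = 0" using homogeneous_nat[OF assms(1), of \<one> 0] by simp
  then show ?thesis using homogeneous_nat[OF assms(1,2), of n] assms(3,4) by simp
qed

text \<open>Conjugation changes F by at most 2 D, uniformly in the element. Applied to the n-th
  power of g, this bounds n times the difference for every n.\<close>

lemma homogeneous_conj:
  assumes "quasimorphism G F" "homogeneous_qm G F" "g \<in> carrier G" "x \<in> carrier G"
  shows "F (x \<otimes> g \<otimes> inv x) = F g"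
proof -
  obtain D where D: "\<And>g h. g \<in> carrier G \<Longrightarrow> h \<in> carrier G \<Longrightarrow> \<bar>F g + F h - F (g \<otimes> h)\<bar> \<le> D"
    using assms(1) by (auto simp: quasimorphism_def)
  have *: "\<bar>F (x \<otimes> h \<otimes> inv x) - F h\<bar> \<le> 2 * D" if "h \<in> carrier G" for h
    using D[of x h] D[of "x \<otimes> h" "inv x"] homogeneous_inv[OF assms(2,4)] that assms(4) by simp
  have le: "real n * \<bar>F (x \<otimes> g \<otimes> inv x) - F g\<bar> \<le> 2 * D" for n :: nat
  proof -
    have "real n * (F (x \<otimes> g \<otimes> inv x) - F g) = F (x \<otimes> (g [^] n) \<otimes> inv x) - F (g [^] n)"
      using assms homogeneous_nat[OF assms(2), of "x \<otimes> g \<otimes> inv x" n] homogeneous_nat[OF assms(2,3), of n]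
      by (simp add: conj_pow right_diff_distrib)
    then show ?thesis using *[of "g [^] n"] assms(3) by (metis abs_mult abs_of_nat nat_pow_closed)
  qed
  show ?thesis
  proof (rule ccontr)
    assume "F (x \<otimes> g \<otimes> inv x) \<noteq> F g"
    then have "\<bar>F (x \<otimes> g \<otimes> inv x) - F g\<bar> > 0" by simp
    from reals_Archimedean3[OF this] obtain n where "2 * D < real n * \<bar>F (x \<otimes> g \<otimes> inv x) - F g\<bar>" by blast
    then show False using le[of n] by linarith
  qed
qed

end

section \<open>Counting factors of lists\<close>

text \<open>Every start position is tested, so overlapping occurrences all count.\<close>

primrec count_factor :: "'a list \<Rightarrow> 'a list \<Rightarrow> nat" where
  "count_factor p [] = 0"
| "count_factor p (x # s) = (if take (length p) (x # s) = p then 1 else 0) + count_factor p s"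

lemma count_factor_le: "count_factor p s \<le> length s"
  by (induction s) auto

lemma count_factor_append_ge: "count_factor p (s @ t) \<ge> count_factor p s + count_factor p t"
proof (induction s)
  case (Cons x s)
  have "take (length p) (x # s @ t) = p" if "take (length p) (x # s) = p"
    using that by (metis append_Cons append_take_drop_id append_eq_conv_conj append_assoc)
  then show ?case using Cons by auto
qed simp

text \<open>Only occurrences that start in s and reach into t are new, and they start among the last
  \<open>length p\<close> positions of s.\<close>

lemma count_factor_append_le:
  "count_factor p (s @ t) \<le> count_factor p s + count_factor p t + min (length s) (length p)"
proof (induction s)
  case (Cons x s)
  show ?case
  proof (cases "length p \<le> length (x # s)")
    case True
    then have "take (length p) (x # s @ t) = take (length p) (x # s)"
      using take_append[of "length p" "x # s" t] by simp
    then show ?thesis using Cons by auto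
  next
    case False
    then show ?thesis using Cons by auto
  qed
qed simp

lemma count_factor_factor:
  assumes "count_factor p s \<noteq> 0" obtains x y where "s = x @ p @ y"
proof -
  have "\<exists>x y. s = x @ p @ y"
    using assms
  proof (induction s)
    case (Cons a s)
    show ?case
    proof (cases "take (length p) (a # s) = p")
      case True
      then have "a # s = [] @ p @ drop (length p) (a # s)" by (metis append_Nil append_take_drop_id)
      then show ?thesis by blast
    next
      case False
      then obtain x y where "s = x @ p @ y" using Cons by auto
      then have "a # s = (a # x) @ p @ y" by simp
      then show ?thesis by blast
    qed
  qed simp
  then show thesis using that by blast
qed

lemma count_factor_replicate: "p \<noteq> [] \<Longrightarrow> count_factor p (concat (replicate n p)) \<ge> n"
proof (induction n)
  case (Suc n)
  have "count_factor p p \<ge> 1" using Suc.prems by (cases p) auto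
  then show ?case using Suc count_factor_append_ge[of p p "concat (replicate n p)"] by simp
qed simp

text \<open>The window z starts inside some block. The rest of that block and the whole next one
  have together at most 2 L letters, so the next block lies inside z.\<close>

lemma block_in_window:
  assumes "concat bs = x @ z @ y" "\<And>b. b \<in> set bs \<Longrightarrow> length b \<le> L \<and> set C \<subseteq> set b"
    and "length z \<ge> 2 * L" "L > 0"
  shows "set C \<subseteq> set z"
  using assms(1,2)
proof (induction bs arbitrary: x)
  case Nil
  then show ?case using assms(3,4) by simp
next
  case (Cons b bs)
  show ?case
  proof (cases "length b \<le> length x")
    case True
    then have "concat bs = drop (length b) x @ z @ y"
      using Cons.prems(1) by (metis append_eq_conv_conj append_eq_append_conv_if concat.simps(2) drop_append diff_is_0_eq drop0)
    then show ?thesis using Cons by simp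
  next
    case False
    have lb: "length b \<le> L" using Cons.prems(2) by simp
    show ?thesis
    proof (cases bs)
      case Nil
      then have "length b = length x + length z + length y"
        using arg_cong[OF Cons.prems(1), of length] by simp
      then show ?thesis using lb assms(3,4) by simp
    next
      case (Cons b' bs')
      have b': "length b' \<le> L" "set C \<subseteq> set b'" using Cons.prems(2) local.Cons by auto
      have eq: "b @ b' @ concat bs' = x @ z @ y" using Cons.prems(1) local.Cons by simp
      have "drop (length x) (b @ b' @ concat bs') = z @ y" using eq by simp
      then have "drop (length x) b @ b' @ concat bs' = z @ y" using False by simp
      then have "take (length z) (drop (length x) b @ b' @ concat bs') = z" by simp
      moreover have "length (drop (length x) b @ b') \<le> length z" using lb b' assms(3) by simp
      ultimately have "set (drop (length x) b @ b') \<subseteq> set z"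
        by (metis append.assoc append_eq_conv_conj le_sup_iff set_append set_take_subset_set_take take_all_iff take_append order_refl)
      then show ?thesis using b' by auto
    qed
  qed
qed

text \<open>Both runs are long enough to contain a full block, so every letter of C equals c and
  also d.\<close>

lemma no_two_runs:
  assumes "concat bs = x @ replicate M c @ replicate M d @ y" "C \<noteq> []"
    and "\<And>b. b \<in> set bs \<Longrightarrow> length b \<le> L \<and> set C \<subseteq> set b" "M \<ge> 2 * L" "L > 0"
  shows "c = d"
proof -
  have "set C \<subseteq> set (replicate M c)"
    using block_in_window[OF assms(1,3)] assms(4,5) by simp
  moreover have "set C \<subseteq> set (replicate M d)"
    using block_in_window[of bs "x @ replicate M c" "replicate M d" y, OF _ assms(3)] assms(1,4,5) by simp
  ultimately show ?thesis using assms(2) by (cases C) (auto split: if_splits)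
qed

definition code_word :: "'a \<Rightarrow> 'a \<Rightarrow> nat \<Rightarrow> 'a list" where
  "code_word a b K = replicate K a @ replicate (2 * K) b @ replicate (3 * K) a @ replicate (4 * K) b"

lemma length_code_word [simp]: "length (code_word a b K) = 10 * K"
  by (simp add: code_word_def)

lemma nth_code_word:
  "i < 10 * K \<Longrightarrow> code_word a b K ! i = (if i < K \<or> 3 * K \<le> i \<and> i < 6 * K then a else b)"
  by (auto simp: code_word_def nth_append)

text \<open>Reversing the cyclic sequence of run lengths K, 2K, 3K, 4K does not give a rotation of it.\<close>

lemma code_word_chiral:
  assumes "concat (replicate n (code_word a b K)) = x @ rev (code_word d c K) @ y" "a \<noteq> b" "c \<noteq> d" "K > 0"
  shows False
proof -
  define s where "s i = (if i mod (10 * K) < K \<or> 3 * K \<le> i mod (10 * K) \<and> i mod (10 * K) < 6 * K then a else b)" for i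
  have s: "s (length x + j) = rev (code_word d c K) ! j" if "j < 10 * K" for j
  proof -
    have "length x + j < n * (10 * K)" using arg_cong[OF assms(1), of length] that by simp
    then have "concat (replicate n (code_word a b K)) ! (length x + j) = s (length x + j)"
      using assms(4) by (simp add: nth_concat_replicate nth_code_word s_def)
    then show ?thesis using that by (simp add: assms(1) nth_append)
  qed
  have r: "rev (code_word d c K) ! j = (if j < 4 * K \<or> 7 * K \<le> j \<and> j < 9 * K then c else d)" if "j < 10 * K" for j
    using that assms(4) by (auto simp: rev_nth nth_code_word)
  \<comment> \<open>The reversed word is c, d, c, d with run lengths 4K, 3K, 2K, K, and t is where
    its first d-run begins. The change of letter at t must sit at 0, K, 3K or 6K modulo 10K. The
    first two are refuted by the values at t + K and t + 2K, the last by t + 3K, and 3K by t +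
    5K.\<close>
  define t where "t = length x + 4 * K"
  have v: "s (t - 1) = c" "s t = d" "s (t + K) = d" "s (t + 2 * K) = d" "s (t + 3 * K) = c" "s (t + 5 * K) = d"
    using s[of "4 * K - 1"] r[of "4 * K - 1"] s[of "4 * K"] r[of "4 * K"] s[of "5 * K"] r[of "5 * K"]
      s[of "6 * K"] r[of "6 * K"] s[of "7 * K"] r[of "7 * K"] s[of "9 * K"] r[of "9 * K"] assms(4)
    by (auto simp: t_def add.assoc)
  define m where "m = t mod (10 * K)"
  have m: "m < 10 * K" using assms(4) by (simp add: m_def)
  have shift: "s (t + j) = s (m + j)" for j by (simp add: s_def m_def mod_add_left_eq)
  have t1: "s (t - 1) = s (m + 10 * K - 1)"
  proof -
    have "(t - 1 + 10 * K) mod (10 * K) = (m + 10 * K - 1) mod (10 * K)"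
    proof -
      have "t - 1 + 10 * K = t + (10 * K - 1)" using assms(4) by (simp add: t_def)
      moreover have "m + 10 * K - 1 = m + (10 * K - 1)" using assms(4) by simp
      ultimately show ?thesis by (simp add: m_def mod_add_left_eq)
    qed
    then show ?thesis by (simp add: s_def)
  qed
  \<comment> \<open>Two periods suffice, since m is below 10K and all offsets, including 10K - 1 in
    place of -1, are below 10K.\<close>
  have ev: "s i = (if i < K \<or> 3 * K \<le> i \<and> i < 6 * K \<or> 10 * K \<le> i \<and> i < 11 * K \<or> 13 * K \<le> i \<and> i < 16 * K then a else b)"
    if "i < 20 * K" for i
  proof (cases "i < 10 * K")
    case False
    then have "i mod (10 * K) = i - 10 * K" using that by (simp add: le_mod_geq)
    then show ?thesis using False that by (auto simp: s_def)
  qed (auto simp: s_def)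
  have "s (m + 10 * K - 1) = c" "s m = d" "s (m + K) = d" "s (m + 2 * K) = d" "s (m + 3 * K) = c" "s (m + 5 * K) = d"
    using v t1 shift shift[of 0] by simp_all
  then show False
    using ev[of "m + 10 * K - 1"] ev[of m] ev[of "m + K"] ev[of "m + 2 * K"] ev[of "m + 3 * K"] ev[of "m + 5 * K"] m assms(2-4)
    by (auto split: if_splits)
qed

section \<open>Free products of two finite abelian groups\<close>

text \<open>The index \<open>True\<close> stands for the factor A, whose letters get counted, and
  \<open>False\<close> for B.\<close>

locale free_product2 =
  fixes H :: "bool \<Rightarrow> 'h monoid"
  assumes factor_comm_group: "comm_group (H i)" and factor_finite: "finite (carrier (H i))"
begin

lemma factor_group: "group (H i)"
  using factor_comm_group by (rule comm_group.axioms(2))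

sublocale graph_prod UNIV "{}" H
  by (simp add: graph_prod_def factor_group)

text \<open>Without edges, the projection to the two vertices is the whole word, so nothing can be
  moved to the front.\<close>

lemma front_free [simp]: "front v (fam w) \<longleftrightarrow> w \<noteq> [] \<and> fst (hd w) = v"
proof
  have "filter (\<lambda>l. fst l = v \<or> fst l = (\<not> v)) w = w" by (auto simp: filter_id_conv)
  moreover assume "front v (fam w)"
  ultimately show "w \<noteq> [] \<and> fst (hd w) = v"
    by (auto simp: front_def fam_def dest!: spec[of _ "\<not> v"])
next
  assume "w \<noteq> [] \<and> fst (hd w) = v"
  then show "front v (fam w)" by (cases w) (auto simp: front_def fam_def)
qed

lemma reduced_append:
  "reduced (x @ y) \<longleftrightarrow> reduced x \<and> reduced y \<and> (x = [] \<or> y = [] \<or> fst (last x) \<noteq> fst (hd y))"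
  by (induction x) (auto simp: hd_append)

lemma reduced_unique:
  assumes "cls w = cls w'" "w \<in> words" "w' \<in> words" "reduced w" "reduced w'"
  shows "w = w'"
proof -
  have "fam w True False = w" for w :: "(bool \<times> 'h) list" by (auto simp: fam_def filter_id_conv)
  then show ?thesis using fam_eq[OF assms] by metis
qed

definition nf :: "(bool \<times> 'h) list set \<Rightarrow> (bool \<times> 'h) list" where
  "nf g = (SOME w. w \<in> words \<and> reduced w \<and> cls w = g)"

lemma nf:
  assumes "g \<in> carrier W" shows "nf g \<in> words" "reduced (nf g)" "cls (nf g) = g"
proof -
  obtain w where "w \<in> words" "g = cls w" using assms by (rule carrierE)
  then obtain w' where "w' \<in> words \<and> reduced w' \<and> cls w' = g" using reduced_representative by metis
  then have "nf g \<in> words \<and> reduced (nf g) \<and> cls (nf g) = g" unfolding nf_def by (rule someI)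
  then show "nf g \<in> words" "reduced (nf g)" "cls (nf g) = g" by auto
qed

lemma nf_cls: "w \<in> words \<Longrightarrow> reduced w \<Longrightarrow> nf (cls w) = w"
  using nf[of "cls w"] by (intro reduced_unique) auto

lemma fst_hd_winv: "w \<noteq> [] \<Longrightarrow> fst (hd (winv w)) = fst (last w)"
  and fst_last_winv: "w \<noteq> [] \<Longrightarrow> fst (last (winv w)) = fst (hd w)"
  and winv_eq_Nil [simp]: "winv w = [] \<longleftrightarrow> w = []"
  and length_winv [simp]: "length (winv w) = length w"
  by (auto simp: winv_def hd_rev last_rev last_map hd_map case_prod_beta)

lemma reduced_winv: "w \<in> words \<Longrightarrow> reduced w \<Longrightarrow> reduced (winv w)"
proof (induction w)
  case (Cons l w)
  interpret Hl: group "H (fst l)" by (rule factor_group)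
  have "winv (l # w) = winv w @ [(fst l, inv\<^bsub>H (fst l)\<^esub> snd l)]" using winv_Cons[of "fst l" "snd l"] by simp
  then show ?case using Cons fst_last_winv[of w] by (auto simp: reduced_append)
qed simp

lemma last_letter: "w \<noteq> [] \<Longrightarrow> fst (last w) = j \<Longrightarrow> \<exists>w' e. w = w' @ [(j, e)]"
  by (cases w rule: rev_cases) auto

text \<open>After the maximal part \<open>c\<close> has cancelled, either nothing is left to merge
  or one letter \<open>s1\<close> of x and one letter \<open>s2\<close> of y merge into the single
  letter \<open>s\<close>. This controls how far the normal form of a product is from a
  concatenation.\<close>

lemma product_cancel:
  assumes "x \<in> words" "reduced x" "y \<in> words" "reduced y"
  obtains x1 s1 c s2 y1 s where "x = x1 @ s1 @ c" "y = winv c @ s2 @ y1" "c \<in> words"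
    "length s1 \<le> 1" "length s2 \<le> 1" "length s \<le> 1" "reduced (x1 @ s @ y1)" "x1 @ s @ y1 \<in> words"
    "cls (x @ y) = cls (x1 @ s @ y1)"
proof -
  have "\<exists>x1 s1 c s2 y1 s. x = x1 @ s1 @ c \<and> y = winv c @ s2 @ y1 \<and> c \<in> words \<and>
    length s1 \<le> 1 \<and> length s2 \<le> 1 \<and> length s \<le> 1 \<and> reduced (x1 @ s @ y1) \<and> x1 @ s @ y1 \<in> words \<and>
    cls (x @ y) = cls (x1 @ s @ y1)"
    using assms
  proof (induction x arbitrary: y rule: rev_induct)
    case Nil
    then show ?case
      by - (rule exI[of _ "[]"], rule exI[of _ "[]"], rule exI[of _ "[]"], rule exI[of _ "[]"],
          rule exI[of _ y], rule exI[of _ "[]"], simp)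
  next
    case (snoc l x)
    obtain v a where l: "l = (v, a)" by force
    interpret Hv: comm_group "H v" by (rule factor_comm_group)
    show ?case
    proof (cases "y \<noteq> [] \<and> fst (hd y) = v")
      case False
      then have "reduced ((x @ [l]) @ y)" using snoc.prems l unfolding reduced_append by auto
      then show ?thesis using snoc.prems
        by - (rule exI[of _ "x @ [l]"], rule exI[of _ "[]"], rule exI[of _ "[]"], rule exI[of _ "[]"],
            rule exI[of _ y], rule exI[of _ "[]"], simp)
    next
      case True
      then obtain b y' where y: "y = (v, b) # y'" by (cases y) auto
      have ab: "a \<in> carrier (H v)" "b \<in> carrier (H v)" "x \<in> words" "y' \<in> words" "reduced x" "reduced y'"
        using snoc.prems l y by (auto simp: reduced_append)
      have m: "cls ((x @ [l]) @ y) = cls (x @ (v, a \<otimes>\<^bsub>H v\<^esub> b) # y')"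
        using cls_merge[of x y' v a b] ab l y by simp
      show ?thesis
      proof (cases "a \<otimes>\<^bsub>H v\<^esub> b = \<one>\<^bsub>H v\<^esub>")
        case True
        then have b: "b = inv\<^bsub>H v\<^esub> a" using ab by (metis Hv.comm_inv_char)
        have "cls ((x @ [l]) @ y) = cls (x @ y')" using m True ab cls_del by simp
        moreover obtain x1 s1 c s2 y1 s where IH: "x = x1 @ s1 @ c" "y' = winv c @ s2 @ y1" "c \<in> words"
          "length s1 \<le> 1" "length s2 \<le> 1" "length s \<le> 1" "reduced (x1 @ s @ y1)" "x1 @ s @ y1 \<in> words"
          "cls (x @ y') = cls (x1 @ s @ y1)"
          using snoc.IH[of y'] ab by blast
        moreover have "x @ [l] = x1 @ s1 @ (c @ [l])" using IH(1) by simp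
        moreover have "y = winv (c @ [l]) @ s2 @ y1" using IH(2) l y b by (simp add: winv_Cons)
        moreover have "c @ [l] \<in> words" using IH(3) l ab by simp
        ultimately show ?thesis using IH(4-9) by metis
      next
        case False
        have "reduced (x @ [(v, a \<otimes>\<^bsub>H v\<^esub> b)] @ y')"
          using snoc.prems False l y by (auto simp: reduced_append)
        moreover have "x @ [(v, a \<otimes>\<^bsub>H v\<^esub> b)] @ y' \<in> words" using ab by simp
        moreover have "x @ [l] = x @ [l] @ []" "y = winv [] @ [(v, b)] @ y'" using y by simp_all
        moreover have "cls ((x @ [l]) @ y) = cls (x @ [(v, a \<otimes>\<^bsub>H v\<^esub> b)] @ y')" using m by simp
        ultimately show ?thesis
          by - (rule exI[of _ x], rule exI[of _ "[l]"], rule exI[of _ "[]"], rule exI[of _ "[(v, b)]"],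
              rule exI[of _ y'], rule exI[of _ "[(v, a \<otimes>\<^bsub>H v\<^esub> b)]"], simp)
      qed
    qed
  qed
  then show thesis using that by blast
qed

section \<open>Torsion, centralizers and endomorphisms of the free product\<close>

lemma projection:
  obtains r where "r \<in> hom W (H i)" "\<And>c. c \<in> carrier (H i) \<Longrightarrow> r (incl i c) = c"
    "\<And>c. c \<in> carrier (H (\<not> i)) \<Longrightarrow> r (incl (\<not> i) c) = \<one>\<^bsub>H i\<^esub>"
proof -
  interpret Hi: group "H i" by (rule factor_group)
  have "(\<lambda>a. if v = i then a else \<one>\<^bsub>H i\<^esub>) \<in> hom (H v) (H i)" for v
    by (cases "v = i") (auto simp: hom_def)
  from hom_extension[of "H i" "\<lambda>v a. if v = i then a else \<one>\<^bsub>H i\<^esub>", OF factor_group this]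
  obtain f where "f \<in> hom W (H i)" "\<And>v a. a \<in> carrier (H v) \<Longrightarrow> f (incl v a) = (if v = i then a else \<one>\<^bsub>H i\<^esub>)"
    by auto
  then show thesis using that[of f] by auto
qed

text \<open>Project to the factor \<open>H i\<close>: it is abelian, so conjugation becomes
  invisible there, and the other factor goes to the identity.\<close>

lemma conjugate_incl:
  assumes "conjugate W (incl i c) (incl j d)" "c \<in> carrier (H i)" "d \<in> carrier (H j)" "c \<noteq> \<one>\<^bsub>H i\<^esub>"
  shows "i = j \<and> c = d"
proof -
  obtain r where r: "r \<in> hom W (H i)" "\<And>c. c \<in> carrier (H i) \<Longrightarrow> r (incl i c) = c"
    "\<And>c. c \<in> carrier (H (\<not> i)) \<Longrightarrow> r (incl (\<not> i) c) = \<one>\<^bsub>H i\<^esub>"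
    using projection by blast
  interpret Hi: comm_group "H i" by (rule factor_comm_group)
  interpret r: group_hom W "H i" r
    using r(1) Hi.is_group group_W by (simp add: group_hom_def group_hom_axioms_def)
  obtain x where x: "x \<in> carrier (H i)" "r (incl j d) = x \<otimes>\<^bsub>H i\<^esub> c \<otimes>\<^bsub>H i\<^esub> inv\<^bsub>H i\<^esub> x"
    using r.conjugate_hom[OF assms(1)] assms(2) r(2) by (auto simp: conjugate_def)
  then have "r (incl j d) = c" using assms(2) by (simp add: Hi.m_comm[of x c] Hi.m_assoc)
  then show ?thesis using assms r(2,3) by (cases "i = j") auto
qed

text \<open>Prefixing d to w gives a reduced word. If w does not end in j, appending d is reduced
  too, and the two words begin at different vertices. If w ends in j, appending d merges and the
  result has a reduced form that is too short.\<close>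

lemma centralizer_aux:
  assumes "w \<in> words" "reduced w" "w = [] \<or> fst (hd w) \<noteq> j" "d \<in> carrier (H j)" "d \<noteq> \<one>\<^bsub>H j\<^esub>"
    and "cls ((j, d) # w) = cls (w @ [(j, d)])"
  shows "w = []"
proof (rule ccontr)
  assume "w \<noteq> []"
  interpret Hj: group "H j" by (rule factor_group)
  have r: "reduced ((j, d) # w)" using assms by auto
  show False
  proof (cases "fst (last w) = j")
    case False
    then have "reduced (w @ [(j, d)])" using assms by (auto simp: reduced_append)
    then have "(j, d) # w = w @ [(j, d)]" using reduced_unique[OF assms(6)] r assms by auto
    then show False using assms(3) \<open>w \<noteq> []\<close> by (metis fst_conv hd_append list.sel(1))
  next
    case True
    then obtain w' e where w: "w = w' @ [(j, e)]" using last_letter[OF \<open>w \<noteq> []\<close> True] by metis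
    have "cls (w @ [(j, d)]) = cls (w' @ [(j, e \<otimes>\<^bsub>H j\<^esub> d)])"
      using cls_merge[of w' "[]" j e d] assms w by simp
    moreover have "w' @ [(j, e \<otimes>\<^bsub>H j\<^esub> d)] \<in> words" using assms w by auto
    ultimately obtain z where z: "z \<in> words" "reduced z" "cls z = cls ((j, d) # w)" "length z \<le> length w"
    proof (cases "e \<otimes>\<^bsub>H j\<^esub> d = \<one>\<^bsub>H j\<^esub>")
      case True
      then have "cls (w' @ [(j, e \<otimes>\<^bsub>H j\<^esub> d)]) = cls w'" using cls_del[of w' "[]" j] assms w by simp
      then show thesis using that[of w'] assms w \<open>cls (w @ [(j, d)]) = _\<close> by (auto simp: reduced_append)
    next
      case False
      then have "reduced (w' @ [(j, e \<otimes>\<^bsub>H j\<^esub> d)])" using assms(2) w by (auto simp: reduced_append)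
      then show thesis using that[of "w' @ [(j, e \<otimes>\<^bsub>H j\<^esub> d)]"] assms w \<open>cls (w @ [(j, d)]) = _\<close> by auto
    qed
    then have "z = (j, d) # w" using r assms by (intro reduced_unique) auto
    then show False using z(4) by simp
  qed
qed

text \<open>A leading j-letter commutes with d because \<open>H j\<close> is abelian, so it can be
  split off and \<open>centralizer_aux\<close> handles the rest.\<close>

lemma centralizer:
  assumes "z \<in> carrier W" "d \<in> carrier (H j)" "d \<noteq> \<one>\<^bsub>H j\<^esub>" "incl j d \<otimes>\<^bsub>W\<^esub> z = z \<otimes>\<^bsub>W\<^esub> incl j d"
  obtains e where "e \<in> carrier (H j)" "z = incl j e"
proof -
  interpret Hj: comm_group "H j" by (rule factor_comm_group)
  define w where "w = nf z"
  have w: "w \<in> words" "reduced w" "z = cls w" using nf[OF assms(1)] by (auto simp: w_def)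
  have c: "cls ((j, d) # w) = cls (w @ [(j, d)])"
    using assms w by (simp add: gp_incl_def mult_cls)
  show thesis
  proof (cases "w = [] \<or> fst (hd w) \<noteq> j")
    case True
    then have "z = incl j \<one>\<^bsub>H j\<^esub>" using centralizer_aux[OF w(1,2) True assms(2,3) c] w incl_one[of j] one_eq by simp
    then show thesis using that[of "\<one>\<^bsub>H j\<^esub>"] by simp
  next
    case False
    then obtain e w' where w': "w = (j, e) # w'" by (cases w) auto
    then have e: "e \<in> carrier (H j)" "w' \<in> words" "reduced w'" "w' = [] \<or> fst (hd w') \<noteq> j" using w by auto
    have z: "z = incl j e \<otimes>\<^bsub>W\<^esub> cls w'" using w w' e cls_Cons by simp
    have "incl j e \<otimes>\<^bsub>W\<^esub> (incl j d \<otimes>\<^bsub>W\<^esub> cls w') = incl j d \<otimes>\<^bsub>W\<^esub> (incl j e \<otimes>\<^bsub>W\<^esub> cls w')"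
      using e assms by (simp add: W.m_assoc[symmetric] incl_mult[symmetric] Hj.m_comm)
    also have "\<dots> = incl j e \<otimes>\<^bsub>W\<^esub> (cls w' \<otimes>\<^bsub>W\<^esub> incl j d)" using assms z e by (simp add: W.m_assoc)
    finally have "incl j d \<otimes>\<^bsub>W\<^esub> cls w' = cls w' \<otimes>\<^bsub>W\<^esub> incl j d" using e assms by simp
    then have "cls ((j, d) # w') = cls (w' @ [(j, d)])"
      using assms(2) e by (simp add: gp_incl_def mult_cls)
    then have "w' = []" using centralizer_aux[OF e(2-4) assms(2,3)] by blast
    then show thesis using that[of e] e z by (simp flip: one_eq)
  qed
qed

lemma torsion_conjugate_incl:
  assumes "g \<in> carrier W" "g [^]\<^bsub>W\<^esub> (n::nat) = \<one>\<^bsub>W\<^esub>" "n > 0"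
  obtains x j d where "x \<in> carrier W" "d \<in> carrier (H j)" "g = x \<otimes>\<^bsub>W\<^esub> incl j d \<otimes>\<^bsub>W\<^esub> inv\<^bsub>W\<^esub> x"
proof -
  obtain w where w: "w \<in> words" "conjugate W g (cls w)" "distinct (map fst w)"
    "\<And>k l. k \<in> set w \<Longrightarrow> l \<in> set w \<Longrightarrow> fst k = fst l \<or> {fst k, fst l} \<in> {}"
    using torsion_conjugate_clique[OF assms] by blast
  have "\<exists>j d. d \<in> carrier (H j) \<and> cls w = incl j d"
  proof (cases w)
    case Nil
    then have "cls w = incl True \<one>\<^bsub>H True\<^esub>" using incl_one one_eq by simp
    then show ?thesis using factor_group by (metis group.is_monoid monoid.one_closed)
  next
    case (Cons l w')
    have "w' = []"
    proof (rule ccontr)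
      assume "w' \<noteq> []"
      then obtain k r where "w' = k # r" by (cases w') auto
      then show False using w(3) w(4)[of l k] Cons by auto
    qed
    then have "snd l \<in> carrier (H (fst l)) \<and> cls w = incl (fst l) (snd l)" using w(1) Cons by (simp add: gp_incl_def)
    then show ?thesis by blast
  qed
  moreover have "conjugate W (cls w) g" using W.conjugate_sym[OF w(2) assms(1)] .
  ultimately show thesis using that by (auto simp: conjugate_def)
qed

lemma incl_pow_order: "c \<in> carrier (H i) \<Longrightarrow> incl i c [^]\<^bsub>W\<^esub> order (H i) = \<one>\<^bsub>W\<^esub>"
proof -
  assume c: "c \<in> carrier (H i)"
  interpret Hi: group "H i" by (rule factor_group)
  interpret group_hom "H i" W "incl i"
    using incl_hom[of i] Hi.is_group group_W by (simp add: group_hom_def group_hom_axioms_def)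
  show ?thesis using hom_nat_pow[OF c, of "order (H i)"] Hi.pow_order_eq_1[OF c] incl_one by simp
qed

lemma order_pos: "order (H i) > 0"
  using factor_finite factor_group by (metis group.is_monoid monoid.order_gt_0_iff_finite)

text \<open>A non-trivial value of \<theta> is torsion, hence conjugate into a factor. All other
  values commute with it, and centralizers of non-trivial factor elements stay in the
  factor.\<close>

lemma factor_image:
  assumes "\<theta> \<in> hom (H i) W"
  obtains x j \<tau> where "x \<in> carrier W"
    "\<And>c. c \<in> carrier (H i) \<Longrightarrow> \<tau> c \<in> carrier (H j) \<and> \<theta> c = x \<otimes>\<^bsub>W\<^esub> incl j (\<tau> c) \<otimes>\<^bsub>W\<^esub> inv\<^bsub>W\<^esub> x"
proof (cases "\<forall>c\<in>carrier (H i). \<theta> c = \<one>\<^bsub>W\<^esub>")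
  case True
  interpret Hi: group "H i" by (rule factor_group)
  show thesis using that[of "\<one>\<^bsub>W\<^esub>" "\<lambda>_. \<one>\<^bsub>H i\<^esub>" i] True incl_one by simp
next
  case False
  interpret Hi: comm_group "H i" by (rule factor_comm_group)
  interpret t: group_hom "H i" W \<theta>
    using assms Hi.is_group group_W by (simp add: group_hom_def group_hom_axioms_def)
  obtain c0 where c0: "c0 \<in> carrier (H i)" "\<theta> c0 \<noteq> \<one>\<^bsub>W\<^esub>" using False by auto
  have "\<theta> c0 [^]\<^bsub>W\<^esub> order (H i) = \<one>\<^bsub>W\<^esub>"
    using t.hom_nat_pow[OF c0(1), of "order (H i)"] Hi.pow_order_eq_1[OF c0(1)] by simp
  then obtain x j d where x: "x \<in> carrier W" "d \<in> carrier (H j)" "\<theta> c0 = x \<otimes>\<^bsub>W\<^esub> incl j d \<otimes>\<^bsub>W\<^esub> inv\<^bsub>W\<^esub> x"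
    using torsion_conjugate_incl[of "\<theta> c0"] c0(1) order_pos[of i] t.hom_closed by metis
  have d: "d \<noteq> \<one>\<^bsub>H j\<^esub>" using x c0(2) incl_one[of j] by auto
  have "\<exists>e. e \<in> carrier (H j) \<and> \<theta> c = x \<otimes>\<^bsub>W\<^esub> incl j e \<otimes>\<^bsub>W\<^esub> inv\<^bsub>W\<^esub> x" if c: "c \<in> carrier (H i)" for c
  proof -
    define z where "z = inv\<^bsub>W\<^esub> x \<otimes>\<^bsub>W\<^esub> \<theta> c \<otimes>\<^bsub>W\<^esub> x"
    have z: "z \<in> carrier W" using x c by (simp add: z_def)
    have tc: "\<theta> c = x \<otimes>\<^bsub>W\<^esub> z \<otimes>\<^bsub>W\<^esub> inv\<^bsub>W\<^esub> x"
    proof -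
      have "x \<otimes>\<^bsub>W\<^esub> (inv\<^bsub>W\<^esub> x \<otimes>\<^bsub>W\<^esub> \<theta> c) = \<theta> c" using x c by (simp add: W.m_assoc[symmetric])
      then show ?thesis using x(1) c by (simp add: z_def W.m_assoc)
    qed
    have "\<theta> c0 \<otimes>\<^bsub>W\<^esub> \<theta> c = \<theta> c \<otimes>\<^bsub>W\<^esub> \<theta> c0"
      using c c0 by (metis Hi.m_comm t.hom_mult)
    then have "x \<otimes>\<^bsub>W\<^esub> (incl j d \<otimes>\<^bsub>W\<^esub> z) \<otimes>\<^bsub>W\<^esub> inv\<^bsub>W\<^esub> x = x \<otimes>\<^bsub>W\<^esub> (z \<otimes>\<^bsub>W\<^esub> incl j d) \<otimes>\<^bsub>W\<^esub> inv\<^bsub>W\<^esub> x"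
      using x z by (simp add: tc W.conj_mult)
    then have "incl j d \<otimes>\<^bsub>W\<^esub> z = z \<otimes>\<^bsub>W\<^esub> incl j d" using x z by simp
    then show ?thesis using centralizer[OF z x(2) d] tc by metis
  qed
  then show thesis using that[OF x(1)] by metis
qed

text \<open>Strips an i-letter from the front and a j-letter from the end of the normal form; y
  represents the double coset of z modulo the two factors.\<close>

lemma double_coset:
  assumes "z \<in> carrier W"
  obtains c y d where "c \<in> carrier (H i)" "d \<in> carrier (H j)" "y \<in> words" "reduced y"
    "y = [] \<or> fst (hd y) \<noteq> i" "y = [] \<or> fst (last y) \<noteq> j" "z = incl i c \<otimes>\<^bsub>W\<^esub> cls y \<otimes>\<^bsub>W\<^esub> incl j d"
proof -
  interpret Hi: group "H i" by (rule factor_group)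
  interpret Hj: group "H j" by (rule factor_group)
  have "\<exists>c y. c \<in> carrier (H i) \<and> y \<in> words \<and> reduced y \<and> (y = [] \<or> fst (hd y) \<noteq> i) \<and> z = incl i c \<otimes>\<^bsub>W\<^esub> cls y"
  proof (cases "nf z \<noteq> [] \<and> fst (hd (nf z)) = i")
    case True
    then obtain c y where "nf z = (i, c) # y" by (cases "nf z") auto
    then show ?thesis using nf[OF assms] cls_Cons[of i c y] by (intro exI[of _ c] exI[of _ y]) auto
  next
    case False
    then show ?thesis using nf[OF assms] incl_one assms by (intro exI[of _ "\<one>\<^bsub>H i\<^esub>"] exI[of _ "nf z"]) auto
  qed
  then obtain c y where y: "c \<in> carrier (H i)" "y \<in> words" "reduced y" "y = [] \<or> fst (hd y) \<noteq> i"
    "z = incl i c \<otimes>\<^bsub>W\<^esub> cls y" by blast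
  show thesis
  proof (cases "y \<noteq> [] \<and> fst (last y) = j")
    case True
    then obtain y' d where y': "y = y' @ [(j, d)]" using last_letter[of y j] by metis
    then have "y' \<in> words" "d \<in> carrier (H j)" "reduced y'" "y' = [] \<or> fst (hd y') \<noteq> i" "y' = [] \<or> fst (last y') \<noteq> j"
      using y by (auto simp: reduced_append)
    moreover from this have "z = incl i c \<otimes>\<^bsub>W\<^esub> cls y' \<otimes>\<^bsub>W\<^esub> incl j d"
      using y y' by (simp add: gp_incl_def mult_cls)
    ultimately show thesis using that y by blast
  next
    case False
    then show thesis using that[of c "\<one>\<^bsub>H j\<^esub>" y] y incl_one[of j] by auto
  qed
qed

lemma incl_conj_trivial:
  "c \<in> carrier (H i) \<Longrightarrow> d \<in> carrier (H i) \<Longrightarrow> incl i c \<otimes>\<^bsub>W\<^esub> incl i d \<otimes>\<^bsub>W\<^esub> inv\<^bsub>W\<^esub> (incl i c) = incl i d"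
proof -
  assume a: "c \<in> carrier (H i)" "d \<in> carrier (H i)"
  interpret Hi: comm_group "H i" by (rule factor_comm_group)
  have "incl i c \<otimes>\<^bsub>W\<^esub> incl i d = incl i d \<otimes>\<^bsub>W\<^esub> incl i c" using a by (metis incl_mult UNIV_I Hi.m_comm)
  then show ?thesis using a by (simp add: W.m_assoc)
qed

lemma cls_conj_word:
  "y \<in> words \<Longrightarrow> c \<in> carrier (H j) \<Longrightarrow> cls (y @ (j, c) # winv y) = cls y \<otimes>\<^bsub>W\<^esub> incl j c \<otimes>\<^bsub>W\<^esub> inv\<^bsub>W\<^esub> (cls y)"
  by (simp add: gp_incl_def inv_cls mult_cls)

text \<open>Each factor goes into a conjugate of a factor. Only the relative conjugator matters, and
  only up to its double coset, because conjugating an abelian factor by its own elements does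
  nothing.\<close>

lemma endomorphism_normal_form:
  assumes "\<psi> \<in> hom W W"
  obtains x i j \<alpha> \<beta> y where "x \<in> carrier W" "y \<in> words" "reduced y" "y = [] \<or> fst (hd y) \<noteq> i" "y = [] \<or> fst (last y) \<noteq> j"
    "\<forall>c\<in>carrier (H True). \<alpha> c \<in> carrier (H i) \<and> \<psi> (incl True c) = x \<otimes>\<^bsub>W\<^esub> incl i (\<alpha> c) \<otimes>\<^bsub>W\<^esub> inv\<^bsub>W\<^esub> x"
    "\<forall>c\<in>carrier (H False). \<beta> c \<in> carrier (H j) \<and> \<psi> (incl False c) = x \<otimes>\<^bsub>W\<^esub> cls (y @ (j, \<beta> c) # winv y) \<otimes>\<^bsub>W\<^esub> inv\<^bsub>W\<^esub> x"
proof -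
  have comp: "(\<lambda>c. \<psi> (incl k c)) \<in> hom (H k) W" for k
    using Group.hom_compose[OF incl_hom assms, of k] by (simp add: comp_def)
  obtain xA i \<alpha> where A: "xA \<in> carrier W" "\<And>c. c \<in> carrier (H True) \<Longrightarrow>
      \<alpha> c \<in> carrier (H i) \<and> \<psi> (incl True c) = xA \<otimes>\<^bsub>W\<^esub> incl i (\<alpha> c) \<otimes>\<^bsub>W\<^esub> inv\<^bsub>W\<^esub> xA"
    using factor_image[OF comp[of True]] by metis
  obtain xB j \<beta> where B: "xB \<in> carrier W" "\<And>c. c \<in> carrier (H False) \<Longrightarrow>
      \<beta> c \<in> carrier (H j) \<and> \<psi> (incl False c) = xB \<otimes>\<^bsub>W\<^esub> incl j (\<beta> c) \<otimes>\<^bsub>W\<^esub> inv\<^bsub>W\<^esub> xB"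
    using factor_image[OF comp[of False]] by metis
  obtain c y d where y: "c \<in> carrier (H i)" "d \<in> carrier (H j)" "y \<in> words" "reduced y"
    "y = [] \<or> fst (hd y) \<noteq> i" "y = [] \<or> fst (last y) \<noteq> j"
    "inv\<^bsub>W\<^esub> xA \<otimes>\<^bsub>W\<^esub> xB = incl i c \<otimes>\<^bsub>W\<^esub> cls y \<otimes>\<^bsub>W\<^esub> incl j d"
    by (rule double_coset[of "inv\<^bsub>W\<^esub> xA \<otimes>\<^bsub>W\<^esub> xB" i j]) (auto simp: A(1) B(1))
  define x where "x = xA \<otimes>\<^bsub>W\<^esub> incl i c"
  have x: "x \<in> carrier W" using A y by (simp add: x_def)
  have conj2: "(p \<otimes>\<^bsub>W\<^esub> q) \<otimes>\<^bsub>W\<^esub> g \<otimes>\<^bsub>W\<^esub> inv\<^bsub>W\<^esub> (p \<otimes>\<^bsub>W\<^esub> q) = p \<otimes>\<^bsub>W\<^esub> (q \<otimes>\<^bsub>W\<^esub> g \<otimes>\<^bsub>W\<^esub> inv\<^bsub>W\<^esub> q) \<otimes>\<^bsub>W\<^esub> inv\<^bsub>W\<^esub> p"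
    if "p \<in> carrier W" "q \<in> carrier W" "g \<in> carrier W" for p q g
    using that by (simp add: W.m_assoc W.inv_mult_group)
  have "xB = xA \<otimes>\<^bsub>W\<^esub> (inv\<^bsub>W\<^esub> xA \<otimes>\<^bsub>W\<^esub> xB)" using A B by (simp add: W.m_assoc[symmetric])
  then have xB: "xB = x \<otimes>\<^bsub>W\<^esub> (cls y \<otimes>\<^bsub>W\<^esub> incl j d)" using y A by (simp add: x_def W.m_assoc)
  show thesis
  proof (rule that[OF x y(3-6)]; intro ballI)
    fix e assume "e \<in> carrier (H True)"
    then show "\<alpha> e \<in> carrier (H i) \<and> \<psi> (incl True e) = x \<otimes>\<^bsub>W\<^esub> incl i (\<alpha> e) \<otimes>\<^bsub>W\<^esub> inv\<^bsub>W\<^esub> x"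
      using A y(1) by (simp add: x_def conj2 incl_conj_trivial)
  next
    fix e assume "e \<in> carrier (H False)"
    then show "\<beta> e \<in> carrier (H j) \<and> \<psi> (incl False e) = x \<otimes>\<^bsub>W\<^esub> cls (y @ (j, \<beta> e) # winv y) \<otimes>\<^bsub>W\<^esub> inv\<^bsub>W\<^esub> x"
      using B(2)[of e] x y(2,3) by (simp add: xB conj2 incl_conj_trivial cls_conj_word)
  qed
qed


text \<open>Class preservation forces \<open>i\<close>, \<open>j\<close>, \<alpha> and \<beta> to be
  the obvious ones. Up to an inner automorphism, \<psi> thus fixes A and conjugates B by y, and
  surjectivity leaves only y = [].\<close>

lemma class_preserving_inner:
  assumes "\<psi> \<in> hom W W" and surj: "\<psi> ` carrier W = carrier W"
    and cp: "\<And>i c. c \<in> carrier (H i) \<Longrightarrow> conjugate W (incl i c) (\<psi> (incl i c))"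
    and nontrivial: "\<And>i. carrier (H i) \<noteq> {\<one>\<^bsub>H i\<^esub>}"
  obtains x where "x \<in> carrier W" "\<And>g. g \<in> carrier W \<Longrightarrow> \<psi> g = x \<otimes>\<^bsub>W\<^esub> g \<otimes>\<^bsub>W\<^esub> inv\<^bsub>W\<^esub> x"
proof -
  interpret psi: group_hom W W \<psi>
    using assms(1) group_W by (simp add: group_hom_def group_hom_axioms_def)
  have one: "\<one>\<^bsub>H i\<^esub> \<in> carrier (H i)" for i using factor_group by (metis group.is_monoid monoid.one_closed)
  obtain x i j \<alpha> \<beta> y where x: "x \<in> carrier W" and y: "y \<in> words" "reduced y" "y = [] \<or> fst (hd y) \<noteq> i" "y = [] \<or> fst (last y) \<noteq> j"
    and A: "\<forall>c\<in>carrier (H True). \<alpha> c \<in> carrier (H i) \<and> \<psi> (incl True c) = x \<otimes>\<^bsub>W\<^esub> incl i (\<alpha> c) \<otimes>\<^bsub>W\<^esub> inv\<^bsub>W\<^esub> x"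
    and B: "\<forall>c\<in>carrier (H False). \<beta> c \<in> carrier (H j) \<and> \<psi> (incl False c) = x \<otimes>\<^bsub>W\<^esub> cls (y @ (j, \<beta> c) # winv y) \<otimes>\<^bsub>W\<^esub> inv\<^bsub>W\<^esub> x"
    by (rule endomorphism_normal_form[OF assms(1)])
  have "i = True \<and> \<alpha> c = c" if "c \<in> carrier (H True)" "c \<noteq> \<one>\<^bsub>H True\<^esub>" for c
  proof -
    have "conjugate W (\<psi> (incl True c)) (incl i (\<alpha> c))"
      using A[THEN bspec, OF that(1)] W.conjugate_sym[OF W.conjugateI[OF x, of "incl i (\<alpha> c)"]] by simp
    then have "conjugate W (incl True c) (incl i (\<alpha> c))"
      using W.conjugate_trans[OF cp[OF that(1)]] that(1) by simp
    from conjugate_incl[OF this that(1) _ that(2)] A[THEN bspec, OF that(1)] show ?thesis by simp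
  qed
  note * = this
  obtain a where a: "a \<in> carrier (H True)" "a \<noteq> \<one>\<^bsub>H True\<^esub>" using nontrivial[of True] one[of True] by blast
  have i: "i = True" and \<alpha>: "\<And>c. c \<in> carrier (H True) \<Longrightarrow> c \<noteq> \<one>\<^bsub>H True\<^esub> \<Longrightarrow> \<alpha> c = c"
    using *[OF a] * by simp_all
  have "j = False \<and> \<beta> c = c" if "c \<in> carrier (H False)" "c \<noteq> \<one>\<^bsub>H False\<^esub>" for c
  proof -
    have b: "\<beta> c \<in> carrier (H j)" using B that by simp
    then have "conjugate W (incl j (\<beta> c)) (cls (y @ (j, \<beta> c) # winv y))"
      using y(1) cls_conj_word W.conjugateI by simp
    moreover have "conjugate W (cls (y @ (j, \<beta> c) # winv y)) (\<psi> (incl False c))"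
      using B[THEN bspec, OF that(1)] W.conjugateI[OF x] by simp
    ultimately have "conjugate W (incl j (\<beta> c)) (\<psi> (incl False c))"
      by (rule W.conjugate_trans) (simp add: b)
    then have "conjugate W (\<psi> (incl False c)) (incl j (\<beta> c))"
      by (rule W.conjugate_sym) (simp add: b)
    then have "conjugate W (incl False c) (incl j (\<beta> c))"
      using W.conjugate_trans[OF cp[OF that(1)]] that(1) by simp
    from conjugate_incl[OF this that(1) b that(2)] show ?thesis by simp
  qed
  note * = this
  obtain b where b: "b \<in> carrier (H False)" "b \<noteq> \<one>\<^bsub>H False\<^esub>" using nontrivial[of False] one[of False] by blast
  have j: "j = False" and \<beta>: "\<And>c. c \<in> carrier (H False) \<Longrightarrow> c \<noteq> \<one>\<^bsub>H False\<^esub> \<Longrightarrow> \<beta> c = c"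
    using *[OF b] * by simp_all
  have A': "\<psi> (incl True c) = x \<otimes>\<^bsub>W\<^esub> incl True c \<otimes>\<^bsub>W\<^esub> inv\<^bsub>W\<^esub> x" if "c \<in> carrier (H True)" for c
  proof (cases "c = \<one>\<^bsub>H True\<^esub>")
    case True
    then show ?thesis using x incl_one[of True] by simp
  next
    case False
    then show ?thesis using A[THEN bspec, OF that] \<alpha>[OF that] i by simp
  qed
  have B': "\<psi> (incl False c) = x \<otimes>\<^bsub>W\<^esub> cls (y @ (False, c) # winv y) \<otimes>\<^bsub>W\<^esub> inv\<^bsub>W\<^esub> x" if "c \<in> carrier (H False)" for c
  proof (cases "c = \<one>\<^bsub>H False\<^esub>")
    case True
    then show ?thesis using x y(1) one[of False] incl_one[of False] by (simp add: cls_conj_word)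
  next
    case False
    then show ?thesis using B[THEN bspec, OF that] \<beta>[OF that] j by simp
  qed
  have "y = []"
  proof (rule ccontr)
    assume y0: "y \<noteq> []"
    then have yt: "fst (hd y) = False" "fst (last y) = True" using y(3,4) i j by auto
    \<comment> \<open>Letterwise image of a word. As y begins in B and ends in A, substitution
      causes no cancellation: reduced words stay reduced and keep their first vertex.\<close>
    define sub where "sub w = concat (map (\<lambda>l. if fst l then [l] else y @ l # winv y) w)" for w
    have sub_Cons: "sub (l # w) = (if fst l then [l] else y @ l # winv y) @ sub w" for l w by (simp add: sub_def)
    have sub: "sub w \<in> words \<and> reduced (sub w) \<and> (w \<noteq> [] \<longrightarrow> sub w \<noteq> [] \<and> fst (hd (sub w)) = fst (hd w))
        \<and> \<psi> (cls w) = x \<otimes>\<^bsub>W\<^esub> cls (sub w) \<otimes>\<^bsub>W\<^esub> inv\<^bsub>W\<^esub> x" if "w \<in> words" "reduced w" for w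
      using that
    proof (induction w)
      case Nil
      then show ?case using x by (simp add: sub_def flip: one_eq)
    next
      case (Cons l w)
      then have IH: "sub w \<in> words" "reduced (sub w)" "w \<noteq> [] \<Longrightarrow> sub w \<noteq> [] \<and> fst (hd (sub w)) = fst (hd w)"
        "\<psi> (cls w) = x \<otimes>\<^bsub>W\<^esub> cls (sub w) \<otimes>\<^bsub>W\<^esub> inv\<^bsub>W\<^esub> x" by auto
      have s0: "sub [] = []" by (simp add: sub_def)
      let ?b = "if fst l then [l] else y @ l # winv y"
      have bw: "?b \<in> words" using Cons.prems y(1) by auto
      have "reduced (y @ [l] @ winv y)" if "\<not> fst l"
        using that Cons.prems y(1,2) y0 yt reduced_winv[OF y(1,2)] fst_hd_winv[OF y0] by (auto simp: reduced_append)
      then have br: "reduced ?b" "?b \<noteq> []" "fst (hd ?b) = fst l" "fst (last ?b) = fst l"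
        using Cons.prems y0 yt fst_last_winv[OF y0] by auto
      have "reduced (?b @ sub w)" unfolding reduced_append using br(1,4) IH(2,3) Cons.prems s0 by (cases "w = []") auto
      moreover have "cls (sub (l # w)) = cls ?b \<otimes>\<^bsub>W\<^esub> cls (sub w)" unfolding sub_Cons using bw IH(1) by (simp only: mult_cls)
      moreover have "\<psi> (incl (fst l) (snd l)) = x \<otimes>\<^bsub>W\<^esub> cls ?b \<otimes>\<^bsub>W\<^esub> inv\<^bsub>W\<^esub> x"
      proof (cases "fst l")
        case True
        then have "cls ?b = incl True (snd l)" by (cases l) (simp add: gp_incl_def)
        then show ?thesis using A'[of "snd l"] True Cons.prems by simp
      next
        case False
        then have "?b = y @ (False, snd l) # winv y" by (cases l) simp
        then show ?thesis using B'[of "snd l"] False Cons.prems by simp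
      qed
      then have "\<psi> (cls (l # w)) = x \<otimes>\<^bsub>W\<^esub> (cls ?b \<otimes>\<^bsub>W\<^esub> cls (sub w)) \<otimes>\<^bsub>W\<^esub> inv\<^bsub>W\<^esub> x"
        using IH(1,4) Cons.prems x bw cls_Cons[of "fst l" "snd l" w] W.conj_mult[OF x, of "cls ?b" "cls (sub w)"] by simp
      ultimately show ?case using bw IH(1) br(2,3) unfolding sub_Cons by (simp add: hd_append)
    qed
    have "x \<otimes>\<^bsub>W\<^esub> incl False b \<otimes>\<^bsub>W\<^esub> inv\<^bsub>W\<^esub> x \<in> \<psi> ` carrier W" using surj x b by simp
    then obtain g where g: "g \<in> carrier W" "\<psi> g = x \<otimes>\<^bsub>W\<^esub> incl False b \<otimes>\<^bsub>W\<^esub> inv\<^bsub>W\<^esub> x"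
      by (auto simp: image_iff)
    have s: "sub (nf g) \<in> words" "reduced (sub (nf g))" "nf g \<noteq> [] \<Longrightarrow> fst (hd (sub (nf g))) = fst (hd (nf g))"
      "\<psi> g = x \<otimes>\<^bsub>W\<^esub> cls (sub (nf g)) \<otimes>\<^bsub>W\<^esub> inv\<^bsub>W\<^esub> x"
      using sub[OF nf(1,2)[OF g(1)]] nf(3)[OF g(1)] by auto
    have "cls (sub (nf g)) = incl False b" using g(2) s(1,4) x b by simp
    then have eq: "sub (nf g) = [(False, b)]"
      using reduced_unique[of "sub (nf g)" "[(False, b)]"] s b by (simp add: gp_incl_def)
    \<comment> \<open>A preimage of the single letter b would contain no B-letter, since that alone
      would bring in y, the letter and the inverse of y. But a word of A-letters has an image that
      starts in A.\<close>
    have "\<not> (\<exists>l\<in>set (nf g). \<not> fst l)"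
    proof
      assume "\<exists>l\<in>set (nf g). \<not> fst l"
      then obtain l where "l \<in> set (nf g)" and l0: "\<not> fst l" by blast
      then obtain u v where l: "nf g = u @ l # v" by (metis split_list)
      then have "length (sub (nf g)) \<ge> length (y @ l # winv y)" using l0 by (simp add: sub_def)
      then show False using eq y0 by (cases y) auto
    qed
    moreover have "nf g \<noteq> []" using eq by (auto simp: sub_def)
    ultimately have "fst (hd (nf g))" by simp
    then show False using s(3) eq \<open>nf g \<noteq> []\<close> by simp
  qed
  have "(\<lambda>g. x \<otimes>\<^bsub>W\<^esub> g \<otimes>\<^bsub>W\<^esub> inv\<^bsub>W\<^esub> x) \<in> hom W W"
    using x by (intro homI) (simp_all only: W.conj_mult W.m_closed W.inv_closed)
  then have "\<psi> g = x \<otimes>\<^bsub>W\<^esub> g \<otimes>\<^bsub>W\<^esub> inv\<^bsub>W\<^esub> x" if "g \<in> carrier W" for g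
  proof (rule hom_eqI[OF assms(1) _ group_W _ that])
    fix v a assume "a \<in> carrier (H v)"
    then show "\<psi> (incl v a) = x \<otimes>\<^bsub>W\<^esub> incl v a \<otimes>\<^bsub>W\<^esub> inv\<^bsub>W\<^esub> x"
      using A' B' \<open>y = []\<close> by (cases v) (auto simp: gp_incl_def)
  qed
  then show thesis using that x by blast
qed

section \<open>Counting quasimorphisms on the free product\<close>

definition letters :: "(bool \<times> 'h) list \<Rightarrow> 'h list" where
  "letters w = map snd (filter fst w)"

lemma letters_Nil [simp]: "letters [] = []"
  and letters_Cons [simp]: "letters (l # w) = (if fst l then snd l # letters w else letters w)"
  and letters_append [simp]: "letters (w @ w') = letters w @ letters w'"
  and length_letters: "length (letters w) \<le> length w"
  by (auto simp: letters_def)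

lemma letters_concat: "letters (concat ws) = concat (map letters ws)"
  by (induction ws) auto

lemma letters_winv: "letters (winv w) = rev (map (\<lambda>a. inv\<^bsub>H True\<^esub> a) (letters w))"
  by (induction w) (auto simp: winv_Cons)

lemma winv_concat_replicate: "winv (concat (replicate n w)) = concat (replicate n (winv w))"
proof (induction n)
  case (Suc n)
  have "replicate n (winv w) @ [winv w] = replicate (Suc n) (winv w)" by (simp add: replicate_append_same)
  then have "concat (replicate n (winv w)) @ winv w = concat (replicate (Suc n) (winv w))"
    by (metis concat.simps concat_append append_Nil2)
  then show ?case using Suc by simp
qed simp

text \<open>Brooks counting applied to the A-letters only. Subtracting the count for the inverse
  makes the value odd under inversion, so cancelled parts of a product drop out.\<close>

definition code_count :: "'h list \<Rightarrow> (bool \<times> 'h) list \<Rightarrow> real" where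
  "code_count p w = real (count_factor p (letters w)) - real (count_factor p (letters (winv w)))"

lemma code_count_append:
  "\<bar>code_count p (x @ y) - code_count p x - code_count p y\<bar> \<le> real (length p)"
  using count_factor_append_ge[of p "letters x" "letters y"] count_factor_append_le[of p "letters x" "letters y"]
    count_factor_append_ge[of p "letters (winv y)" "letters (winv x)"]
    count_factor_append_le[of p "letters (winv y)" "letters (winv x)"]
  by (auto simp: code_count_def)

lemma code_count_winv: "w \<in> words \<Longrightarrow> code_count p (winv w) = - code_count p w"
  by (simp add: code_count_def winv_winv)

lemma code_count_short: "\<bar>code_count p w\<bar> \<le> real (length w)"
  using count_factor_le[of p "letters w"] count_factor_le[of p "letters (winv w)"]
    length_letters[of w] length_letters[of "winv w"]
  by (auto simp: code_count_def)

definition code_qm :: "'h list \<Rightarrow> (bool \<times> 'h) list set \<Rightarrow> real" where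
  "code_qm p g = code_count p (nf g)"

text \<open>The cancelled \<open>c\<close> and its inverse contribute opposite values. What is left
  are the errors of six concatenations and three words of at most one letter.\<close>

lemma code_qm: "quasimorphism W (code_qm p)"
  unfolding quasimorphism_def
proof (intro exI ballI)
  fix g h assume gh: "g \<in> carrier W" "h \<in> carrier W"
  obtain x1 s1 c s2 y1 s where d: "nf g = x1 @ s1 @ c" "nf h = winv c @ s2 @ y1" "c \<in> words"
    "length s1 \<le> 1" "length s2 \<le> 1" "length s \<le> 1" "reduced (x1 @ s @ y1)" "x1 @ s @ y1 \<in> words"
    "cls (nf g @ nf h) = cls (x1 @ s @ y1)"
    by (rule product_cancel[OF nf(1,2)[OF gh(1)] nf(1,2)[OF gh(2)]])
  have "g \<otimes>\<^bsub>W\<^esub> h = cls (x1 @ s @ y1)"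
    using d(9) nf[OF gh(1)] nf[OF gh(2)] mult_cls[of "nf g" "nf h"] by simp
  then have "nf (g \<otimes>\<^bsub>W\<^esub> h) = x1 @ s @ y1" using d(7,8) nf_cls by simp
  moreover have short: "\<bar>code_count p v\<bar> \<le> 1" if "length v \<le> 1" for v
    using code_count_short[of p v] that by linarith
  ultimately show "\<bar>code_qm p g + code_qm p h - code_qm p (g \<otimes>\<^bsub>W\<^esub> h)\<bar> \<le> 6 * real (length p) + 3"
    using code_count_append[of p x1 "s1 @ c"] code_count_append[of p s1 c]
      code_count_append[of p "winv c" "s2 @ y1"] code_count_append[of p s2 y1]
      code_count_append[of p x1 "s @ y1"] code_count_append[of p s y1]
      short[OF d(4)] short[OF d(5)] short[OF d(6)] code_count_winv[OF d(3), of p]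
    unfolding code_qm_def d(1,2) abs_le_iff by auto
qed

definition hom_qm :: "'h list \<Rightarrow> (bool \<times> 'h) list set \<Rightarrow> real" where
  "hom_qm p = (SOME F. quasimorphism W F \<and> homogeneous_qm W F \<and>
     (\<forall>g\<in>carrier W. (\<lambda>n. code_qm p (g [^]\<^bsub>W\<^esub> n) / real n) \<longlonglongrightarrow> F g))"

lemma hom_qm: "quasimorphism W (hom_qm p)" "homogeneous_qm W (hom_qm p)"
    "\<And>g. g \<in> carrier W \<Longrightarrow> (\<lambda>n. code_qm p (g [^]\<^bsub>W\<^esub> n) / real n) \<longlonglongrightarrow> hom_qm p g"
proof -
  have "\<exists>F. quasimorphism W F \<and> homogeneous_qm W F \<and>
     (\<forall>g\<in>carrier W. (\<lambda>n. code_qm p (g [^]\<^bsub>W\<^esub> n) / real n) \<longlonglongrightarrow> F g)"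
    by (rule W.homogenization[OF code_qm[of p]]) blast
  from someI_ex[OF this] show "quasimorphism W (hom_qm p)" "homogeneous_qm W (hom_qm p)"
    "\<And>g. g \<in> carrier W \<Longrightarrow> (\<lambda>n. code_qm p (g [^]\<^bsub>W\<^esub> n) / real n) \<longlonglongrightarrow> hom_qm p g"
    unfolding hom_qm_def by auto
qed

lemma reduced_power:
  assumes "reduced (w @ w)" shows "reduced (concat (replicate n w))"
proof (induction n)
  case (Suc n)
  have "hd (concat (replicate n w)) = hd w" if "n > 0" using that by (cases n; cases w) auto
  then show ?case using Suc assms by (cases "n = 0") (auto simp: reduced_append)
qed simp

text \<open>The hypothesis \<open>reduced (w @ w)\<close> says that w is cyclically reduced; its
  powers are then reduced as plain repetitions, so their normal forms are known.\<close>

lemma hom_qm_cls: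
  assumes "w \<in> words" "reduced (w @ w)"
  shows "(\<lambda>n. code_count p (concat (replicate n w)) / real n) \<longlonglongrightarrow> hom_qm p (cls w)"
proof -
  have "code_qm p (cls w [^]\<^bsub>W\<^esub> n) = code_count p (concat (replicate n w))" for n :: nat
    using assms reduced_power[OF assms(2), of n] words_concat[of "replicate n w"]
    by (simp add: pow_cls code_qm_def nf_cls)
  then show ?thesis using hom_qm(3)[of "cls w" p] assms by simp
qed

lemma hom_qm_ge:
  assumes "w \<in> words" "reduced (w @ w)"
    and "\<And>n. count_factor p (letters (winv (concat (replicate n w)))) = 0"
    and "\<And>n. count_factor p (letters (concat (replicate n w))) \<ge> n * k"
  shows "hom_qm p (cls w) \<ge> real k"
proof (rule tendsto_lowerbound[OF hom_qm_cls[OF assms(1,2)]])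
  show "\<forall>\<^sub>F n in sequentially. real k \<le> code_count p (concat (replicate n w)) / real n"
    using eventually_gt_at_top[of 0]
  proof eventually_elim
    case (elim n)
    have "real (n * k) \<le> real (count_factor p (letters (concat (replicate n w))))" using assms(4) of_nat_le_iff by blast
    then show ?case using elim assms(3) by (simp add: code_count_def field_simps)
  qed
qed simp

lemma hom_qm_zero:
  assumes "w \<in> words" "reduced (w @ w)"
    and "\<And>n. count_factor p (letters (winv (concat (replicate n w)))) = 0"
    and "\<And>n. count_factor p (letters (concat (replicate n w))) = 0"
  shows "hom_qm p (cls w) = 0"
  using hom_qm_cls[OF assms(1,2), of p] assms(3,4) by (simp add: code_count_def LIMSEQ_const_iff)

text \<open>A code word has neighbouring runs of a and of b, each of length at least 2 L, while
  every short block contains the letters of C.\<close>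

lemma no_code_word:
  assumes "C \<noteq> []" "\<And>b. b \<in> set bs \<Longrightarrow> length b \<le> L \<and> set C \<subseteq> set b" "K \<ge> 2 * L" "a \<noteq> b" "L > 0"
  shows "count_factor (code_word a b K) (concat bs) = 0"
proof (rule ccontr)
  assume "count_factor (code_word a b K) (concat bs) \<noteq> 0"
  then obtain x y where "concat bs = x @ code_word a b K @ y" by (rule count_factor_factor)
  \<comment> \<open>\<open>no_two_runs\<close> speaks of runs of equal length, so the b-run is cut
    in half.\<close>
  moreover have "replicate (2 * K) b = replicate K b @ replicate K b" by (simp add: mult_2 replicate_add)
  ultimately obtain z where "concat bs = x @ replicate K a @ replicate K b @ z" by (auto simp: code_word_def)
  from no_two_runs[OF this assms(1,2,3,5)] show False using assms(4) by simp
qed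

text \<open>A shortest conjugate is either a single letter or empty, hence torsion, or cyclically
  reduced. In the second case its powers repeat a fixed block that contains an A-letter, so long
  runs of two different letters cannot both occur.\<close>

lemma hom_qm_eventually_zero:
  assumes "g \<in> carrier W" "a \<noteq> b"
  obtains M where "\<And>K. K \<ge> M \<Longrightarrow> hom_qm (code_word a b K) g = 0"
proof -
  obtain w where w: "w \<in> words" "conjugate W g (cls w)"
    and least: "\<And>w'. w' \<in> words \<Longrightarrow> conjugate W g (cls w') \<Longrightarrow> length w \<le> length w'"
    using minimal_conjugate[OF assms(1)] by metis
  have eq: "hom_qm p g = hom_qm p (cls w)" for p
    using w(2) assms(1) W.homogeneous_conj[OF hom_qm(1,2)] by (auto simp: conjugate_def)
  show thesis
  proof (cases "length w \<le> 1")
    case True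
    then have "\<exists>n>0. cls w [^]\<^bsub>W\<^esub> (n::nat) = \<one>\<^bsub>W\<^esub>"
    proof (cases w)
      case Nil
      then show ?thesis by (intro exI[of _ 1]) (simp flip: one_eq)
    next
      case (Cons l w')
      then have "cls w = incl (fst l) (snd l)" "snd l \<in> carrier (H (fst l))" using True w(1) by (auto simp: gp_incl_def)
      then show ?thesis using incl_pow_order order_pos by metis
    qed
    then have "hom_qm p (cls w) = 0" for p using W.homogeneous_torsion[OF hom_qm(2)] w(1) by (meson cls_closed)
    then show thesis using that eq by simp
  next
    case False
    have "reduced w"
    proof (rule ccontr)
      assume "\<not> reduced w"
      then obtain w' where "w' \<in> words" "length w' < length w" "cls w' = cls w" using shorten w(1) by metis
      then show False using least[of w'] w(2) by simp
    qed
    obtain l v where "w = l # v" "v \<noteq> []" using False by (cases w) auto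
    moreover obtain u k where "v = u @ [k]" using \<open>v \<noteq> []\<close> by (cases v rule: rev_cases) auto
    ultimately have luk: "w = l # u @ [k]" by simp
    \<comment> \<open>Otherwise rotating the first letter to the end and merging it there gives a
      shorter conjugate.\<close>
    have "fst l \<noteq> fst k"
    proof
      assume "fst l = fst k"
      then have e: "u @ [k, l] = u @ (fst k, snd k) # [] @ (fst k, snd l) # []" by (cases k; cases l) auto
      have uw: "u @ [k, l] \<in> words" using w luk by auto
      obtain w' where w': "w' \<in> words" "length w' < length (u @ [k, l])" "cls w' = cls (u @ [k, l])"
        by (rule shorten_pair[OF uw e]) auto
      have "conjugate W (cls w) (cls (u @ [k, l]))" using conjugate_rotate[of "[l]" "u @ [k]"] w luk by simp
      then have "conjugate W g (cls w')" using W.conjugate_trans[OF w(2) _ assms(1)] w'(3) by simp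
      then show False using least[OF w'(1)] w'(2) luk by simp
    qed
    then have red: "reduced (w @ w)" using \<open>reduced w\<close> luk unfolding reduced_append[of w w] by auto
    have ne: "letters w \<noteq> []" "letters (winv w) \<noteq> []"
      using \<open>fst l \<noteq> fst k\<close> luk by (auto simp: letters_winv)
    show thesis
    proof (rule that)
      fix K assume K: "K \<ge> 2 * length w"
      have c: "count_factor (code_word a b K) (concat (replicate n (letters v))) = 0"
        if "letters v \<noteq> []" "length v = length w" for n v
        using length_letters[of v] that luk K assms(2)
        by (intro no_code_word[of "letters v" _ "length w"]) auto
      have "hom_qm (code_word a b K) (cls w) = 0"
        using c[OF ne(1)] c[OF ne(2)] by (intro hom_qm_zero[OF w(1) red]) (auto simp: letters_concat winv_concat_replicate)
      then show "hom_qm (code_word a b K) g = 0" using eq by simp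
    qed
  qed
qed

section \<open>Code words under endomorphisms\<close>

lemma map_code_word: "map f (code_word a b K) = code_word (f a) (f b) K"
  by (simp add: code_word_def)

text \<open>An occurrence in an inverse power, read backwards with inverted letters, would be a
  reversed code word inside a power of a code word, which \<open>code_word_chiral\<close> excludes
  whatever the letters are. So nothing is subtracted; with matching letters each period adds an
  occurrence.\<close>

lemma hom_qm_code_nonneg:
  assumes "w \<in> words" "reduced (w @ w)" "letters w = code_word a' b' K" "a' \<noteq> b'" "K > 0"
    and "a \<in> carrier (H True)" "b \<in> carrier (H True)" "a \<noteq> b"
  shows "hom_qm (code_word a b K) (cls w) \<ge> 0" "a = a' \<Longrightarrow> b = b' \<Longrightarrow> hom_qm (code_word a b K) (cls w) \<ge> 1"
proof -
  interpret A: group "H True" by (rule factor_group)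
  have z: "count_factor (code_word a b K) (letters (winv (concat (replicate n w)))) = 0" for n
  proof (rule ccontr)
    assume "count_factor (code_word a b K) (letters (winv (concat (replicate n w)))) \<noteq> 0"
    then obtain x y where "letters (winv (concat (replicate n w))) = x @ code_word a b K @ y" by (rule count_factor_factor)
    then have "letters (winv (winv (concat (replicate n w)))) = rev (map (\<lambda>a. inv\<^bsub>H True\<^esub> a) (x @ code_word a b K @ y))"
      by (simp add: letters_winv[of "winv (concat (replicate n w))"])
    then have "concat (replicate n (code_word a' b' K)) = rev (map (\<lambda>a. inv\<^bsub>H True\<^esub> a) y) @
        rev (code_word (inv\<^bsub>H True\<^esub> a) (inv\<^bsub>H True\<^esub> b) K) @ rev (map (\<lambda>a. inv\<^bsub>H True\<^esub> a) x)"
      using assms(1,3) words_concat[of "replicate n w"] by (simp add: winv_winv letters_concat map_code_word)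
    moreover have "inv\<^bsub>H True\<^esub> b \<noteq> inv\<^bsub>H True\<^esub> a" using assms(6-8) by (metis A.inv_inv)
    ultimately show False using code_word_chiral assms(4,5) by metis
  qed
  show "hom_qm (code_word a b K) (cls w) \<ge> 0" using hom_qm_ge[OF assms(1,2) z, of 0] by simp
  show "hom_qm (code_word a b K) (cls w) \<ge> 1" if "a = a'" "b = b'"
  proof -
    have "code_word a b K \<noteq> []" using assms(5) by (metis length_code_word list.size(3) mult_is_0 neq0_conv zero_neq_numeral)
    then have "count_factor (code_word a b K) (letters (concat (replicate n w))) \<ge> n * 1" for n
      using count_factor_replicate[of "code_word a b K" n] assms(3) that by (simp add: letters_concat)
    from hom_qm_ge[OF assms(1,2) z this] show ?thesis by simp
  qed
qed

text \<open>A fixed B-letter separates consecutive A-letters, so that any sequence s of non-trivial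
  A-letters, even with long runs, comes from a cyclically reduced word if b is non-trivial.\<close>

definition pair_word :: "'h \<Rightarrow> 'h list \<Rightarrow> (bool \<times> 'h) list" where
  "pair_word b s = concat (map (\<lambda>c. [(True, c), (False, b)]) s)"

lemma pair_word_words: "b \<in> carrier (H False) \<Longrightarrow> set s \<subseteq> carrier (H True) \<Longrightarrow> pair_word b s \<in> words"
  by (induction s) (auto simp: pair_word_def)

lemma set_code_word: "set (code_word a b K) \<subseteq> {a, b}"
  by (auto simp: code_word_def split: if_splits)

lemma blocks_reduced:
  assumes D: "D \<in> words" "reduced D" "D \<noteq> []" "fst (hd D) \<noteq> i" "fst (last D) \<noteq> i"
    and s: "\<And>c. c \<in> set s \<Longrightarrow> c \<in> carrier (H i) \<and> c \<noteq> \<one>\<^bsub>H i\<^esub>"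
  defines "w \<equiv> concat (map (\<lambda>c. (i, c) # D) s)"
  shows "w \<in> words" "reduced (w @ w)"
proof -
  have "w \<in> words \<and> reduced w \<and> (s \<noteq> [] \<longrightarrow> w \<noteq> [] \<and> fst (hd w) = i \<and> fst (last w) \<noteq> i)"
    unfolding w_def using s
  proof (induction s)
    case (Cons c s)
    let ?w = "concat (map (\<lambda>c. (i, c) # D) s)"
    have IH: "?w \<in> words" "reduced ?w" "s \<noteq> [] \<Longrightarrow> ?w \<noteq> [] \<and> fst (hd ?w) = i \<and> fst (last ?w) \<noteq> i"
      using Cons by auto
    have "reduced ((i, c) # D)" using D Cons.prems by auto
    then have "reduced (((i, c) # D) @ ?w)" unfolding reduced_append using IH D by (cases "s = []") auto
    then show ?case using IH D Cons.prems by (cases "s = []") auto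
  qed simp
  then show "w \<in> words" "reduced (w @ w)"
    unfolding reduced_append by (cases "s = []", auto simp: w_def)
qed

lemma cls_single_vertex:
  "w \<in> words \<Longrightarrow> (\<And>l. l \<in> set w \<Longrightarrow> fst l = i) \<Longrightarrow> \<exists>d. d \<in> carrier (H i) \<and> cls w = incl i d"
proof (induction w)
  case Nil
  interpret Hi: group "H i" by (rule factor_group)
  show ?case using incl_one[of i] one_eq by (intro exI[of _ "\<one>\<^bsub>H i\<^esub>"]) simp
next
  case (Cons l w)
  interpret Hi: group "H i" by (rule factor_group)
  obtain d where d: "d \<in> carrier (H i)" "cls w = incl i d" using Cons by auto
  have "fst l = i" using Cons.prems by simp
  then have "cls (l # w) = incl i (snd l) \<otimes>\<^bsub>W\<^esub> incl i d" "snd l \<in> carrier (H i)"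
    using cls_Cons[of "fst l" "snd l" w] Cons.prems(1) d unfolding prod.collapse by auto
  then show ?case using d incl_mult[of i "snd l" d] by (intro exI[of _ "snd l \<otimes>\<^bsub>H i\<^esub> d"]) simp
qed

text \<open>The exponents are multiples of the orders of the factors, so that the runs of an endomorphic
  image disappear when a letter is killed.\<close>

lemma hom_qm_endomorphism_nonneg:
  assumes psi: "\<psi> \<in> hom W W" and a: "a \<in> carrier (H True)" "b \<in> carrier (H True)" "a \<noteq> b"
    and c: "c \<in> carrier (H False)"
  obtains M where "\<And>N. N \<ge> M \<Longrightarrow> N > 0 \<Longrightarrow> hom_qm (code_word a b (N * (order (H True) * order (H False))))
      (\<psi> (cls (pair_word c (code_word a b (N * (order (H True) * order (H False))))))) \<ge> 0"
proof -
  define e where "e = order (H True) * order (H False)"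
  have e: "e > 0" using order_pos by (simp add: e_def)
  interpret psi: group_hom W W \<psi>
    using psi group_W by (simp add: group_hom_def group_hom_axioms_def)
  define PW where "PW s = \<psi> (cls (pair_word c s))" for s
  \<comment> \<open>The image of one A-letter with its separator. The image of a code word is a
    product of four powers of \<open>Y a\<close> and \<open>Y b\<close>.\<close>
  define Y where "Y d = \<psi> (incl True d) \<otimes>\<^bsub>W\<^esub> \<psi> (incl False c)" for d
  have Y: "Y d \<in> carrier W" if "d \<in> carrier (H True)" for d using that c by (simp add: Y_def)
  have PW_append: "PW (s @ t) = PW s \<otimes>\<^bsub>W\<^esub> PW t" if "set s \<subseteq> carrier (H True)" "set t \<subseteq> carrier (H True)" for s t
  proof -
    have "pair_word c (s @ t) = pair_word c s @ pair_word c t" by (simp add: pair_word_def)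
    then show ?thesis using pair_word_words[OF c that(1)] pair_word_words[OF c that(2)]
      by (simp add: PW_def mult_cls[symmetric])
  qed
  have PW_one: "PW [d] = Y d" if "d \<in> carrier (H True)" for d
    using that c psi.hom_mult[of "incl True d" "incl False c"] cls_Cons[of True d "[(False, c)]"]
    by (simp add: PW_def Y_def pair_word_def) (simp add: gp_incl_def)
  have PW_replicate: "PW (replicate n d) = Y d [^]\<^bsub>W\<^esub> n" if d: "d \<in> carrier (H True)" for n d
  proof (induction n)
    case 0
    then show ?case by (simp add: PW_def pair_word_def flip: one_eq)
  next
    case (Suc n)
    have "PW (replicate n d @ [d]) = Y d [^]\<^bsub>W\<^esub> n \<otimes>\<^bsub>W\<^esub> Y d"
      using PW_append[of "replicate n d" "[d]"] Suc PW_one[OF d] d by (simp add: set_replicate_conv_if)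
    then show ?case by (simp add: replicate_append_same)
  qed
  have PW_code: "PW (code_word a b K) = Y a [^]\<^bsub>W\<^esub> K \<otimes>\<^bsub>W\<^esub> (Y b [^]\<^bsub>W\<^esub> (2 * K) \<otimes>\<^bsub>W\<^esub>
      (Y a [^]\<^bsub>W\<^esub> (3 * K) \<otimes>\<^bsub>W\<^esub> Y b [^]\<^bsub>W\<^esub> (4 * K)))" for K
    using a by (simp add: code_word_def PW_append PW_replicate set_replicate_conv_if)
  have tors: "\<psi> (incl i d) [^]\<^bsub>W\<^esub> (m * (N * e)) = \<one>\<^bsub>W\<^esub>" if "d \<in> carrier (H i)" for i d m N
  proof -
    have "\<psi> (incl i d) [^]\<^bsub>W\<^esub> order (H i) = \<one>\<^bsub>W\<^esub>"
      using psi.hom_nat_pow[of "incl i d" "order (H i)"] incl_pow_order[OF that] that by simp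
    moreover obtain q where "m * (N * e) = order (H i) * q" by (cases i) (auto simp: e_def)
    ultimately show ?thesis using that by (simp add: W.nat_pow_pow[symmetric])
  qed
  have tors1: "\<psi> (incl i d) [^]\<^bsub>W\<^esub> (N * e) = \<one>\<^bsub>W\<^esub>" if "d \<in> carrier (H i)" for i d N
    using tors[OF that, of 1 N] by simp
  have one: "hom_qm p \<one>\<^bsub>W\<^esub> = 0" for p
    using W.homogeneous_torsion[OF hom_qm(2), of "\<one>\<^bsub>W\<^esub>" 1] by simp
  obtain Ma where Ma: "\<And>K. K \<ge> Ma \<Longrightarrow> hom_qm (code_word a b K) (Y a) = 0"
    using hom_qm_eventually_zero[OF Y[OF a(1)] a(3)] by blast
  obtain Mb where Mb: "\<And>K. K \<ge> Mb \<Longrightarrow> hom_qm (code_word a b K) (Y b) = 0"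
    using hom_qm_eventually_zero[OF Y[OF a(2)] a(3)] by blast
  have "\<exists>M. \<forall>N\<ge>M. N > 0 \<longrightarrow> hom_qm (code_word a b (N * e)) (PW (code_word a b (N * e))) \<ge> 0"
  proof -
    \<comment> \<open>In the first three cases the image collapses to a power of the single fixed
      element \<open>Y b\<close> or \<open>Y a\<close>, where \<open>hom_qm_eventually_zero\<close>
      applies; in the fourth all runs are torsion and the image is trivial.\<close>
    consider "\<psi> (incl True a) = \<one>\<^bsub>W\<^esub>" | "\<psi> (incl True b) = \<one>\<^bsub>W\<^esub>" | "\<psi> (incl True a) = \<psi> (incl True b)"
      | "\<psi> (incl False c) = \<one>\<^bsub>W\<^esub>"
      | "\<psi> (incl True a) \<noteq> \<one>\<^bsub>W\<^esub>" "\<psi> (incl True b) \<noteq> \<one>\<^bsub>W\<^esub>" "\<psi> (incl True a) \<noteq> \<psi> (incl True b)"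
        "\<psi> (incl False c) \<noteq> \<one>\<^bsub>W\<^esub>" by blast
    then show ?thesis
    proof cases
      case 1
      then have "Y a = \<psi> (incl False c)" using c by (simp add: Y_def)
      then have "PW (code_word a b (N * e)) = Y b [^]\<^bsub>W\<^esub> (2 * (N * e) + 4 * (N * e))" for N
        using Y[OF a(2)] tors[OF c] tors1[OF c] by (simp add: PW_code W.nat_pow_mult)
      then have "hom_qm (code_word a b (N * e)) (PW (code_word a b (N * e))) = 0" if "N \<ge> Mb" for N
        using Mb[of "N * e"] that e W.homogeneous_nat[OF hom_qm(2) Y[OF a(2)]]
        by (simp add: le_trans[OF that])
      then show ?thesis by (metis order_refl)
    next
      case 2
      then have "Y b = \<psi> (incl False c)" using c by (simp add: Y_def)
      then have "PW (code_word a b (N * e)) = Y a [^]\<^bsub>W\<^esub> (N * e + 3 * (N * e))" for N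
        using Y[OF a(1)] tors[OF c] by (simp add: PW_code W.nat_pow_mult)
      then have "hom_qm (code_word a b (N * e)) (PW (code_word a b (N * e))) = 0" if "N \<ge> Ma" for N
        using Ma[of "N * e"] that e W.homogeneous_nat[OF hom_qm(2) Y[OF a(1)]]
        by (simp add: le_trans[OF that])
      then show ?thesis by (metis order_refl)
    next
      case 3
      then have "Y b = Y a" by (simp add: Y_def)
      then have "PW (code_word a b (N * e)) = Y a [^]\<^bsub>W\<^esub> (N * e + (2 * (N * e) + (3 * (N * e) + 4 * (N * e))))" for N
        using Y[OF a(1)] by (simp add: PW_code W.nat_pow_mult)
      then have "hom_qm (code_word a b (N * e)) (PW (code_word a b (N * e))) = 0" if "N \<ge> Ma" for N
        using Ma[of "N * e"] that e W.homogeneous_nat[OF hom_qm(2) Y[OF a(1)]]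
        by (simp add: le_trans[OF that])
      then show ?thesis by (metis order_refl)
    next
      case 4
      then have "Y d = \<psi> (incl True d)" if "d \<in> carrier (H True)" for d using that by (simp add: Y_def)
      then have "PW (code_word a b (N * e)) = \<one>\<^bsub>W\<^esub>" for N
        using a tors[OF a(1)] tors[OF a(2)] tors1[OF a(1)] by (simp add: PW_code)
      then show ?thesis using one by simp
    next
      case 5
      obtain x i j \<alpha> \<beta> y where x: "x \<in> carrier W" and y: "y \<in> words" "reduced y" "y = [] \<or> fst (hd y) \<noteq> i" "y = [] \<or> fst (last y) \<noteq> j"
        and A: "\<forall>c\<in>carrier (H True). \<alpha> c \<in> carrier (H i) \<and> \<psi> (incl True c) = x \<otimes>\<^bsub>W\<^esub> incl i (\<alpha> c) \<otimes>\<^bsub>W\<^esub> inv\<^bsub>W\<^esub> x"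
        and B: "\<forall>c\<in>carrier (H False). \<beta> c \<in> carrier (H j) \<and> \<psi> (incl False c) = x \<otimes>\<^bsub>W\<^esub> cls (y @ (j, \<beta> c) # winv y) \<otimes>\<^bsub>W\<^esub> inv\<^bsub>W\<^esub> x"
        by (rule endomorphism_normal_form[OF psi])
      \<comment> \<open>Up to the common conjugator x, D is the image of the separator c, and each
        A-letter d with its separator becomes the block \<open>(i, \<alpha> d) # D\<close>.\<close>
      define D where "D = y @ (j, \<beta> c) # winv y"
      have Dw: "D \<in> words" using y(1) B c by (simp add: D_def)
      have \<alpha>: "\<alpha> a \<in> carrier (H i)" "\<alpha> b \<in> carrier (H i)" "\<alpha> a \<noteq> \<one>\<^bsub>H i\<^esub>" "\<alpha> b \<noteq> \<one>\<^bsub>H i\<^esub>" "\<alpha> a \<noteq> \<alpha> b"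
        using A a 5 x incl_one[of i] by auto
      have \<beta>: "\<beta> c \<in> carrier (H j)" "\<beta> c \<noteq> \<one>\<^bsub>H j\<^esub>"
        using B c 5(4) x y(1) incl_one[of j] by (auto simp: cls_conj_word)
      define w where "w s = concat (map (\<lambda>d. (i, \<alpha> d) # D) s)" for s
      have ww: "w s \<in> words" if "set s \<subseteq> carrier (H True)" for s
        unfolding w_def using that A Dw by (intro words_concat) auto
      have PW_w: "PW s = x \<otimes>\<^bsub>W\<^esub> cls (w s) \<otimes>\<^bsub>W\<^esub> inv\<^bsub>W\<^esub> x" if "set s \<subseteq> carrier (H True)" for s
        using that
      proof (induction s)
        case Nil
        then show ?case using x by (simp add: PW_def pair_word_def w_def flip: one_eq)
      next
        case (Cons d s)
        have d: "d \<in> carrier (H True)" "set s \<subseteq> carrier (H True)" using Cons.prems by auto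
        have "cls (w (d # s)) = (incl i (\<alpha> d) \<otimes>\<^bsub>W\<^esub> cls D) \<otimes>\<^bsub>W\<^esub> cls (w s)"
          using d A Dw ww[OF d(2)] cls_Cons[of i "\<alpha> d" D] mult_cls[of "(i, \<alpha> d) # D" "w s"] by (simp add: w_def)
        moreover have "Y d = x \<otimes>\<^bsub>W\<^esub> (incl i (\<alpha> d) \<otimes>\<^bsub>W\<^esub> cls D) \<otimes>\<^bsub>W\<^esub> inv\<^bsub>W\<^esub> x"
          using A[THEN bspec, OF d(1)] B[THEN bspec, OF c] x Dw W.conj_mult[OF x, of "incl i (\<alpha> d)" "cls D"]
          by (simp add: Y_def D_def)
        moreover have "PW (d # s) = Y d \<otimes>\<^bsub>W\<^esub> PW s" using PW_append[of "[d]" s] PW_one d by simp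
        ultimately show ?case
          using Cons.IH[OF d(2)] x ww[OF d(2)] Dw A[THEN bspec, OF d(1)]
            W.conj_mult[OF x, of "incl i (\<alpha> d) \<otimes>\<^bsub>W\<^esub> cls D" "cls (w s)"] by simp
      qed
      have code_sub: "set (code_word a b K) \<subseteq> carrier (H True)" for K
        using set_code_word[of a b K] a by auto
      have eq: "hom_qm p (PW (code_word a b K)) = hom_qm p (cls (w (code_word a b K)))" for p K
        using PW_w[OF code_sub] W.homogeneous_conj[OF hom_qm(1,2) _ x] ww[OF code_sub] by simp
      show ?thesis
      proof (cases "y = [] \<and> i = j")
        case True
        \<comment> \<open>Here both factors land in the same factor, so the image is
          torsion.\<close>
        have "hom_qm p (cls (w (code_word a b K))) = 0" for p K
        proof -
          have "fst l = i" if "l \<in> set (w (code_word a b K))" for l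
            using that True by (auto simp: w_def D_def)
          then obtain d where "d \<in> carrier (H i)" "cls (w (code_word a b K)) = incl i d"
            using cls_single_vertex[OF ww[OF code_sub]] by blast
          then show ?thesis
            using W.homogeneous_torsion[OF hom_qm(2) _ incl_pow_order order_pos] by simp
        qed
        then show ?thesis using eq by simp
      next
        case False
        have D: "reduced D" "D \<noteq> []" "fst (hd D) \<noteq> i" "fst (last D) \<noteq> i"
        proof -
          have "reduced (y @ [(j, \<beta> c)] @ winv y)"
            using y \<beta> reduced_winv[OF y(1,2)] fst_hd_winv[of y] by (auto simp: reduced_append)
          then show "reduced D" by (simp add: D_def)
          show "D \<noteq> []" by (simp add: D_def)
          show "fst (hd D) \<noteq> i" "fst (last D) \<noteq> i"
            using False y(3) fst_last_winv[of y] by (cases "y = []"; simp add: D_def)+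
        qed
        have red: "reduced (w (code_word a b K) @ w (code_word a b K))" for K
        proof -
          have "d \<in> carrier (H i) \<and> d \<noteq> \<one>\<^bsub>H i\<^esub>" if "d \<in> set (map \<alpha> (code_word a b K))" for d
            using that set_code_word[of a b K] \<alpha> by auto
          from blocks_reduced(2)[OF Dw D, of "map \<alpha> (code_word a b K)", OF this] show ?thesis
            unfolding w_def by (simp add: comp_def)
        qed
        show ?thesis
        proof (cases "letters D = []")
          case True
          \<comment> \<open>D consists of B-letters and does not begin at i. So the A-letters of the
            image form the code word in \<open>\<alpha> a\<close> and \<open>\<alpha> b\<close>, and
            chirality gives the sign.\<close>
          then have "i = True" using D(2,3) by (cases D) (auto split: if_splits)
          then have "letters (w s) = map \<alpha> s" for s
            using True by (induction s) (auto simp: w_def)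
          then have "hom_qm (code_word a b K) (cls (w (code_word a b K))) \<ge> 0" if "K > 0" for K
            using hom_qm_code_nonneg(1)[OF ww[OF code_sub] red _ \<alpha>(5) that a] by (simp add: map_code_word)
          then show ?thesis using eq e by simp
        next
          case False
          \<comment> \<open>Every block now carries the A-letters of D, at most \<open>L\<close>
            letters in all, and likewise in the inverse. For large K no code word fits into either,
            and the value is 0.\<close>
          define L where "L = Suc (length D)"
          have bl: "length (letters ((i, d) # D)) \<le> L \<and> set (letters D) \<subseteq> set (letters ((i, d) # D))"
            "length (letters (winv ((i, d) # D))) \<le> L \<and> set (letters (winv D)) \<subseteq> set (letters (winv ((i, d) # D)))" for d
            using length_letters[of D] length_letters[of "winv D"] by (auto simp: L_def winv_Cons)
          have ne: "letters (winv D) \<noteq> []" using False by (simp add: letters_winv)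
          have pow: "concat (replicate n (w s)) = concat (map (\<lambda>d. (i, \<alpha> d) # D) (concat (replicate n s)))" for n s
            by (induction n) (auto simp: w_def)
          have winv_concat: "winv (concat ws) = concat (map winv (rev ws))" for ws :: "(bool \<times> 'h) list list"
            by (induction ws) auto
          have z1: "count_factor (code_word a b K) (letters (concat (replicate n (w s)))) = 0" if "K \<ge> 2 * L" for K n s
            unfolding pow letters_concat
            by (rule no_code_word[OF False _ that a(3)]) (use bl(1) in \<open>auto simp: L_def simp del: letters_Cons\<close>)
          have z2: "count_factor (code_word a b K) (letters (winv (concat (replicate n (w s))))) = 0" if "K \<ge> 2 * L" for K n s
            unfolding pow winv_concat letters_concat
            by (rule no_code_word[OF ne _ that a(3)]) (use bl(2) in \<open>auto simp: L_def simp del: letters_Cons\<close>)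
          have "hom_qm (code_word a b (N * e)) (cls (w (code_word a b (N * e)))) = 0" if "N \<ge> 2 * L" for N
          proof -
            have "2 * L \<le> N * e" using that e by (metis le_trans mult_le_mono2 Suc_leI One_nat_def mult_1_right)
            then show ?thesis using z1 z2 by (intro hom_qm_zero[OF ww[OF code_sub] red]) auto
          qed
          then show ?thesis using eq by (metis order_refl)
        qed
      qed
    qed
  qed
  then obtain M where "\<forall>N\<ge>M. N > 0 \<longrightarrow> hom_qm (code_word a b (N * e)) (PW (code_word a b (N * e))) \<ge> 0" by blast
  then show thesis using that[of M] unfolding PW_def e_def by blast
qed

lemma hom_qm_pair_word:
  assumes "a \<in> carrier (H True)" "b \<in> carrier (H True)" "a \<noteq> b" "a \<noteq> \<one>\<^bsub>H True\<^esub>" "b \<noteq> \<one>\<^bsub>H True\<^esub>"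
    and "c \<in> carrier (H False)" "c \<noteq> \<one>\<^bsub>H False\<^esub>" "K > 0"
  shows "hom_qm (code_word a b K) (cls (pair_word c (code_word a b K))) \<ge> 1"
proof -
  let ?w = "pair_word c (code_word a b K)"
  have w: "?w = concat (map (\<lambda>d. (True, d) # [(False, c)]) (code_word a b K))" by (simp add: pair_word_def)
  have "letters (pair_word c s) = s" for s by (induction s) (auto simp: pair_word_def)
  moreover have "d \<in> carrier (H True) \<and> d \<noteq> \<one>\<^bsub>H True\<^esub>" if "d \<in> set (code_word a b K)" for d
    using that set_code_word[of a b K] assms by auto
  then have "?w \<in> words" "reduced (?w @ ?w)"
    unfolding w using assms blocks_reduced[of "[(False, c)]" True "code_word a b K"] by auto
  ultimately show ?thesis using hom_qm_code_nonneg(2)[of ?w a b K a b] assms by simp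
qed

end

section \<open>Averaging over automorphisms\<close>

lemma quasimorphism_sum:
  assumes "finite S" "\<And>h. h \<in> S \<Longrightarrow> quasimorphism M h"
  shows "quasimorphism M (\<lambda>g. \<Sum>h\<in>S. h g)"
  using assms
proof (induction S)
  case empty
  then show ?case by (auto simp: quasimorphism_def)
next
  case (insert h S)
  obtain D1 where D1: "\<forall>x\<in>carrier M. \<forall>y\<in>carrier M. \<bar>h x + h y - h (x \<otimes>\<^bsub>M\<^esub> y)\<bar> \<le> D1"
    using insert.prems[of h] by (auto simp: quasimorphism_def)
  obtain D2 where D2: "\<forall>x\<in>carrier M. \<forall>y\<in>carrier M.
      \<bar>(\<Sum>h\<in>S. h x) + (\<Sum>h\<in>S. h y) - (\<Sum>h\<in>S. h (x \<otimes>\<^bsub>M\<^esub> y))\<bar> \<le> D2"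
    using insert by (auto simp: quasimorphism_def)
  have "\<bar>(\<Sum>h\<in>insert h S. h x) + (\<Sum>h\<in>insert h S. h y) - (\<Sum>h\<in>insert h S. h (x \<otimes>\<^bsub>M\<^esub> y))\<bar> \<le> D1 + D2"
    if "x \<in> carrier M" "y \<in> carrier M" for x y
    using D1[THEN bspec, OF that(1), THEN bspec, OF that(2)] D2[THEN bspec, OF that(1), THEN bspec, OF that(2)] insert.hyps
    by simp
  then show ?case unfolding quasimorphism_def by blast
qed

text \<open>Evaluate a vanishing combination at \<open>x j\<close> for the least index j with a
  non-zero coefficient: smaller indices have coefficient 0, larger ones vanish at
  \<open>x j\<close>.\<close>

lemma triangular_lin_indep:
  fixes F :: "nat \<Rightarrow> 'a \<Rightarrow> real"
  assumes x: "\<And>k. x k \<in> carrier M" and diag: "\<And>k. F k (x k) \<noteq> 0"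
    and zero: "\<And>j k. j < k \<Longrightarrow> F k (x j) = 0"
  shows "infinite (range F)" "lin_indep_funs M (range F)"
proof -
  have "F j \<noteq> F k" if "j < k" for j k using zero[OF that] diag[of j] by metis
  then have inj: "inj F" by (metis injI nat_neq_iff)
  then show "infinite (range F)" using range_inj_infinite by blast
  show "lin_indep_funs M (range F)"
    unfolding lin_indep_funs_def
  proof (intro allI impI ballI, elim conjE)
    fix S c f assume S: "finite S" "S \<subseteq> range F" "\<forall>g\<in>carrier M. (\<Sum>f\<in>S. c f * f g) = 0" and "f \<in> S"
    show "c f = 0"
    proof (rule ccontr)
      assume "c f \<noteq> 0"
      define J where "J k \<longleftrightarrow> F k \<in> S \<and> c (F k) \<noteq> 0" for k
      have "\<exists>k. J k" using \<open>f \<in> S\<close> \<open>c f \<noteq> 0\<close> S(2) by (auto simp: J_def)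
      define j where "j = (LEAST k. J k)"
      have j: "J j" unfolding j_def using \<open>\<exists>k. J k\<close> by (rule LeastI_ex)
      have "c h * h (x j) = 0" if h: "h \<in> S" "h \<noteq> F j" for h
      proof -
        obtain k where k: "h = F k" using h S(2) by auto
        show ?thesis
        proof (cases "k < j")
          case True
          then have "\<not> J k" unfolding j_def by (rule not_less_Least)
          then show ?thesis using h k by (simp add: J_def)
        next
          case False
          then have "j < k" using h k by (metis nat_neq_iff)
          then show ?thesis using zero k by simp
        qed
      qed
      then have "(\<Sum>h\<in>S - {F j}. c h * h (x j)) = 0" by (intro sum.neutral) blast
      then have "(\<Sum>h\<in>S. c h * h (x j)) = c (F j) * F j (x j)"
        using S(1) j by (subst sum.remove[of S "F j"]) (auto simp: J_def)
      then show False using S(3) x j diag by (simp add: J_def)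
    qed
  qed
qed

text \<open>The hypothesis \<open>gens\<close> says that each vertex element is either killed by
  \<rho> or lies in the copy \<sigma>(P) of the free product. This is what makes automorphisms that
  preserve conjugacy classes descend to P.\<close>

theorem retract_quasimorphisms:
  fixes V :: "'v set" and E :: "'v set set" and G :: "'v \<Rightarrow> 'g monoid" and H :: "bool \<Rightarrow> 'h monoid"
  assumes gp: "graph_prod V E G" and finV: "finite V" and finG: "\<And>v. v \<in> V \<Longrightarrow> finite (carrier (G v))"
    and fp: "free_product2 H"
    and a: "a \<in> carrier (H True)" "b \<in> carrier (H True)" "a \<noteq> b" "a \<noteq> \<one>\<^bsub>H True\<^esub>" "b \<noteq> \<one>\<^bsub>H True\<^esub>"
    and c: "c \<in> carrier (H False)" "c \<noteq> \<one>\<^bsub>H False\<^esub>"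
    and rho: "\<rho> \<in> hom (graph_product V E G) (graph_product UNIV {} H)"
    and sigma: "\<sigma> \<in> hom (graph_product UNIV {} H) (graph_product V E G)"
    and retraction: "\<And>p. p \<in> carrier (graph_product UNIV {} H) \<Longrightarrow> \<rho> (\<sigma> p) = p"
    and gens: "\<And>v d. v \<in> V \<Longrightarrow> d \<in> carrier (G v) \<Longrightarrow>
        \<rho> (gp_incl V E G v d) = \<one>\<^bsub>graph_product UNIV {} H\<^esub> \<or> \<sigma> (\<rho> (gp_incl V E G v d)) = gp_incl V E G v d"
  shows "\<exists>Q :: (('v \<times> 'g) list set \<Rightarrow> real) set. infinite Q
           \<and> (\<forall>\<psi>\<in>Q. quasimorphism (graph_product V E G) \<psi>
                    \<and> homogeneous_qm (graph_product V E G) \<psi>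
                    \<and> aut_invariant (graph_product V E G) \<psi>)
           \<and> lin_indep_funs (graph_product V E G) Q"
proof -
  interpret W: graph_prod V E G by (rule gp)
  interpret P: free_product2 H by (rule fp)
  let ?W = "graph_product V E G" and ?P = "graph_product UNIV {} H"
  interpret rho: group_hom ?W ?P \<rho>
    using rho W.group_W P.group_W by (simp add: group_hom_def group_hom_axioms_def)
  interpret sigma: group_hom ?P ?W \<sigma>
    using sigma W.group_W P.group_W by (simp add: group_hom_def group_hom_axioms_def)
  have iso_hom: "group_hom ?W ?W \<phi>" if "\<phi> \<in> iso ?W ?W" for \<phi>
    using that W.group_W by (simp add: group_hom_def group_hom_axioms_def iso_def)
  have iso_inv: "inv_into (carrier ?W) \<phi> \<in> iso ?W ?W" "\<And>g. g \<in> carrier ?W \<Longrightarrow> \<phi> (inv_into (carrier ?W) \<phi> g) = g"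
    "\<And>g. g \<in> carrier ?W \<Longrightarrow> inv_into (carrier ?W) \<phi> (\<phi> g) = g" if "\<phi> \<in> iso ?W ?W" for \<phi>
    using that W.W.iso_set_sym[OF that] by (auto simp: iso_def bij_betw_def f_inv_into_f)

  define Tor where "Tor = {g \<in> carrier ?W. \<exists>n::nat. n > 0 \<and> g [^]\<^bsub>?W\<^esub> n = \<one>\<^bsub>?W\<^esub>}"
  \<comment> \<open>By \<open>torsion_conjugate_clique\<close> every torsion class has a
    representative with distinct vertices, hence of length at most \<open>card V\<close>.\<close>
  define R0 where "R0 = W.cls ` {w \<in> W.words. length w \<le> card V}"
  have fin_R0: "finite R0"
  proof -
    have "finite (SIGMA v:V. carrier (G v))" using finV finG by (intro finite_SigmaI)
    then have "finite {w. set w \<subseteq> (SIGMA v:V. carrier (G v)) \<and> length w \<le> card V}" by (rule finite_lists_length_le)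
    moreover have "{w \<in> W.words. length w \<le> card V} \<subseteq> {w. set w \<subseteq> (SIGMA v:V. carrier (G v)) \<and> length w \<le> card V}"
      by (auto simp: gp_words_def)
    ultimately show ?thesis unfolding R0_def by (meson finite_imageI finite_subset)
  qed
  have Tor_R0: "\<exists>r\<in>R0. conjugate ?W g r" if g_Tor: "g \<in> Tor" for g
  proof -
    obtain n :: nat where "g \<in> carrier ?W" "n > 0" "g [^]\<^bsub>?W\<^esub> n = \<one>\<^bsub>?W\<^esub>" using g_Tor by (auto simp: Tor_def)
    then obtain w where w: "w \<in> W.words" "conjugate ?W g (W.cls w)" "distinct (map fst w)"
      using W.torsion_conjugate_clique by metis
    have "length w = card (set (map fst w))" using w(3) by (metis distinct_card length_map)
    also have "\<dots> \<le> card V" using w(1) finV by (intro card_mono) (auto simp: gp_words_def)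
    finally show ?thesis using w by (auto simp: R0_def)
  qed
  have Tor_iso: "\<phi> g \<in> Tor" if phi_Tor: "\<phi> \<in> iso ?W ?W" "g \<in> Tor" for \<phi> g
  proof -
    interpret group_hom ?W ?W \<phi> using iso_hom that by blast
    obtain n :: nat where "g \<in> carrier ?W" "n > 0" "g [^]\<^bsub>?W\<^esub> n = \<one>\<^bsub>?W\<^esub>" using phi_Tor by (auto simp: Tor_def)
    then have "\<phi> g \<in> carrier ?W" "n > 0" "\<phi> g [^]\<^bsub>?W\<^esub> n = \<one>\<^bsub>?W\<^esub>" using hom_nat_pow[of g n] by auto
    then show ?thesis by (auto simp: Tor_def)
  qed
  \<comment> \<open>The test elements. The vertex groups are needed to descend to P, the images of
    the factors of P to see that the induced map preserves classes there.\<close>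
  define T where "T = (\<Union>v\<in>V. W.incl v ` carrier (G v)) \<union> (\<Union>i. (\<lambda>d. \<sigma> (P.incl i d)) ` carrier (H i))"
  have fin_T: "finite T" using finV finG P.factor_finite by (auto simp: T_def)
  have hom_tor: "h d \<in> Tor" if "group K" "finite (carrier K)" "h \<in> hom K ?W" "d \<in> carrier K" for K :: "'k monoid" and h d
  proof -
    interpret group_hom K ?W h using that W.group_W by (simp add: group_hom_def group_hom_axioms_def)
    have "h d [^]\<^bsub>?W\<^esub> order K = \<one>\<^bsub>?W\<^esub>"
      using hom_nat_pow[OF that(4), of "order K"] G.pow_order_eq_1[OF that(4)] by simp
    moreover have "order K > 0" using that(2) by (metis G.order_gt_0_iff_finite)
    ultimately show ?thesis using that(4) by (auto simp: Tor_def)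
  qed
  have T_Tor: "t \<in> Tor" if "t \<in> T" for t
    using that hom_tor[OF W.vertex_group finG W.incl_hom]
      hom_tor[OF P.factor_group P.factor_finite Group.hom_compose[OF P.incl_hom sigma]]
    by (auto simp: T_def comp_def)
  \<comment> \<open>Inverses are used so that equal signatures make \<phi> after the inverse of
    \<phi>' preserve the class of every test element. There are only finitely many signatures, and
    \<open>R\<close> picks one automorphism for each.\<close>
  define sig where "sig \<phi> = (\<lambda>t\<in>T. {r \<in> R0. conjugate ?W (inv_into (carrier ?W) \<phi> t) r})" for \<phi>
  have "finite (sig ` iso ?W ?W)"
  proof (rule finite_subset)
    show "sig ` iso ?W ?W \<subseteq> T \<rightarrow>\<^sub>E Pow R0" by (auto simp: sig_def)
    show "finite (T \<rightarrow>\<^sub>E Pow R0)" using fin_T fin_R0 by (intro finite_PiE) auto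
  qed
  from finite_subset_image[OF this subset_refl]
  obtain R where R: "R \<subseteq> iso ?W ?W" "finite R" "sig ` iso ?W ?W = sig ` R" by blast

  have same_sig: "\<exists>x\<in>carrier ?P. \<forall>g\<in>carrier ?W. \<rho> (\<phi> g) = x \<otimes>\<^bsub>?P\<^esub> \<rho> (\<phi>' g) \<otimes>\<^bsub>?P\<^esub> inv\<^bsub>?P\<^esub> x"
    if phi: "\<phi> \<in> iso ?W ?W" "\<phi>' \<in> iso ?W ?W" "sig \<phi> = sig \<phi>'" for \<phi> \<phi>'
  proof -
    interpret phi: group_hom ?W ?W \<phi> using iso_hom phi by blast
    interpret phi': group_hom ?W ?W \<phi>' using iso_hom phi by blast
    let ?i = "inv_into (carrier ?W) \<phi>" and ?i' = "inv_into (carrier ?W) \<phi>'"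
    interpret i': group_hom ?W ?W ?i' using iso_hom iso_inv phi by blast
    define \<chi> where "\<chi> g = \<phi> (?i' g)" for g
    have chi_hom: "\<chi> \<in> hom ?W ?W" unfolding \<chi>_def by (rule homI) auto
    have chi_T: "conjugate ?W t (\<chi> t)" if t: "t \<in> T" for t
    proof -
      have tW: "t \<in> carrier ?W" using T_Tor[OF t] by (simp add: Tor_def)
      have it: "?i t \<in> Tor" "?i' t \<in> Tor" using Tor_iso T_Tor[OF t] iso_inv phi by auto
      then have itW: "?i t \<in> carrier ?W" "?i' t \<in> carrier ?W" by (auto simp: Tor_def)
      obtain r where r: "r \<in> R0" "conjugate ?W (?i t) r" using Tor_R0 it by blast
      have "sig \<phi> t = sig \<phi>' t" using phi by simp
      then have "conjugate ?W (?i' t) r" using t r by (auto simp: sig_def)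
      then have "conjugate ?W r (?i' t)" using W.W.conjugate_sym itW by blast
      then have "conjugate ?W (?i t) (?i' t)" using W.W.conjugate_trans[OF r(2)] itW by blast
      from phi.conjugate_hom[OF this itW(1)] show ?thesis using iso_inv(2)[OF phi(1) tW] by (simp add: \<chi>_def)
    qed
    define \<psi> where "\<psi> p = \<rho> (\<chi> (\<sigma> p))" for p
    interpret chi: group_hom ?W ?W \<chi> using chi_hom W.group_W by (simp add: group_hom_def group_hom_axioms_def)
    have psi: "\<psi> \<in> hom ?P ?P" unfolding \<psi>_def by (rule homI) auto
    interpret psi: group_hom ?P ?P \<psi> using psi P.group_W by (simp add: group_hom_def group_hom_axioms_def)
    \<comment> \<open>On a killed generator both sides are trivial, as \<chi> moves it only within
      its conjugacy class; on a generator fixed by \<sigma> after \<rho> both sides agree by the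
      choice of \<psi>.\<close>
    have fact: "\<rho> (\<chi> g) = \<psi> (\<rho> g)" if "g \<in> carrier ?W" for g
    proof (rule W.hom_eqI[OF _ _ P.group_W _ that, of "\<lambda>g. \<rho> (\<chi> g)" "\<lambda>g. \<psi> (\<rho> g)"])
      show "(\<lambda>g. \<rho> (\<chi> g)) \<in> hom ?W ?P" "(\<lambda>g. \<psi> (\<rho> g)) \<in> hom ?W ?P" by (auto intro!: homI)
      fix v d assume vd: "v \<in> V" "d \<in> carrier (G v)"
      then have t: "W.incl v d \<in> T" "W.incl v d \<in> carrier ?W" by (auto simp: T_def)
      show "\<rho> (\<chi> (W.incl v d)) = \<psi> (\<rho> (W.incl v d))"
      proof (cases "\<rho> (W.incl v d) = \<one>\<^bsub>?P\<^esub>")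
        case True
        then show ?thesis using rho.conjugate_hom[OF chi_T[OF t(1)] t(2)] P.W.conjugate_one by simp
      next
        case False
        then show ?thesis using gens[OF vd] by (simp add: \<psi>_def)
      qed
    qed
    have surj: "\<psi> ` carrier ?P = carrier ?P"
    proof
      show "carrier ?P \<subseteq> \<psi> ` carrier ?P"
      proof
        fix p assume p: "p \<in> carrier ?P"
        define g where "g = \<phi>' (?i (\<sigma> p))"
        have "?i (\<sigma> p) \<in> carrier ?W"
          using iso_inv(1)[OF phi(1)] p by (auto simp: iso_def hom_def)
        then have g: "g \<in> carrier ?W" "\<chi> g = \<sigma> p"
          using p iso_inv(2)[OF phi(1)] iso_inv(3)[OF phi(2)] by (auto simp: g_def \<chi>_def)
        then have "\<psi> (\<rho> g) = p" using fact[OF g(1)] retraction[OF p] by simp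
        then show "p \<in> \<psi> ` carrier ?P" using g by (metis image_eqI rho.hom_closed)
      qed
    qed auto
    have "conjugate ?P (P.incl i d) (\<psi> (P.incl i d))" if "d \<in> carrier (H i)" for i d
    proof -
      have t: "\<sigma> (P.incl i d) \<in> T" "\<sigma> (P.incl i d) \<in> carrier ?W" using that by (auto simp: T_def)
      show ?thesis using rho.conjugate_hom[OF chi_T[OF t(1)] t(2)] retraction that by (simp add: \<psi>_def)
    qed
    moreover have "carrier (H i) \<noteq> {\<one>\<^bsub>H i\<^esub>}" for i using a c by (cases i) auto
    ultimately obtain x where x: "x \<in> carrier ?P" "\<And>g. g \<in> carrier ?P \<Longrightarrow> \<psi> g = x \<otimes>\<^bsub>?P\<^esub> g \<otimes>\<^bsub>?P\<^esub> inv\<^bsub>?P\<^esub> x"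
      using P.class_preserving_inner[OF psi surj] by blast
    have "\<rho> (\<phi> g) = x \<otimes>\<^bsub>?P\<^esub> \<rho> (\<phi>' g) \<otimes>\<^bsub>?P\<^esub> inv\<^bsub>?P\<^esub> x" if "g \<in> carrier ?W" for g
      using fact[of "\<phi>' g"] x(2)[of "\<rho> (\<phi>' g)"] iso_inv(3)[OF phi(2) that] that by (simp add: \<chi>_def)
    then show ?thesis using x(1) by blast
  qed

  \<comment> \<open>Restricting to the carrier turns agreement on W into equality of functions. As
    \<open>orbit\<close> is a set, pullbacks that agree are summed once, and an automorphism
    permutes it.\<close>
  define orbit where "orbit f = (\<lambda>\<phi>. \<lambda>g\<in>carrier ?W. f (\<rho> (\<phi> g))) ` R" for f :: "_ \<Rightarrow> real"
  have fin_orbit: "finite (orbit f)" for f using R by (simp add: orbit_def)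
  have orbit: "(\<lambda>g\<in>carrier ?W. f (\<rho> (\<phi> g))) \<in> orbit f"
    if f: "quasimorphism ?P f" "homogeneous_qm ?P f" and phi: "\<phi> \<in> iso ?W ?W" for f \<phi>
  proof -
    have "sig \<phi> \<in> sig ` R" using R phi by blast
    then obtain \<phi>' where phi': "\<phi>' \<in> R" "sig \<phi> = sig \<phi>'" by blast
    then interpret phi': group_hom ?W ?W \<phi>' using iso_hom R by blast
    obtain x where "x \<in> carrier ?P" "\<forall>g\<in>carrier ?W. \<rho> (\<phi> g) = x \<otimes>\<^bsub>?P\<^esub> \<rho> (\<phi>' g) \<otimes>\<^bsub>?P\<^esub> inv\<^bsub>?P\<^esub> x"
      using same_sig[OF phi _ phi'(2)] phi' R by blast
    then have "(\<lambda>g\<in>carrier ?W. f (\<rho> (\<phi> g))) = (\<lambda>g\<in>carrier ?W. f (\<rho> (\<phi>' g)))"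
      using P.W.homogeneous_conj[OF f] by (intro restrict_ext) simp
    then show ?thesis using phi' by (auto simp: orbit_def)
  qed
  define avg where "avg f g = (\<Sum>h\<in>orbit f. h g)" for f g
  have avg: "quasimorphism ?W (avg f) \<and> homogeneous_qm ?W (avg f) \<and> aut_invariant ?W (avg f)"
    if f: "quasimorphism ?P f" "homogeneous_qm ?P f" for f
  proof (intro conjI)
    have qh: "quasimorphism ?W h \<and> homogeneous_qm ?W h" if "h \<in> orbit f" for h
    proof -
      obtain \<phi> where phi: "\<phi> \<in> iso ?W ?W" and h: "h = (\<lambda>g\<in>carrier ?W. f (\<rho> (\<phi> g)))"
        using \<open>h \<in> orbit f\<close> R by (auto simp: orbit_def)
      interpret phi: group_hom ?W ?W \<phi> using iso_hom phi by blast
      have "homogeneous_qm ?W h"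
        using f(2) by (simp add: homogeneous_qm_def h phi.hom_int_pow rho.hom_int_pow)
      moreover have "quasimorphism ?W h" using f(1) by (fastforce simp: quasimorphism_def h)
      ultimately show ?thesis by blast
    qed
    then show "quasimorphism ?W (avg f)" unfolding avg_def by (intro quasimorphism_sum fin_orbit) auto
    show "homogeneous_qm ?W (avg f)"
      using qh by (auto simp: homogeneous_qm_def avg_def sum_distrib_left intro!: sum.cong)
    show "aut_invariant ?W (avg f)"
      unfolding aut_invariant_def
    proof (intro ballI)
      fix \<phi> g assume phi: "\<phi> \<in> iso ?W ?W" and g: "g \<in> carrier ?W"
      interpret phi: group_hom ?W ?W \<phi> using iso_hom phi by blast
      define t where "t h = (\<lambda>g\<in>carrier ?W. h (\<phi> g))" for h :: "_ \<Rightarrow> real"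
      have "t ` orbit f \<subseteq> orbit f"
      proof
        fix h assume "h \<in> t ` orbit f"
        then obtain \<phi>' where phi': "\<phi>' \<in> R" and h: "h = t (\<lambda>g\<in>carrier ?W. f (\<rho> (\<phi>' g)))" by (auto simp: orbit_def)
        have "\<phi>' \<circ> \<phi> \<in> iso ?W ?W" using iso_set_trans[OF phi] phi' R by (auto simp: compose_def)
        from orbit[OF f this] show "h \<in> orbit f" by (simp add: h t_def cong: restrict_cong)
      qed
      moreover have "inj_on t (orbit f)"
      proof (rule inj_onI)
        fix h h' assume hh: "h \<in> orbit f" "h' \<in> orbit f" "t h = t h'"
        have "h u = h' u" if "u \<in> carrier ?W" for u
        proof -
          have "inv_into (carrier ?W) \<phi> u \<in> carrier ?W" using iso_inv(1)[OF phi] that by (auto simp: iso_def hom_def)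
          then show ?thesis using fun_cong[OF hh(3), of "inv_into (carrier ?W) \<phi> u"] iso_inv(2)[OF phi that] by (simp add: t_def)
        qed
        moreover have "h \<in> extensional (carrier ?W)" "h' \<in> extensional (carrier ?W)" using hh by (auto simp: orbit_def)
        ultimately show "h = h'" by (metis extensionalityI)
      qed
      ultimately have "bij_betw t (orbit f) (orbit f)"
        using fin_orbit by (simp add: bij_betw_def endo_inj_surj)
      from sum.reindex_bij_betw[OF this, of "\<lambda>h. h g"]
      show "avg f (\<phi> g) = avg f g" using g by (simp add: avg_def t_def)
    qed
  qed

  \<comment> \<open>Multiples of both orders, as \<open>hom_qm_endomorphism_nonneg\<close>
    requires.\<close>
  define K where "K N = N * (order (H True) * order (H False))" for N
  have Kpos: "K N > 0" if "N > 0" for N using that P.order_pos by (simp add: K_def)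
  have Kge: "K N \<ge> N" for N using P.order_pos[of True] P.order_pos[of False] by (simp add: K_def)
  define f where "f N = P.hom_qm (code_word a b (K N))" for N
  have f: "quasimorphism ?P (f N)" "homogeneous_qm ?P (f N)" for N using P.hom_qm by (auto simp: f_def)
  define g where "g N = P.cls (P.pair_word c (code_word a b (K N)))" for N
  have code_sub: "set (code_word a b L) \<subseteq> carrier (H True)" for L using P.set_code_word[of a b L] a by auto
  have g: "g N \<in> carrier ?P" for N unfolding g_def by (intro P.cls_closed P.pair_word_words c code_sub)
  have endo: "(\<lambda>p. \<rho> (\<phi> (\<sigma> p))) \<in> hom ?P ?P" if "\<phi> \<in> R" for \<phi>
  proof -
    interpret phi: group_hom ?W ?W \<phi> using iso_hom that R by blast
    show ?thesis by (rule homI) auto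
  qed
  have "\<forall>\<^sub>F N in sequentially. f N (\<rho> (\<phi> (\<sigma> (g N)))) \<ge> 0" if phi: "\<phi> \<in> R" for \<phi>
  proof -
    obtain M where "\<And>N. N \<ge> M \<Longrightarrow> N > 0 \<Longrightarrow> f N (\<rho> (\<phi> (\<sigma> (g N)))) \<ge> 0"
      using P.hom_qm_endomorphism_nonneg[OF endo[OF phi] a(1-3) c(1)] unfolding f_def g_def K_def by blast
    then show ?thesis unfolding eventually_sequentially by (intro exI[of _ "Suc M"]) auto
  qed
  then have "\<forall>\<^sub>F N in sequentially. \<forall>\<phi>\<in>R. f N (\<rho> (\<phi> (\<sigma> (g N)))) \<ge> 0"
    using R(2) by (simp add: eventually_ball_finite)
  \<comment> \<open>All terms are non-negative for large N, and the term of the identity is at least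
    1.\<close>
  then have diag: "\<forall>\<^sub>F N in sequentially. avg (f N) (\<sigma> (g N)) > 0"
    using eventually_gt_at_top[of 0]
  proof eventually_elim
    case (elim N)
    let ?h = "\<lambda>u\<in>carrier ?W. f N (\<rho> u)"
    have "(\<lambda>u. u) \<in> iso ?W ?W" using W.W.is_group by (auto simp: iso_def hom_def bij_betw_def)
    from orbit[OF f this] have "?h \<in> orbit (f N)" by simp
    moreover have "h (\<sigma> (g N)) \<ge> 0" if "h \<in> orbit (f N)" for h using that elim(1) g by (auto simp: orbit_def)
    ultimately have "?h (\<sigma> (g N)) \<le> avg (f N) (\<sigma> (g N))"
      unfolding avg_def by (intro member_le_sum[of ?h "orbit (f N)" "\<lambda>h. h (\<sigma> (g N))"] fin_orbit) auto
    moreover have "?h (\<sigma> (g N)) = f N (g N)" using g retraction by simp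
    moreover have "f N (g N) \<ge> 1" unfolding f_def g_def
      using P.hom_qm_pair_word[OF a c] Kpos elim(2) by simp
    ultimately show ?case by linarith
  qed
  \<comment> \<open>Here the element is fixed while N grows, so each of the finitely many terms
    eventually vanishes.\<close>
  have offdiag: "\<forall>\<^sub>F N in sequentially. avg (f N) (\<sigma> (g m)) = 0" for m
  proof -
    have "\<forall>\<^sub>F N in sequentially. f N (\<rho> (\<phi> (\<sigma> (g m)))) = 0" if phi: "\<phi> \<in> R" for \<phi>
    proof -
      have "\<rho> (\<phi> (\<sigma> (g m))) \<in> carrier ?P" using endo[OF phi] g by (auto simp: hom_def)
      from P.hom_qm_eventually_zero[OF this a(3)]
      obtain M where "\<And>L. L \<ge> M \<Longrightarrow> P.hom_qm (code_word a b L) (\<rho> (\<phi> (\<sigma> (g m)))) = 0" by blast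
      then show ?thesis unfolding eventually_sequentially f_def using Kge le_trans by blast
    qed
    then have "\<forall>\<^sub>F N in sequentially. \<forall>\<phi>\<in>R. f N (\<rho> (\<phi> (\<sigma> (g m)))) = 0"
      using R(2) by (simp add: eventually_ball_finite)
    then show ?thesis
    proof eventually_elim
      case (elim N)
      then show ?case using g by (auto simp: avg_def orbit_def intro!: sum.neutral)
    qed
  qed
  \<comment> \<open>The indices are chosen recursively: \<open>s k\<close> must be large enough for
    the diagonal value and, for all earlier elements at once, for the values to be 0.\<close>
  define good where "good s k N \<longleftrightarrow> avg (f N) (\<sigma> (g N)) > 0 \<and> (\<forall>j<k. avg (f N) (\<sigma> (g (s j))) = 0)"
    for s :: "nat \<Rightarrow> nat" and k N
  have "\<exists>s. \<forall>k. good s k (s k)"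
  proof (rule dependent_wellorder_choice)
    fix k and s :: "nat \<Rightarrow> nat"
    have "\<forall>\<^sub>F N in sequentially. avg (f N) (\<sigma> (g N)) > 0 \<and> (\<forall>j\<in>{..<k}. avg (f N) (\<sigma> (g (s j))) = 0)"
      using diag offdiag by (intro eventually_conj eventually_ball_finite) auto
    then show "\<exists>N. good s k N" by (auto simp: eventually_sequentially good_def)
  qed (simp add: good_def)
  then obtain s where good_s: "\<forall>k. good s k (s k)" by blast
  have s: "avg (f (s k)) (\<sigma> (g (s k))) > 0" "j < k \<Longrightarrow> avg (f (s k)) (\<sigma> (g (s j))) = 0" for j k
    using good_s[THEN spec, of k] by (auto simp: good_def)
  define Q where "Q = range (\<lambda>k. avg (f (s k)))"
  have "infinite Q" "lin_indep_funs ?W Q"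
    unfolding Q_def using s(1) s(2) g
    by (intro triangular_lin_indep[of "\<lambda>k. \<sigma> (g (s k))" ?W "\<lambda>k. avg (f (s k))"]; simp add: less_imp_neq[symmetric])+
  moreover have "\<forall>\<psi>\<in>Q. quasimorphism ?W \<psi> \<and> homogeneous_qm ?W \<psi> \<and> aut_invariant ?W \<psi>"
    using avg[OF f] by (auto simp: Q_def)
  ultimately show ?thesis by blast
qed

section \<open>Retractions onto free products of two factors\<close>

lemma comm_group_DirProd:
  assumes "comm_group A" "comm_group B" shows "comm_group (A \<times>\<times> B)"
proof -
  interpret A: comm_group A by fact
  interpret B: comm_group B by fact
  show ?thesis
    by (rule group.group_comm_groupI[OF DirProd_group]) (auto simp: A.m_comm B.m_comm)
qed

theorem quasimorphisms_of_configuration: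
  fixes V :: "'v set" and E :: "'v set set" and G :: "'v \<Rightarrow> 'g monoid"
  assumes gp: "graph_prod V E G" and finV: "finite V"
    and G: "\<And>v. v \<in> V \<Longrightarrow> comm_group (G v) \<and> finite (carrier (G v)) \<and> carrier (G v) \<noteq> {\<one>\<^bsub>G v\<^esub>}"
    and uv: "u \<in> V" "v \<in> V" "u \<noteq> v" "{u, v} \<notin> E"
    and cases: "(w \<in> V \<and> w \<noteq> v \<and> {u, w} \<in> E \<and> {v, w} \<notin> E) \<or>
      (\<exists>a\<in>carrier (G u). \<exists>b\<in>carrier (G u). a \<noteq> b \<and> a \<noteq> \<one>\<^bsub>G u\<^esub> \<and> b \<noteq> \<one>\<^bsub>G u\<^esub>)"
  shows "\<exists>Q :: (('v \<times> 'g) list set \<Rightarrow> real) set. infinite Q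
           \<and> (\<forall>\<psi>\<in>Q. quasimorphism (graph_product V E G) \<psi>
                    \<and> homogeneous_qm (graph_product V E G) \<psi>
                    \<and> aut_invariant (graph_product V E G) \<psi>)
           \<and> lin_indep_funs (graph_product V E G) Q"
proof -
  interpret W: graph_prod V E G by (rule gp)
  let ?W = "graph_product V E G"
  define three where "three \<longleftrightarrow> w \<in> V \<and> w \<noteq> v \<and> {u, w} \<in> E \<and> {v, w} \<notin> E"
  have uw: "u \<noteq> w" if three using that W.no_loop[of u] by (auto simp: three_def)
  define K where "K = (if three then G w else singleton_group undefined)"
  define H where "H i = (if i then G u \<times>\<times> K else G v \<times>\<times> singleton_group undefined)" for i
  have K: "comm_group K" "finite (carrier K)" using G[of w] by (auto simp: K_def three_def)
  interpret K: comm_group K by (rule K)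
  interpret Gu: comm_group "G u" using G uv by simp
  interpret Gv: comm_group "G v" using G uv by simp
  have fp: "free_product2 H"
    using G uv K by (auto simp: free_product2_def H_def intro!: comm_group_DirProd)
  interpret P: free_product2 H by (rule fp)
  let ?P = "graph_product UNIV {} H"
  have HT: "H True = G u \<times>\<times> K" and HF: "H False = G v \<times>\<times> singleton_group undefined" by (auto simp: H_def)
  define h where "h x c = (if x = u then P.incl True (c, \<one>\<^bsub>K\<^esub>) else if x = w \<and> three then P.incl True (\<one>\<^bsub>G u\<^esub>, c)
      else if x = v then P.incl False (c, undefined) else \<one>\<^bsub>?P\<^esub>)" for x c
  have Kw: "K = G w" if three using that by (simp add: K_def)
  have multT: "P.incl True (a, b) \<otimes>\<^bsub>?P\<^esub> P.incl True (a', b') = P.incl True (a \<otimes>\<^bsub>G u\<^esub> a', b \<otimes>\<^bsub>K\<^esub> b')"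
    if "a \<in> carrier (G u)" "b \<in> carrier K" "a' \<in> carrier (G u)" "b' \<in> carrier K" for a b a' b'
    using that P.incl_mult[of True "(a, b)" "(a', b')"] by (simp add: HT)
  have multF: "P.incl False (a, undefined) \<otimes>\<^bsub>?P\<^esub> P.incl False (a', undefined) = P.incl False (a \<otimes>\<^bsub>G v\<^esub> a', undefined)"
    if "a \<in> carrier (G v)" "a' \<in> carrier (G v)" for a a'
    using that P.incl_mult[of False "(a, undefined)" "(a', undefined)"] by (simp add: HF singleton_group_def)
  have closedT: "P.incl True (a, b) \<in> carrier ?P" if "a \<in> carrier (G u)" "b \<in> carrier K" for a b
    using that by (simp add: HT)
  have closedF: "P.incl False (a, undefined) \<in> carrier ?P" if "a \<in> carrier (G v)" for a
    using that by (simp add: HF)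
  have h_u: "h u c = P.incl True (c, \<one>\<^bsub>K\<^esub>)" for c by (simp add: h_def)
  have h_w: "h w c = P.incl True (\<one>\<^bsub>G u\<^esub>, c)" if three for c using that uw by (simp add: h_def)
  have h_v: "h v c = P.incl False (c, undefined)" for c using uv by (auto simp: h_def three_def)
  have h_other: "h x c = \<one>\<^bsub>?P\<^esub>" if "x \<noteq> u" "\<not> (x = w \<and> three)" "x \<noteq> v" for x c using that by (auto simp: h_def)
  have hom_h: "h x \<in> hom (G x) ?P" if "x \<in> V" for x
  proof -
    consider "x = u" | "x = w" three | "x = v" | "x \<noteq> u" "\<not> (x = w \<and> three)" "x \<noteq> v" by blast
    then show ?thesis
    proof cases
      case 1
      then show ?thesis by (auto intro!: homI simp: h_u closedT multT)
    next
      case 2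
      then show ?thesis using Kw by (auto intro!: homI simp: h_w closedT multT)
    next
      case 3
      then show ?thesis by (auto intro!: homI simp: h_v closedF multF)
    next
      case 4
      then show ?thesis by (auto intro!: homI simp: h_other)
    qed
  qed
  have comm_h: "h x a \<otimes>\<^bsub>?P\<^esub> h y b = h y b \<otimes>\<^bsub>?P\<^esub> h x a"
    if xy: "{x, y} \<in> E" "x \<in> V" "y \<in> V" "a \<in> carrier (G x)" "b \<in> carrier (G y)" for x y a b
  proof -
    have hc: "h x a \<in> carrier ?P" "h y b \<in> carrier ?P" using hom_h xy by (auto simp: hom_def)
    have sym: "{y, x} \<in> E" using xy by (simp add: insert_commute)
    have "x \<noteq> y" using xy W.no_loop by auto
    \<comment> \<open>Only u, v and possibly w survive. The one edge among them joins u and w, and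
      their images commute inside the direct product.\<close>
    consider "h x a = \<one>\<^bsub>?P\<^esub> \<or> h y b = \<one>\<^bsub>?P\<^esub>" | "x = u" "y = w" "three" | "x = w" "y = u" "three"
    proof -
      have "(x = u \<and> y = w \<and> three) \<or> (x = w \<and> y = u \<and> three)"
        if "x = u \<or> (x = w \<and> three) \<or> x = v" "y = u \<or> (y = w \<and> three) \<or> y = v"
        using xy(1) sym uv \<open>x \<noteq> y\<close> that by (auto simp: three_def insert_commute)
      then show thesis using that h_other by metis
    qed
    then show ?thesis
    proof cases
      case 1
      then show ?thesis using hc by auto
    next
      case 2
      have b: "b \<in> carrier K" using xy 2 Kw by simp
      then show ?thesis using xy 2 multT[of a "\<one>\<^bsub>K\<^esub>" "\<one>\<^bsub>G u\<^esub>" b] multT[of "\<one>\<^bsub>G u\<^esub>" b a "\<one>\<^bsub>K\<^esub>"]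
        by (simp add: h_u h_w)
    next
      case 3
      have a: "a \<in> carrier K" using xy 3 Kw by simp
      then show ?thesis using xy 3 multT[of b "\<one>\<^bsub>K\<^esub>" "\<one>\<^bsub>G u\<^esub>" a] multT[of "\<one>\<^bsub>G u\<^esub>" a b "\<one>\<^bsub>K\<^esub>"]
        by (simp add: h_u h_w)
    qed
  qed
  obtain \<rho> where rho: "\<rho> \<in> hom ?W ?P" "\<And>x c. x \<in> V \<Longrightarrow> c \<in> carrier (G x) \<Longrightarrow> \<rho> (W.incl x c) = h x c"
    using W.hom_extension[OF P.group_W hom_h comm_h] by blast
  interpret rho: group_hom ?W ?P \<rho>
    using rho W.group_W P.group_W by (simp add: group_hom_def group_hom_axioms_def)
  define k where "k i p = (if i then W.incl u (fst p) \<otimes>\<^bsub>?W\<^esub> (if three then W.incl w (snd p) else \<one>\<^bsub>?W\<^esub>) else W.incl v (fst p))" for i and p :: "'g \<times> 'g"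
  have hom_k: "k i \<in> hom (H i) ?W" for i
  proof (cases i)
    case True
    show ?thesis
    proof (cases three)
      case False
      then show ?thesis using True uv unfolding k_def
        by (intro homI) (auto simp: HT W.incl_mult)
    next
      case three: True
      have w: "w \<in> V" "{u, w} \<in> E" using three by (auto simp: three_def)
      have "W.incl u (a \<otimes>\<^bsub>G u\<^esub> a') \<otimes>\<^bsub>?W\<^esub> W.incl w (b \<otimes>\<^bsub>G w\<^esub> b')
          = (W.incl u a \<otimes>\<^bsub>?W\<^esub> W.incl w b) \<otimes>\<^bsub>?W\<^esub> (W.incl u a' \<otimes>\<^bsub>?W\<^esub> W.incl w b')"
        if "a \<in> carrier (G u)" "a' \<in> carrier (G u)" "b \<in> carrier (G w)" "b' \<in> carrier (G w)" for a a' b b'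
      proof -
        have "W.incl w b \<otimes>\<^bsub>?W\<^esub> (W.incl u a' \<otimes>\<^bsub>?W\<^esub> W.incl w b') = W.incl u a' \<otimes>\<^bsub>?W\<^esub> (W.incl w b \<otimes>\<^bsub>?W\<^esub> W.incl w b')"
          using that uv w W.incl_commute[of u a' w b] by (simp add: W.W.m_assoc[symmetric])
        then show ?thesis using that uv w by (simp add: W.incl_mult W.W.m_assoc)
      qed
      then show ?thesis using True three uv w Kw[OF three] unfolding k_def
        by (intro homI) (auto simp: HT)
    qed
  next
    case False
    then show ?thesis using uv unfolding k_def by (intro homI) (auto simp: HF W.incl_mult)
  qed
  obtain \<sigma> where sigma: "\<sigma> \<in> hom ?P ?W" "\<And>i p. p \<in> carrier (H i) \<Longrightarrow> \<sigma> (P.incl i p) = k i p"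
    using P.hom_extension[OF W.group_W hom_k] by (metis UNIV_I empty_iff)
  interpret sigma: group_hom ?P ?W \<sigma>
    using sigma W.group_W P.group_W by (simp add: group_hom_def group_hom_axioms_def)
  have retr: "\<rho> (\<sigma> p) = p" if "p \<in> carrier ?P" for p
  proof (rule P.hom_eqI[OF _ _ P.group_W _ that, of "\<lambda>p. \<rho> (\<sigma> p)" "\<lambda>p. p"])
    show "(\<lambda>p. \<rho> (\<sigma> p)) \<in> hom ?P ?P" "(\<lambda>p. p) \<in> hom ?P ?P" by (auto intro!: homI)
    fix i p assume p: "p \<in> carrier (H i)"
    show "\<rho> (\<sigma> (P.incl i p)) = P.incl i p"
    proof (cases i)
      case True
      then obtain a b where ab: "p = (a, b)" "a \<in> carrier (G u)" "b \<in> carrier K" using p by (auto simp: HT)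
      show ?thesis
      proof (cases three)
        case three: True
        then have w: "w \<in> V" "K = G w" using Kw by (auto simp: three_def)
        have "\<rho> (\<sigma> (P.incl i p)) = P.incl True (a, \<one>\<^bsub>K\<^esub>) \<otimes>\<^bsub>?P\<^esub> P.incl True (\<one>\<^bsub>G u\<^esub>, b)"
          using p True three ab w uv uw[OF three] sigma(2)[OF p] by (simp add: k_def rho(2) h_def)
        also have "\<dots> = P.incl i p" using multT[of a "\<one>\<^bsub>K\<^esub>" "\<one>\<^bsub>G u\<^esub>" b] ab True by simp
        finally show ?thesis .
      next
        case False
        then have "b = \<one>\<^bsub>K\<^esub>" using ab by (simp add: K_def singleton_group_def)
        then show ?thesis using p True False ab uv sigma(2)[OF p] by (simp add: k_def rho(2) h_def)
      qed
    next
      case False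
      then obtain a where "p = (a, undefined)" "a \<in> carrier (G v)" using p by (auto simp: HF)
      then show ?thesis using p False uv sigma(2)[OF p] by (auto simp: k_def rho(2) h_def three_def)
    qed
  qed
  have gens: "\<rho> (W.incl x d) = \<one>\<^bsub>?P\<^esub> \<or> \<sigma> (\<rho> (W.incl x d)) = W.incl x d" if x: "x \<in> V" "d \<in> carrier (G x)" for x d
  proof -
    consider "x = u" | "x = w" "three" "x \<noteq> u" | "x = v" "\<not> (x = w \<and> three)" "x \<noteq> u" | "h x d = \<one>\<^bsub>?P\<^esub>"
      using h_other by blast
    then show ?thesis
    proof cases
      case 1
      then show ?thesis using x sigma(2)[of "(d, \<one>\<^bsub>K\<^esub>)" True] W.incl_one[of w] Kw
        by (auto simp: rho(2) h_def HT k_def three_def)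
    next
      case 2
      then show ?thesis using x sigma(2)[of "(\<one>\<^bsub>G u\<^esub>, d)" True] W.incl_one[OF uv(1)] Kw
        by (auto simp: rho(2) h_def HT k_def)
    next
      case 3
      then show ?thesis using x sigma(2)[of "(d, undefined)" False] by (auto simp: rho(2) h_def HF k_def)
    next
      case 4
      then show ?thesis using x rho(2) by simp
    qed
  qed
  have nontriv: "\<exists>c\<in>carrier (G x). c \<noteq> \<one>\<^bsub>G x\<^esub>" if "x \<in> V" for x
  proof -
    interpret comm_group "G x" using G that by simp
    show ?thesis using G that one_closed by blast
  qed
  obtain a b where ab: "a \<in> carrier (H True)" "b \<in> carrier (H True)" "a \<noteq> b" "a \<noteq> \<one>\<^bsub>H True\<^esub>" "b \<noteq> \<one>\<^bsub>H True\<^esub>"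
  proof (cases three)
    case True
    obtain c d where cd: "c \<in> carrier (G u)" "c \<noteq> \<one>\<^bsub>G u\<^esub>" "d \<in> carrier (G w)" "d \<noteq> \<one>\<^bsub>G w\<^esub>"
      using nontriv[OF uv(1)] nontriv[of w] True by (auto simp: three_def)
    show thesis
      \<comment> \<open>Elements of different coordinates are distinct and non-trivial, even when
        all vertex groups have order two.\<close>
      by (rule that[of "(c, \<one>\<^bsub>K\<^esub>)" "(\<one>\<^bsub>G u\<^esub>, d)"]) (use cd Kw[OF True] K.one_closed in \<open>auto simp: HT\<close>)
  next
    case False
    then obtain c d where "c \<in> carrier (G u)" "d \<in> carrier (G u)" "c \<noteq> d" "c \<noteq> \<one>\<^bsub>G u\<^esub>" "d \<noteq> \<one>\<^bsub>G u\<^esub>"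
      using cases by (auto simp: three_def)
    then show thesis by (intro that[of "(c, \<one>\<^bsub>K\<^esub>)" "(d, \<one>\<^bsub>K\<^esub>)"]) (auto simp: HT)
  qed
  obtain c where "c \<in> carrier (G v)" "c \<noteq> \<one>\<^bsub>G v\<^esub>" using nontriv[OF uv(2)] by blast
  then have c: "(c, undefined) \<in> carrier (H False)" "(c, undefined) \<noteq> \<one>\<^bsub>H False\<^esub>" by (auto simp: HF)
  show ?thesis
    using retract_quasimorphisms[OF gp finV _ fp ab c rho(1) sigma(1) retr gens] G by blast
qed

section \<open>Direct product decompositions\<close>

lemma ordered_prod_0 [simp]: "ordered_prod M 0 x = \<one>\<^bsub>M\<^esub>"
  by (simp add: ordered_prod_def)

lemma ordered_prod_cong: "(\<And>i. i < l \<Longrightarrow> x i = y i) \<Longrightarrow> ordered_prod M l x = ordered_prod M l y"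
  unfolding ordered_prod_def by (rule foldr_cong) auto

context group
begin

lemma ordered_prod_foldr:
  "(\<And>i. i \<in> set is \<Longrightarrow> x i \<in> carrier G) \<Longrightarrow> a \<in> carrier G \<Longrightarrow>
    foldr (\<lambda>i acc. x i \<otimes> acc) is \<one> \<in> carrier G \<and>
    foldr (\<lambda>i acc. x i \<otimes> acc) is a = foldr (\<lambda>i acc. x i \<otimes> acc) is \<one> \<otimes> a"
  by (induction "is") (auto simp: m_assoc)

lemma ordered_prod_closed: "(\<And>i. i < l \<Longrightarrow> x i \<in> carrier G) \<Longrightarrow> ordered_prod G l x \<in> carrier G"
  using ordered_prod_foldr[of "[0..<l]" x \<one>] by (simp add: ordered_prod_def)

lemma ordered_prod_Suc:
  assumes "\<And>i. i < Suc l \<Longrightarrow> x i \<in> carrier G"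
  shows "ordered_prod G (Suc l) x = ordered_prod G l x \<otimes> x l"
  using ordered_prod_foldr[of "[0..<l]" x "x l"] assms by (simp add: ordered_prod_def)

lemma ordered_prod_commute:
  assumes "\<And>i. i < l \<Longrightarrow> x i \<in> carrier G" "a \<in> carrier G" "\<And>i. i < l \<Longrightarrow> x i \<otimes> a = a \<otimes> x i"
  shows "ordered_prod G l x \<otimes> a = a \<otimes> ordered_prod G l x"
  using assms
proof (induction l)
  case (Suc l)
  have c: "ordered_prod G l x \<in> carrier G" using Suc.prems by (intro ordered_prod_closed) simp
  have "ordered_prod G l x \<otimes> x l \<otimes> a = ordered_prod G l x \<otimes> (a \<otimes> x l)"
    using c Suc.prems(1)[of l] Suc.prems(2) Suc.prems(3)[of l] by (simp add: m_assoc)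
  also have "\<dots> = (ordered_prod G l x \<otimes> a) \<otimes> x l" using c Suc.prems(1)[of l] Suc.prems(2) by (simp add: m_assoc)
  also have "\<dots> = a \<otimes> ordered_prod G l x \<otimes> x l" using Suc by simp
  finally show ?case using c Suc.prems by (simp add: ordered_prod_Suc m_assoc)
qed simp

text \<open>In the induction step \<open>x l\<close> moves left across the product of the earlier y,
  with which it commutes.\<close>

lemma ordered_prod_mult:
  assumes "\<And>i. i < l \<Longrightarrow> x i \<in> carrier G" "\<And>i. i < l \<Longrightarrow> y i \<in> carrier G"
    and "\<And>i j. i < l \<Longrightarrow> j < l \<Longrightarrow> i \<noteq> j \<Longrightarrow> y i \<otimes> x j = x j \<otimes> y i"
  shows "ordered_prod G l (\<lambda>i. x i \<otimes> y i) = ordered_prod G l x \<otimes> ordered_prod G l y"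
  using assms
proof (induction l)
  case (Suc l)
  let ?x = "ordered_prod G l x" and ?y = "ordered_prod G l y"
  have c: "?x \<in> carrier G" "?y \<in> carrier G" "x l \<in> carrier G" "y l \<in> carrier G"
    using Suc.prems(1,2) by (auto intro!: ordered_prod_closed)
  have "?y \<otimes> x l = x l \<otimes> ?y" using Suc.prems by (intro ordered_prod_commute) auto
  then have e: "?y \<otimes> (x l \<otimes> y l) = x l \<otimes> (?y \<otimes> y l)" using c by (simp add: m_assoc[symmetric])
  have "ordered_prod G (Suc l) (\<lambda>i. x i \<otimes> y i) = ordered_prod G l (\<lambda>i. x i \<otimes> y i) \<otimes> (x l \<otimes> y l)"
    using Suc.prems by (intro ordered_prod_Suc) auto
  also have "ordered_prod G l (\<lambda>i. x i \<otimes> y i) = ?x \<otimes> ?y" using Suc by auto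
  also have "?x \<otimes> ?y \<otimes> (x l \<otimes> y l) = (?x \<otimes> x l) \<otimes> (?y \<otimes> y l)" using c e by (simp add: m_assoc)
  finally show ?case using ordered_prod_Suc[of l x] ordered_prod_Suc[of l y] Suc.prems(1,2) by simp
qed simp

lemma ordered_prod_single:
  assumes "k < l" "\<And>i. i < l \<Longrightarrow> i \<noteq> k \<Longrightarrow> x i = \<one>" "x k \<in> carrier G"
  shows "ordered_prod G l x = x k"
  using assms
proof (induction l)
  case (Suc l)
  have x: "x i \<in> carrier G" if "i < Suc l" for i using Suc.prems that by (cases "i = k") auto
  show ?case
  proof (cases "k = l")
    case True
    have "ordered_prod G l x = ordered_prod G l (\<lambda>_. \<one>)" using True Suc.prems by (intro ordered_prod_cong) auto
    also have "\<dots> = \<one>" by (induction l) (auto simp: ordered_prod_Suc)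
    finally show ?thesis using x ordered_prod_Suc[OF x] True Suc.prems by simp
  next
    case False
    then have "ordered_prod G l x = x k" using Suc by auto
    then show ?thesis using ordered_prod_Suc[OF x] False Suc.prems by simp
  qed
qed simp

end

lemma (in group_hom) hom_ordered_prod:
  assumes "\<And>i. i < l \<Longrightarrow> x i \<in> carrier G"
  shows "h (ordered_prod G l x) = ordered_prod H l (\<lambda>i. h (x i))"
  using assms
proof (induction l)
  case (Suc l)
  have "ordered_prod G l x \<in> carrier G" using Suc.prems by (intro G.ordered_prod_closed) simp
  then show ?case using Suc by (simp add: G.ordered_prod_Suc H.ordered_prod_Suc)
qed simp

context graph_prod
begin

section \<open>Subgroups spanned by vertex sets\<close>

lemma gp_sub_simps [simp]: "monoid.mult (gp_sub V E G S) = monoid.mult W" "one (gp_sub V E G S) = \<one>\<^bsub>W\<^esub>"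
  by (auto simp: gp_sub_def)

lemma carrier_gp_sub:
  assumes "S \<subseteq> V" shows "carrier (gp_sub V E G S) = cls ` {w \<in> words. fst ` set w \<subseteq> S}" (is "_ = ?R")
proof -
  let ?X = "\<Union>v\<in>S. incl v ` carrier (G v)"
  have "x \<in> ?R" if "x \<in> generate W ?X" for x
    using that
  proof (induction rule: generate.induct)
    case one
    show ?case using one_eq by (intro image_eqI[of _ _ "[]"]) auto
  next
    case (incl h)
    then obtain v c where "v \<in> S" "c \<in> carrier (G v)" "h = cls [(v, c)]" by (auto simp: gp_incl_def)
    then show ?case using assms by (intro image_eqI[of _ _ "[(v, c)]"]) auto
  next
    case (inv h)
    then obtain v c where "v \<in> S" "c \<in> carrier (G v)" "h = cls [(v, c)]" by (auto simp: gp_incl_def)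
    then show ?case using assms inv_cls[of "[(v, c)]"] winv_words[of "[(v, c)]"]
      by (intro image_eqI[of _ _ "winv [(v, c)]"]) (auto simp: winv_Cons)
  next
    case (eng h1 h2)
    then obtain w1 w2 where "w1 \<in> words" "fst ` set w1 \<subseteq> S" "h1 = cls w1" "w2 \<in> words" "fst ` set w2 \<subseteq> S" "h2 = cls w2"
      by blast
    then show ?case by (intro image_eqI[of _ _ "w1 @ w2"]) (auto simp: mult_cls)
  qed
  moreover have "cls w \<in> generate W ?X" if "w \<in> words" "fst ` set w \<subseteq> S" for w
    using that
  proof (induction w)
    case Nil
    then show ?case using generate.one[of W ?X] one_eq by simp
  next
    case (Cons l w)
    have "incl (fst l) (snd l) \<in> generate W ?X" using Cons.prems by (intro generate.incl) auto
    from generate.eng[OF this] show ?case using Cons cls_Cons[of "fst l" "snd l" w] by simp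
  qed
  ultimately show ?thesis by (auto simp: gp_sub_def)
qed

lemma gp_subE:
  assumes "S \<subseteq> V" "g \<in> carrier (gp_sub V E G S)"
  obtains w where "w \<in> words" "fst ` set w \<subseteq> S" "g = cls w"
  using assms carrier_gp_sub by blast

lemma gp_sub_closed: "S \<subseteq> V \<Longrightarrow> g \<in> carrier (gp_sub V E G S) \<Longrightarrow> g \<in> carrier W"
  by (metis gp_subE cls_closed)

lemma group_gp_sub: "S \<subseteq> V \<Longrightarrow> group (gp_sub V E G S)"
  unfolding gp_sub_def by (intro W.subgroup_imp_group W.generate_is_subgroup) auto

lemma adjacent_words_commute:
  assumes "w \<in> words" "w' \<in> words" "\<And>k l. k \<in> set w \<Longrightarrow> l \<in> set w' \<Longrightarrow> {fst k, fst l} \<in> E"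
  shows "cls (w @ w') = cls (w' @ w)"
  using assms
proof (induction w)
  case (Cons l w)
  have "cls ((l # w) @ w') = cls ([l] @ (w @ w'))" by simp
  also have "\<dots> = cls ([l] @ (w' @ w))"
    by (rule cls_append_cong[OF refl]) (use Cons in auto)
  also have "\<dots> = cls (w' @ (l # w))"
    using cls_move_front[of w' "fst l" "snd l" w] Cons.prems by simp
  finally show ?case .
qed simp

text \<open>Serves to read off one coordinate of a product over disjoint vertex sets.\<close>

lemma vertex_retraction:
  obtains f where "f \<in> hom W W" "\<And>v c. v \<in> V \<Longrightarrow> c \<in> carrier (G v) \<Longrightarrow> f (incl v c) = (if v \<in> S then incl v c else \<one>\<^bsub>W\<^esub>)"
proof -
  have "(\<lambda>c. if v \<in> S then incl v c else \<one>\<^bsub>W\<^esub>) \<in> hom (G v) W" if "v \<in> V" for v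
    using that by (auto intro!: homI simp: incl_mult)
  moreover have "(if u \<in> S then incl u a else \<one>\<^bsub>W\<^esub>) \<otimes>\<^bsub>W\<^esub> (if v \<in> S then incl v b else \<one>\<^bsub>W\<^esub>)
      = (if v \<in> S then incl v b else \<one>\<^bsub>W\<^esub>) \<otimes>\<^bsub>W\<^esub> (if u \<in> S then incl u a else \<one>\<^bsub>W\<^esub>)"
    if "{u, v} \<in> E" "u \<in> V" "v \<in> V" "a \<in> carrier (G u)" "b \<in> carrier (G v)" for u v a b
    using that incl_commute[of u a v b] by auto
  ultimately show thesis
    using hom_extension[OF group_W, of "\<lambda>v c. if v \<in> S then incl v c else \<one>\<^bsub>W\<^esub>"] that by blast
qed

text \<open>Complete joins make the subgroups commute, so the map is a homomorphism. Surjectivity is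
  proved letter by letter. For injectivity, killing all vertices outside \<open>B k\<close> sends
  the product to its k-th factor.\<close>

theorem ordered_prod_iso:
  assumes B: "\<And>i. i < l \<Longrightarrow> B i \<subseteq> V" "(\<Union>i<l. B i) = V"
    and disj: "\<And>i j. i < l \<Longrightarrow> j < l \<Longrightarrow> i \<noteq> j \<Longrightarrow> B i \<inter> B j = {}"
    and adj: "\<And>i j u v. i < l \<Longrightarrow> j < l \<Longrightarrow> i \<noteq> j \<Longrightarrow> u \<in> B i \<Longrightarrow> v \<in> B j \<Longrightarrow> {u, v} \<in> E"
  shows "ordered_prod W l \<in> iso (product_group {..<l} (\<lambda>i. gp_sub V E G (B i))) W"
proof -
  let ?S = "\<lambda>i. gp_sub V E G (B i)"
  let ?\<Pi> = "product_group {..<l} ?S"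
  have S: "group (?S i)" if "i < l" for i using group_gp_sub B(1)[OF that] by blast
  have one: "\<one>\<^bsub>W\<^esub> \<in> carrier (?S i)" if "i < l" for i
    using monoid.one_closed[OF group.is_monoid[OF S[OF that]]] by simp
  have xc: "x i \<in> carrier W" "x i \<in> carrier (?S i)" if "x \<in> carrier ?\<Pi>" "i < l" for x i
    using that gp_sub_closed[OF B(1)] by (auto simp: PiE_def Pi_def)
  have comm: "x \<otimes>\<^bsub>W\<^esub> y = y \<otimes>\<^bsub>W\<^esub> x" if ij: "i < l" "j < l" "i \<noteq> j" and xy: "x \<in> carrier (?S i)" "y \<in> carrier (?S j)" for i j x y
  proof -
    obtain w where w: "w \<in> words" "fst ` set w \<subseteq> B i" "x = cls w" by (rule gp_subE[OF B(1)[OF ij(1)] xy(1)])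
    obtain w' where w': "w' \<in> words" "fst ` set w' \<subseteq> B j" "y = cls w'" by (rule gp_subE[OF B(1)[OF ij(2)] xy(2)])
    have "cls (w @ w') = cls (w' @ w)" using w w' adj[OF ij] by (intro adjacent_words_commute) blast+
    then show ?thesis using w w' by (simp add: mult_cls)
  qed
  have mult: "ordered_prod W l (x \<otimes>\<^bsub>?\<Pi>\<^esub> y) = ordered_prod W l x \<otimes>\<^bsub>W\<^esub> ordered_prod W l y"
    if "x \<in> carrier ?\<Pi>" "y \<in> carrier ?\<Pi>" for x y
  proof -
    have "ordered_prod W l (x \<otimes>\<^bsub>?\<Pi>\<^esub> y) = ordered_prod W l (\<lambda>i. x i \<otimes>\<^bsub>W\<^esub> y i)"
      by (rule ordered_prod_cong) simp
    also have "\<dots> = ordered_prod W l x \<otimes>\<^bsub>W\<^esub> ordered_prod W l y"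
      using xc that comm by (intro W.ordered_prod_mult) blast+
    finally show ?thesis .
  qed
  have closed: "x \<otimes>\<^bsub>?\<Pi>\<^esub> y \<in> carrier ?\<Pi>" if "x \<in> carrier ?\<Pi>" "y \<in> carrier ?\<Pi>" for x y
    using that monoid.m_closed[OF group.is_monoid[OF S]] by (fastforce simp: PiE_iff)
  have hom: "ordered_prod W l \<in> hom ?\<Pi> W"
    using mult xc by (intro homI) (auto intro!: W.ordered_prod_closed)
  have surj: "cls w \<in> ordered_prod W l ` carrier ?\<Pi>" if "w \<in> words" for w
    using that
  proof (induction w)
    case Nil
    have "ordered_prod W l (\<lambda>i\<in>{..<l}. \<one>\<^bsub>W\<^esub>) = ordered_prod W l (\<lambda>_. \<one>\<^bsub>W\<^esub>)" by (rule ordered_prod_cong) simp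
    also have "\<dots> = \<one>\<^bsub>W\<^esub>" by (induction l) (auto simp: W.ordered_prod_Suc)
    finally have "cls [] = ordered_prod W l (\<lambda>i\<in>{..<l}. \<one>\<^bsub>W\<^esub>)" using one_eq by simp
    moreover have "(\<lambda>i\<in>{..<l}. \<one>\<^bsub>W\<^esub>) \<in> carrier ?\<Pi>"
      using one by auto
    ultimately show ?case by blast
  next
    case (Cons p w)
    obtain v c where p: "p = (v, c)" by force
    have v: "v \<in> V" "c \<in> carrier (G v)" "w \<in> words" using Cons.prems p by auto
    then obtain k where k: "k < l" "v \<in> B k" using B(2) by blast
    obtain x where x: "x \<in> carrier ?\<Pi>" "cls w = ordered_prod W l x" using Cons v by blast
    define y where "y = (\<lambda>i\<in>{..<l}. if i = k then incl v c else \<one>\<^bsub>W\<^esub>)"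
    have "incl v c \<in> carrier (?S k)"
      using carrier_gp_sub[OF B(1)[OF k(1)]] k v by (auto simp: gp_incl_def intro!: image_eqI[of _ _ "[(v, c)]"])
    then have y: "y \<in> carrier ?\<Pi>"
      using one by (auto simp: y_def)
    have "ordered_prod W l y = incl v c"
      using W.ordered_prod_single[of k l y] k v by (simp add: y_def)
    then have "cls (p # w) = ordered_prod W l (y \<otimes>\<^bsub>?\<Pi>\<^esub> x)"
      using mult[OF y x(1)] x(2) p v cls_Cons by simp
    then show ?case using closed[OF y x(1)] by blast
  qed
  have inj: "x = y" if xy: "x \<in> carrier ?\<Pi>" "y \<in> carrier ?\<Pi>" and eq: "ordered_prod W l x = ordered_prod W l y" for x y
  proof -
    have "x k = y k" if k: "k < l" for k
    proof -
      obtain f where f: "f \<in> hom W W" "\<And>v c. v \<in> V \<Longrightarrow> c \<in> carrier (G v) \<Longrightarrow> f (incl v c) = (if v \<in> B k then incl v c else \<one>\<^bsub>W\<^esub>)"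
        using vertex_retraction[of "B k"] by blast
      interpret f: group_hom W W f using f(1) group_W by (simp add: group_hom_def group_hom_axioms_def)
      have f1: "f (cls w) = cls w" if "w \<in> words" "fst ` set w \<subseteq> B k" for w
        using that
      proof (induction w)
        case Nil
        then show ?case using f.hom_one one_eq by simp
      next
        case (Cons p w)
        then show ?case using cls_Cons[of "fst p" "snd p" w] f(2)[of "fst p" "snd p"] by simp
      qed
      have f0: "f (cls w) = \<one>\<^bsub>W\<^esub>" if "w \<in> words" "fst ` set w \<inter> B k = {}" for w
        using that
      proof (induction w)
        case Nil
        then show ?case using f.hom_one one_eq by simp
      next
        case (Cons p w)
        then show ?case using cls_Cons[of "fst p" "snd p" w] f(2)[of "fst p" "snd p"] by simp
      qed
      have "f (ordered_prod W l z) = z k" if z: "z \<in> carrier ?\<Pi>" for z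
      proof -
        have "f (z i) = (if i = k then z k else \<one>\<^bsub>W\<^esub>)" if i: "i < l" for i
        proof -
          obtain w where "w \<in> words" "fst ` set w \<subseteq> B i" "z i = cls w"
            by (rule gp_subE[OF B(1)[OF i] xc(2)[OF z i]])
          then show ?thesis using f1[of w] f0[of w] disj[OF i k] by auto
        qed
        then have "ordered_prod W l (\<lambda>i. f (z i)) = z k"
          using W.ordered_prod_single[OF k, of "\<lambda>i. f (z i)"] k xc[OF z k] by simp
        then show ?thesis using f.hom_ordered_prod[of l z] xc[OF z] by simp
      qed
      then show ?thesis using xy eq by metis
    qed
    then show ?thesis using xy by (auto intro!: PiE_ext[of x "{..<l}" "\<lambda>i. carrier (?S i)"])
  qed
  have "bij_betw (ordered_prod W l) (carrier ?\<Pi>) (carrier W)"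
    unfolding bij_betw_def
  proof
    show "inj_on (ordered_prod W l) (carrier ?\<Pi>)" using inj by (rule inj_onI)
    show "ordered_prod W l ` carrier ?\<Pi> = carrier W"
    proof
      show "ordered_prod W l ` carrier ?\<Pi> \<subseteq> carrier W" using hom_in_carrier[OF hom] by blast
      show "carrier W \<subseteq> ordered_prod W l ` carrier ?\<Pi>" unfolding carrier_eq using surj by blast
    qed
  qed
  with hom show ?thesis by (simp add: iso_def)
qed

lemma gp_sub_singleton:
  assumes "v \<in> V" "comm_group (G v)" "finite (carrier (G v))"
  shows "finite (carrier (gp_sub V E G {v}))" "comm_group (gp_sub V E G {v})"
proof -
  interpret Gv: comm_group "G v" by fact
  have "cls w \<in> incl v ` carrier (G v)" if "w \<in> words" "fst ` set w \<subseteq> {v}" for w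
    using that
  proof (induction w)
    case Nil
    then show ?case using incl_one[OF assms(1)] one_eq Gv.one_closed by (metis image_eqI)
  next
    case (Cons l w)
    then obtain c where "c \<in> carrier (G v)" "cls w = incl v c" by auto
    then have "cls (l # w) = incl v (snd l \<otimes>\<^bsub>G v\<^esub> c)" "snd l \<otimes>\<^bsub>G v\<^esub> c \<in> carrier (G v)"
      using Cons.prems cls_Cons[of v "snd l" w] incl_mult[of v "snd l" c] by (cases l; auto)+
    then show ?case by blast
  qed
  then have sub: "carrier (gp_sub V E G {v}) \<subseteq> incl v ` carrier (G v)"
    using carrier_gp_sub[of "{v}"] assms(1) by auto
  then show "finite (carrier (gp_sub V E G {v}))" using assms(3) finite_subset by blast
  show "comm_group (gp_sub V E G {v})"
  proof (rule group.group_comm_groupI)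
    show "group (gp_sub V E G {v})" using group_gp_sub assms by simp
    fix x y assume "x \<in> carrier (gp_sub V E G {v})" "y \<in> carrier (gp_sub V E G {v})"
    then obtain a b where "a \<in> carrier (G v)" "b \<in> carrier (G v)" "x = incl v a" "y = incl v b" using sub by blast
    then show "x \<otimes>\<^bsub>gp_sub V E G {v}\<^esub> y = y \<otimes>\<^bsub>gp_sub V E G {v}\<^esub> x"
      using assms(1) by (metis gp_sub_simps(1) incl_mult Gv.m_comm)
  qed
qed

text \<open>Both directions come from universal properties. The map to \<open>Zk\<close> is built on
  all of W, killing the vertices outside S, and then restricted to the subgroup.\<close>

lemma gp_sub_Zk:
  assumes S: "S \<subseteq> V" "finite S" "\<And>u v. u \<in> S \<Longrightarrow> v \<in> S \<Longrightarrow> {u, v} \<notin> E"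
    and t: "\<And>v. v \<in> S \<Longrightarrow> t v \<noteq> \<one>\<^bsub>G v\<^esub> \<and> carrier (G v) = {\<one>\<^bsub>G v\<^esub>, t v}"
  shows "gp_sub V E G S \<cong> Zk (card S)"
proof -
  let ?k = "card S"
  interpret Z: graph_prod "{..<?k}" "{}" "\<lambda>_. integer_mod_group 2" by (simp add: graph_prod_def)
  let ?Z = "graph_product {..<?k} {} (\<lambda>_. integer_mod_group 2)"
  have C2: "carrier (integer_mod_group 2) = {0, 1}" by (auto simp: carrier_integer_mod_group)
  obtain e where e: "bij_betw e {..<?k} S"
    using ex_bij_betw_nat_finite[OF S(2)] by (auto simp: lessThan_atLeast0)
  define d where "d = inv_into {..<?k} e"
  have d: "d v < ?k" "e (d v) = v" if "v \<in> S" for v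
    using that e bij_betw_inv_into[OF e] by (auto simp: d_def bij_betw_def f_inv_into_f inv_into_into dest: inv_into_into)
  have ed: "d (e i) = i" "e i \<in> S" if "i < ?k" for i using that e by (auto simp: d_def bij_betw_def)
  \<comment> \<open>If the square were not the identity it would be \<open>t v\<close> itself, and
    cancelling would make \<open>t v\<close> trivial.\<close>
  have tt: "t v \<otimes>\<^bsub>G v\<^esub> t v = \<one>\<^bsub>G v\<^esub>" "t v \<in> carrier (G v)" if "v \<in> S" for v
  proof -
    interpret Gv: group "G v" using vertex_group S(1) that by blast
    show tv: "t v \<in> carrier (G v)" using t[OF that] by simp
    have "t v \<otimes>\<^bsub>G v\<^esub> t v \<in> {\<one>\<^bsub>G v\<^esub>, t v}" using tv t[OF that] Gv.m_closed[OF tv tv] by simp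
    then show "t v \<otimes>\<^bsub>G v\<^esub> t v = \<one>\<^bsub>G v\<^esub>" using tv t[OF that] Gv.l_cancel_one by auto
  qed
  define f where "f i n = (if n = (0::int) then \<one>\<^bsub>W\<^esub> else incl (e i) (t (e i)))" for i n
  have fh: "f i \<in> hom (integer_mod_group 2) W" if "i \<in> {..<?k}" for i
  proof (rule homI)
    have i: "e i \<in> S" "e i \<in> V" using ed that S(1) by auto
    have sq: "incl (e i) (t (e i)) \<otimes>\<^bsub>W\<^esub> incl (e i) (t (e i)) = \<one>\<^bsub>W\<^esub>"
      using incl_mult[OF i(2) tt(2)[OF i(1)] tt(2)[OF i(1)]] incl_one[OF i(2)] tt(1)[OF i(1)] by metis
    have cl: "incl (e i) (t (e i)) \<in> carrier W" using i tt by simp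
    show "f i n \<in> carrier W" if "n \<in> carrier (integer_mod_group 2)" for n
      using cl by (simp add: f_def)
    show "f i (m \<otimes>\<^bsub>integer_mod_group 2\<^esub> n) = f i m \<otimes>\<^bsub>W\<^esub> f i n"
      if "m \<in> carrier (integer_mod_group 2)" "n \<in> carrier (integer_mod_group 2)" for m n
      using that sq cl by (auto simp only: C2 insert_iff empty_iff) (simp_all add: f_def)
  qed
  obtain F where F: "F \<in> hom ?Z W"
    "\<And>i n. i \<in> {..<?k} \<Longrightarrow> n \<in> carrier (integer_mod_group 2) \<Longrightarrow> F (Z.incl i n) = f i n"
    using Z.hom_extension[OF group_W, of f, OF fh] by blast
  define h where "h v c = (if v \<in> S \<and> c \<noteq> \<one>\<^bsub>G v\<^esub> then Z.incl (d v) 1 else \<one>\<^bsub>?Z\<^esub>)" for v c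
  have Z11: "Z.incl i 1 \<otimes>\<^bsub>?Z\<^esub> Z.incl i 1 = \<one>\<^bsub>?Z\<^esub>" if "i < ?k" for i
    using Z.incl_mult[of i 1 1] Z.incl_one[of i] that by (simp add: C2)
  have hh: "h v \<in> hom (G v) ?Z" if "v \<in> V" for v
  proof (cases "v \<in> S")
    case True
    interpret Gv: group "G v" using vertex_group that by blast
    show ?thesis
    proof (rule homI)
      show "h v c \<in> carrier ?Z" for c using d[OF True] by (auto simp: h_def C2)
      show "h v (b \<otimes>\<^bsub>G v\<^esub> c) = h v b \<otimes>\<^bsub>?Z\<^esub> h v c" if bc: "b \<in> carrier (G v)" "c \<in> carrier (G v)" for b c
      proof -
        have "b = \<one>\<^bsub>G v\<^esub> \<or> b = t v" "c = \<one>\<^bsub>G v\<^esub> \<or> c = t v" using bc t[OF True] by auto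
        then show ?thesis using True tt[OF True] t[OF True] d[OF True] Z11 by (auto simp: h_def C2)
      qed
    qed
  next
    case False
    then show ?thesis by (auto intro!: homI simp: h_def)
  qed
  have hcomm: "h u a \<otimes>\<^bsub>?Z\<^esub> h v b = h v b \<otimes>\<^bsub>?Z\<^esub> h u a"
    if uv: "{u, v} \<in> E" "u \<in> V" "v \<in> V" "a \<in> carrier (G u)" "b \<in> carrier (G v)" for u v a b
  proof -
    have "h u a \<in> carrier ?Z" "h v b \<in> carrier ?Z" using hh uv by (auto simp: hom_def)
    moreover have "u \<notin> S \<or> v \<notin> S" using S(3) uv by blast
    ultimately show ?thesis by (auto simp: h_def)
  qed
  obtain F' where F': "F' \<in> hom W ?Z" "\<And>v c. v \<in> V \<Longrightarrow> c \<in> carrier (G v) \<Longrightarrow> F' (incl v c) = h v c"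
    using hom_extension[OF Z.group_W hh hcomm] by blast
  interpret F: group_hom ?Z W F using F(1) group_W Z.group_W by (simp add: group_hom_def group_hom_axioms_def)
  interpret F': group_hom W ?Z F' using F'(1) group_W Z.group_W by (simp add: group_hom_def group_hom_axioms_def)
  have F'F: "F' (F x) = x" if "x \<in> carrier ?Z" for x
  proof (rule Z.hom_eqI[OF _ _ Z.group_W _ that, of "\<lambda>x. F' (F x)" "\<lambda>x. x"])
    show "(\<lambda>x. F' (F x)) \<in> hom ?Z ?Z" "(\<lambda>x. x) \<in> hom ?Z ?Z" by (auto intro!: homI)
    fix i n assume i: "i \<in> {..<?k}" "n \<in> carrier (integer_mod_group 2)"
    have "e i \<in> S" "e i \<in> V" using ed i S(1) by auto
    then show "F' (F (Z.incl i n)) = Z.incl i n"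
      using i F(2)[of i n] F'(2)[of "e i" "t (e i)"] tt[of "e i"] t[of "e i"] ed[of i] Z.incl_one[of i]
      by (auto simp: C2 f_def h_def)
  qed
  have FF': "F (F' (cls w)) = cls w" if "w \<in> words" "fst ` set w \<subseteq> S" for w
    using that
  proof (induction w)
    case Nil
    then show ?case using F'.hom_one F.hom_one one_eq by simp
  next
    case (Cons p w)
    have p: "fst p \<in> S" "fst p \<in> V" "snd p \<in> carrier (G (fst p))" using Cons.prems by auto
    have "F (F' (incl (fst p) (snd p))) = incl (fst p) (snd p)"
      using p F'(2)[of "fst p" "snd p"] F(2)[of "d (fst p)" 1] d[of "fst p"] t[of "fst p"] incl_one[of "fst p"]
      by (auto simp: h_def f_def C2)
    then show ?case using Cons p cls_Cons[of "fst p" "snd p" w] by simp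
  qed
  have F_sub: "F x \<in> carrier (gp_sub V E G S)" if "x \<in> carrier ?Z" for x
  proof -
    interpret Sg: group "gp_sub V E G S" using group_gp_sub[OF S(1)] .
    have "F (Z.cls w) \<in> carrier (gp_sub V E G S)" if "w \<in> Z.words" for w
      using that
    proof (induction w)
      case Nil
      then show ?case using F.hom_one Z.one_eq Sg.one_closed by simp
    next
      case (Cons p w)
      have p: "fst p < ?k" "snd p \<in> carrier (integer_mod_group 2)" using Cons.prems by auto
      have "incl (e (fst p)) (t (e (fst p))) \<in> carrier (gp_sub V E G S)"
        using carrier_gp_sub[OF S(1)] ed[OF p(1)] S(1) tt
        by (auto simp: gp_incl_def intro!: image_eqI[of _ _ "[(e (fst p), t (e (fst p)))]"])
      then have "f (fst p) (snd p) \<in> carrier (gp_sub V E G S)" using Sg.one_closed by (simp add: f_def)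
      moreover have "F (Z.cls (p # w)) = f (fst p) (snd p) \<otimes>\<^bsub>W\<^esub> F (Z.cls w)"
        using Cons.prems p Z.cls_Cons[of "fst p" "snd p" w] F(2) by simp
      ultimately show ?case using Cons Sg.m_closed by simp
    qed
    then show ?thesis using that Z.carrierE by metis
  qed
  have "F' \<in> hom (gp_sub V E G S) ?Z"
    using gp_sub_closed[OF S(1)] by (intro homI) auto
  moreover have "bij_betw F' (carrier (gp_sub V E G S)) (carrier ?Z)"
  proof (rule bij_betwI[of _ _ _ F])
    show "F' \<in> carrier (gp_sub V E G S) \<rightarrow> carrier ?Z" using gp_sub_closed[OF S(1)] by auto
    show "F \<in> carrier ?Z \<rightarrow> carrier (gp_sub V E G S)" using F_sub by auto
    show "F (F' x) = x" if "x \<in> carrier (gp_sub V E G S)" for x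
      using that FF' gp_subE[OF S(1)] by metis
    show "F' (F x) = x" if "x \<in> carrier ?Z" for x using F'F that .
  qed
  ultimately show ?thesis by (auto simp: is_iso_def iso_def Zk_def)
qed

end

theorem theorem6p17:
  fixes V :: "'v set" and E :: "'v set set" and G :: "'v \<Rightarrow> 'g monoid"
  assumes graph: "finite_graph V E"
    and vgroups: "\<forall>v\<in>V. comm_group (G v) \<and> finite (carrier (G v)) \<and> carrier (G v) \<noteq> {\<one>\<^bsub>G v\<^esub>}"
    and no_decomp: "\<not> (\<exists>(l::nat) (B :: nat \<Rightarrow> 'v set).
          l \<ge> 1 \<and> (\<forall>i<l. B i \<noteq> {}) \<and> (\<forall>i<l. \<forall>j<l. i \<noteq> j \<longrightarrow> B i \<inter> B j = {})
          \<and> (\<Union>i<l. B i) = V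
          \<and> ordered_prod (graph_product V E G) l
              \<in> iso (product_group {..<l} (\<lambda>i. gp_sub V E G (B i))) (graph_product V E G)
          \<and> (\<forall>i<l. (\<exists>k\<ge>1. gp_sub V E G (B i) \<cong> Zk k)
                   \<or> (finite (carrier (gp_sub V E G (B i))) \<and> comm_group (gp_sub V E G (B i)))))"
  shows "\<exists>Q :: (('v \<times> 'g) list set \<Rightarrow> real) set. infinite Q
           \<and> (\<forall>\<psi>\<in>Q. quasimorphism (graph_product V E G) \<psi>
                    \<and> homogeneous_qm (graph_product V E G) \<psi>
                    \<and> aut_invariant (graph_product V E G) \<psi>)
           \<and> lin_indep_funs (graph_product V E G) Q"
proof (rule ccontr)
  assume none: "\<not> ?thesis"
  have finV: "finite V" "V \<noteq> {}" using graph by (auto simp: finite_graph_def)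
  have no_loop: "{v} \<notin> E" for v
  proof
    assume "{v} \<in> E"
    then obtain x y where "{v} = {x, y}" "x \<noteq> y" using graph unfolding finite_graph_def by metis
    then show False by auto
  qed
  interpret W: graph_prod V E G
    using vgroups no_loop by (auto simp: graph_prod_def comm_group_def)
  have gp: "graph_prod V E G" by unfold_locales
  have config: False if "u \<in> V" "v \<in> V" "u \<noteq> v" "{u, v} \<notin> E"
    and "(w \<in> V \<and> w \<noteq> v \<and> {u, w} \<in> E \<and> {v, w} \<notin> E) \<or>
      (\<exists>a\<in>carrier (G u). \<exists>b\<in>carrier (G u). a \<noteq> b \<and> a \<noteq> \<one>\<^bsub>G u\<^esub> \<and> b \<noteq> \<one>\<^bsub>G u\<^esub>)" for u v w
    using quasimorphisms_of_configuration[OF gp finV(1) _ that] vgroups none by blast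
  \<comment> \<open>The classes of this relation will be the blocks. It is reflexive because there
    are no loops; if u, v and v, w are non-adjacent but u, w are adjacent, the first configuration
    appears.\<close>
  define R where "R = {(u, v). u \<in> V \<and> v \<in> V \<and> {u, v} \<notin> E}"
  have "equiv V R"
  proof (rule equivI)
    show "R \<subseteq> V \<times> V" by (auto simp: R_def)
    show "refl_on V R" using no_loop by (auto simp: R_def refl_on_def)
    show "sym R" by (auto simp: R_def sym_def insert_commute)
    show "trans R"
    proof (rule transI)
      fix u v w assume uvw: "(u, v) \<in> R" "(v, w) \<in> R"
      show "(u, w) \<in> R"
      proof (rule ccontr)
        assume "(u, w) \<notin> R"
        then have "{u, w} \<in> E" using uvw by (auto simp: R_def)
        then show False using config[of u v w] uvw by (cases "u = v"; cases "v = w") (auto simp: R_def)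
      qed
    qed
  qed
  have "finite (V // R)" using finV(1) \<open>equiv V R\<close> by (intro finite_quotient) (auto simp: equiv_def)
  define l where "l = card (V // R)"
  obtain B where B: "bij_betw B {..<l} (V // R)"
    using ex_bij_betw_nat_finite[OF \<open>finite (V // R)\<close>] by (auto simp: l_def lessThan_atLeast0)
  have Bq: "B i \<in> V // R" if "i < l" for i using B that by (auto simp: bij_betw_def)
  have "V // R \<noteq> {}" using finV(2) by (auto simp: quotient_def)
  then have "l \<ge> 1" using \<open>finite (V // R)\<close> by (simp add: l_def Suc_leI card_gt_0_iff)
  moreover have ne: "\<forall>i<l. B i \<noteq> {}" using Bq in_quotient_imp_non_empty[OF \<open>equiv V R\<close>] by blast
  moreover have disj: "\<forall>i<l. \<forall>j<l. i \<noteq> j \<longrightarrow> B i \<inter> B j = {}"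
    using Bq B quotient_disj[OF \<open>equiv V R\<close>] by (metis bij_betw_def inj_on_def lessThan_iff)
  moreover have un: "(\<Union>i<l. B i) = V"
    using B Union_quotient[OF \<open>equiv V R\<close>] by (auto simp: bij_betw_def)
  moreover have sub: "B i \<subseteq> V" if "i < l" for i using un that by blast
  have inR: "{u, v} \<notin> E" if "i < l" "u \<in> B i" "v \<in> B i" for i u v
    using quotient_eq_iff[OF \<open>equiv V R\<close> Bq[OF that(1)] Bq[OF that(1)] that(2,3)] by (simp add: R_def)
  have adj: "{u, v} \<in> E" if "i < l" "j < l" "i \<noteq> j" "u \<in> B i" "v \<in> B j" for i j u v
  proof (rule ccontr)
    assume "{u, v} \<notin> E"
    then have "(u, v) \<in> R" using that sub by (auto simp: R_def)
    then have "B i = B j"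
      using quotient_eq_iff[OF \<open>equiv V R\<close> Bq[OF that(1)] Bq[OF that(2)] that(4,5)] by simp
    then show False using that disj by blast
  qed
  moreover have "ordered_prod (graph_product V E G) l
              \<in> iso (product_group {..<l} (\<lambda>i. gp_sub V E G (B i))) (graph_product V E G)"
    using disj un sub adj by (intro W.ordered_prod_iso) blast+
  moreover have "(\<exists>k\<ge>1. gp_sub V E G (B i) \<cong> Zk k)
                   \<or> (finite (carrier (gp_sub V E G (B i))) \<and> comm_group (gp_sub V E G (B i)))" if i: "i < l" for i
  proof (cases "\<exists>v. B i = {v}")
    case True
    then show ?thesis using W.gp_sub_singleton vgroups sub[OF i] by auto
  next
    case False
    \<comment> \<open>A second vertex of the class is not adjacent to u, so a third element in
      \<open>G u\<close> would give the second configuration.\<close>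
    have "\<exists>t. t \<noteq> \<one>\<^bsub>G u\<^esub> \<and> carrier (G u) = {\<one>\<^bsub>G u\<^esub>, t}" if u: "u \<in> B i" for u
    proof -
      have uV: "u \<in> V" using sub i u by blast
      interpret Gu: group "G u" using W.vertex_group uV by blast
      obtain v where v: "v \<in> B i" "v \<noteq> u" using False u by blast
      then have "\<not> (\<exists>a\<in>carrier (G u). \<exists>b\<in>carrier (G u). a \<noteq> b \<and> a \<noteq> \<one>\<^bsub>G u\<^esub> \<and> b \<noteq> \<one>\<^bsub>G u\<^esub>)"
        using config[of u v] uV sub[OF i] inR[OF i u v(1)] by blast
      moreover obtain t where "t \<in> carrier (G u)" "t \<noteq> \<one>\<^bsub>G u\<^esub>" using vgroups uV Gu.one_closed by blast
      ultimately show ?thesis using Gu.one_closed by blast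
    qed
    then obtain t where "\<forall>u\<in>B i. t u \<noteq> \<one>\<^bsub>G u\<^esub> \<and> carrier (G u) = {\<one>\<^bsub>G u\<^esub>, t u}" by metis
    moreover have "finite (B i)" using finV(1) sub[OF i] finite_subset by blast
    ultimately have "gp_sub V E G (B i) \<cong> Zk (card (B i))"
      using inR[OF i] by (intro W.gp_sub_Zk[OF sub[OF i], of t]) auto
    moreover have "card (B i) \<ge> 1" using \<open>finite (B i)\<close> ne i by (simp add: Suc_leI card_gt_0_iff)
    ultimately show ?thesis by blast
  qed
  ultimately show False using no_decomp by blast
qed

end
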